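(* Let $M^{n}$, $n\geq 3$, be an $n$-dimensional submanifold of an $m$-dimensional conformally flat Riemannian manifold $(\widetilde{M}^{m},\widetilde{g})$, $m\geq 4$. Suppose that along $M^n$ $$\frac{2}{n(m-2)}\sum_{j=1}^{n}\widetilde{\operatorname{Ric}}(e_{j},e_{j})-\frac{2\widetilde{\tau}}{(m-1)(m-2)}\leq 0,$$ where $\{e_j\}_{1\le j\le n}$ is a local orthonormal tangent frame of $M^n$. If $\rho+\rho^{\perp}>0$ at some point of $M^n$, then $M^{n}$ is not minimal at that point. In particular, there exists no minimal immersion of $M^n$ into $(\widetilde{M}^{m},\widetilde{g})$ satisfying the ambient curvature condition $\frac{2}{n(m-2)}\sum_{j=1}^{n}\widetilde{\operatorname{Ric}}(e_{j},e_{j})-\frac{2\widetilde{\tau}}{(m-1)(m-2)}\leq 0$ along $M^n$ and $\rho+\rho^{\perp}>0$ everywhere.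
   Context: $g$ is the metric induced on $M^n$ by $\widetilde g$; $h$ is the second fundamental form and $H=\frac1n\operatorname{trace} h$ the mean curvature vector; $M^n$ is minimal at a point if $H=0$ there, and minimal if $H=0$ everywhere. $\widetilde{\operatorname{Ric}}$ is the Ricci tensor of $(\widetilde M^m,\widetilde g)$ and $\widetilde\tau$ is its scalar curvature normalized so that $2\widetilde\tau=\operatorname{trace}_{\widetilde g}\widetilde{\operatorname{Ric}}$. The normalized scalar curvature of $M^n$ is $\rho=\frac{2}{n(n-1)}\sum_{1\le i<j\le n}\sigma(e_i\wedge e_j)$, where $\sigma$ is the sectional curvature of $(M^n,g)$. The normalized normal scalar curvature is $\rho^\perp=\frac{2}{n(n-1)}\sqrt{\sum_{1\le i<j\le n}\sum_{1\le r<s\le m-n}\left(R^\perp(e_i,e_j,\upsilon_r,\upsilon_s)\right)^2}$, where $R^\perp$ is the curvature tensor of the normal connection and $\{\upsilon_r\}_{1\le r\le m-n}$ is a local orthonormal normal frame. For $m\ge4$, conformally flat is equivalent to vanishing of the Weyl tensor of $\widetilde g$. *)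

theory Defs
  imports "HOL-Analysis.Analysis"
begin

section \<open>Smooth maps between open subsets of Euclidean spaces\<close>

text \<open>To be used on open sets. On a finite-dimensional domain, \<open>Ck_on k S f\<close> says that all
  iterated directional derivatives of \<open>f\<close> up to order \<open>k\<close> exist and are continuous on \<open>S\<close>.\<close>

primrec Ck_on :: "nat \<Rightarrow> 'a::real_normed_vector set \<Rightarrow> ('a \<Rightarrow> 'b::real_normed_vector) \<Rightarrow> bool" where
  "Ck_on 0 S f \<longleftrightarrow> continuous_on S f"
| "Ck_on (Suc k) S f \<longleftrightarrow>
     (\<forall>x\<in>S. f differentiable (at x)) \<and> (\<forall>v. Ck_on k S (\<lambda>x. frechet_derivative f (at x) v))"

definition smooth_on :: "'a::real_normed_vector set \<Rightarrow> ('a \<Rightarrow> 'b::real_normed_vector) \<Rightarrow> bool" where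
  "smooth_on S f \<longleftrightarrow> (\<forall>k. Ck_on k S f)"

definition pd :: "'n::finite \<Rightarrow> (real^'n \<Rightarrow> 'b::real_normed_vector) \<Rightarrow> real^'n \<Rightarrow> 'b" where
  "pd i f x = frechet_derivative f (at x) (axis i 1)"

section \<open>Riemannian geometry in local coordinates\<close>

text \<open>\<open>G :: real^'m \<Rightarrow> real^'m^'m\<close> is the matrix of components of a metric in a coordinate system.\<close>

definition ginner :: "(real^'m \<Rightarrow> real^'m^'m) \<Rightarrow> real^'m \<Rightarrow> real^'m \<Rightarrow> real^'m \<Rightarrow> real" where
  "ginner G y u v = u \<bullet> (G y *v v)"

text \<open>\<open>christoffel G k i j y\<close> is $\Gamma^k_{ij}(y)$.\<close>

definition christoffel ::
  "(real^'m::finite \<Rightarrow> real^'m^'m) \<Rightarrow> 'm \<Rightarrow> 'm \<Rightarrow> 'm \<Rightarrow> real^'m \<Rightarrow> real" where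
  "christoffel G k i j y =
     (1/2) * (\<Sum>l\<in>UNIV. matrix_inv (G y) $ k $ l *
        (pd i (\<lambda>z. G z $ j $ l) y + pd j (\<lambda>z. G z $ i $ l) y - pd l (\<lambda>z. G z $ i $ j) y))"

definition christoffel_vec ::
  "(real^'m::finite \<Rightarrow> real^'m^'m) \<Rightarrow> real^'m \<Rightarrow> real^'m \<Rightarrow> real^'m \<Rightarrow> real^'m" where
  "christoffel_vec G y u v =
     (\<chi> k. \<Sum>i\<in>UNIV. \<Sum>j\<in>UNIV. christoffel G k i j y * u $ i * v $ j)"

text \<open>\<open>riem_comp G l i j k y\<close> is the \<open>l\<close>-th component of $R(\partial_i,\partial_j)\partial_k$ at \<open>y\<close>, where
  $R(X,Y)Z = \nabla_X\nabla_Y Z - \nabla_Y\nabla_X Z - \nabla_{[X,Y]}Z$.\<close>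

definition riem_comp ::
  "(real^'m::finite \<Rightarrow> real^'m^'m) \<Rightarrow> 'm \<Rightarrow> 'm \<Rightarrow> 'm \<Rightarrow> 'm \<Rightarrow> real^'m \<Rightarrow> real" where
  "riem_comp G l i j k y =
     pd i (christoffel G l j k) y - pd j (christoffel G l i k) y
     + (\<Sum>s\<in>UNIV. christoffel G l i s y * christoffel G s j k y
                  - christoffel G l j s y * christoffel G s i k y)"

definition riem ::
  "(real^'m::finite \<Rightarrow> real^'m^'m) \<Rightarrow> real^'m \<Rightarrow> real^'m \<Rightarrow> real^'m \<Rightarrow> real^'m \<Rightarrow> real^'m" where
  "riem G y u v w =
     (\<chi> l. \<Sum>i\<in>UNIV. \<Sum>j\<in>UNIV. \<Sum>k\<in>UNIV. riem_comp G l i j k y * u $ i * v $ j * w $ k)"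

definition sectional_curvature ::
  "(real^'m::finite \<Rightarrow> real^'m^'m) \<Rightarrow> real^'m \<Rightarrow> real^'m \<Rightarrow> real^'m \<Rightarrow> real" where
  "sectional_curvature G y u v =
     ginner G y (riem G y u v v) u /
       (ginner G y u u * ginner G y v v - (ginner G y u v)\<^sup>2)"

text \<open>$\mathrm{Ric}(v,w)$ is the trace of $u \mapsto R(u,v)w$.\<close>

definition ricci :: "(real^'m::finite \<Rightarrow> real^'m^'m) \<Rightarrow> real^'m \<Rightarrow> real^'m \<Rightarrow> real^'m \<Rightarrow> real" where
  "ricci G y v w = (\<Sum>i\<in>UNIV. riem G y (axis i 1) v w $ i)"

text \<open>Half the metric trace of the Ricci tensor: $2\tau = \mathrm{trace}_g\,\mathrm{Ric}$.\<close>

definition scalar_tau :: "(real^'m::finite \<Rightarrow> real^'m^'m) \<Rightarrow> real^'m \<Rightarrow> real" where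
  "scalar_tau G y =
     (1/2) * (\<Sum>i\<in>UNIV. \<Sum>j\<in>UNIV. matrix_inv (G y) $ i $ j * ricci G y (axis i 1) (axis j 1))"

section \<open>Immersed submanifolds in local coordinates\<close>

text \<open>\<open>F :: real^'n \<Rightarrow> real^'m\<close> is the coordinate expression of an immersion into a manifold whose
  metric has components \<open>G\<close>. Tangent vectors of the submanifold are written as vectors
  of \<open>real^'n\<close>; normal vectors, and images of tangent vectors, as vectors of \<open>real^'m\<close>.\<close>

definition differential ::
  "(real^'n::finite \<Rightarrow> real^'m::finite) \<Rightarrow> real^'n \<Rightarrow> real^'n \<Rightarrow> real^'m" where
  "differential F x v = frechet_derivative F (at x) v"

definition induced_metric ::
  "(real^'m::finite \<Rightarrow> real^'m^'m) \<Rightarrow> (real^'n::finite \<Rightarrow> real^'m) \<Rightarrow> real^'n \<Rightarrow> real^'n^'n" where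
  "induced_metric G F x = (\<chi> a b. ginner G (F x) (pd a F x) (pd b F x))"

text \<open>The component of \<open>w\<close> orthogonal to the tangent space of the submanifold.\<close>

definition normal_part ::
  "(real^'m::finite \<Rightarrow> real^'m^'m) \<Rightarrow> (real^'n::finite \<Rightarrow> real^'m) \<Rightarrow> real^'n \<Rightarrow> real^'m \<Rightarrow> real^'m"
  where
  "normal_part G F x w =
     w - (\<Sum>a\<in>UNIV. \<Sum>b\<in>UNIV.
            (matrix_inv (induced_metric G F x) $ a $ b * ginner G (F x) w (pd a F x)) *\<^sub>R pd b F x)"

text \<open>The ambient Levi-Civita derivative in direction $\partial_a$ of a vector field \<open>W\<close> along \<open>F\<close>.\<close>

definition cov_along ::
  "(real^'m::finite \<Rightarrow> real^'m^'m) \<Rightarrow> (real^'n::finite \<Rightarrow> real^'m) \<Rightarrow> 'n \<Rightarrow>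
     (real^'n \<Rightarrow> real^'m) \<Rightarrow> real^'n \<Rightarrow> real^'m" where
  "cov_along G F a W x = pd a W x + christoffel_vec G (F x) (pd a F x) (W x)"

text \<open>\<open>second_ff G F a b x\<close> is $h(\partial_a,\partial_b)$ at \<open>x\<close>, by the Gauss formula.\<close>

definition second_ff ::
  "(real^'m::finite \<Rightarrow> real^'m^'m) \<Rightarrow> (real^'n::finite \<Rightarrow> real^'m) \<Rightarrow> 'n \<Rightarrow> 'n \<Rightarrow> real^'n \<Rightarrow> real^'m"
  where
  "second_ff G F a b x = normal_part G F x (cov_along G F a (pd b F) x)"

definition mean_curvature ::
  "(real^'m::finite \<Rightarrow> real^'m^'m) \<Rightarrow> (real^'n::finite \<Rightarrow> real^'m) \<Rightarrow> real^'n \<Rightarrow> real^'m" where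
  "mean_curvature G F x =
     (1 / real CARD('n)) *\<^sub>R
       (\<Sum>a\<in>UNIV. \<Sum>b\<in>UNIV. matrix_inv (induced_metric G F x) $ a $ b *\<^sub>R second_ff G F a b x)"

definition minimal_at ::
  "(real^'m::finite \<Rightarrow> real^'m^'m) \<Rightarrow> (real^'n::finite \<Rightarrow> real^'m) \<Rightarrow> real^'n \<Rightarrow> bool" where
  "minimal_at G F x \<longleftrightarrow> mean_curvature G F x = 0"

definition normal_connection ::
  "(real^'m::finite \<Rightarrow> real^'m^'m) \<Rightarrow> (real^'n::finite \<Rightarrow> real^'m) \<Rightarrow> 'n \<Rightarrow>
     (real^'n \<Rightarrow> real^'m) \<Rightarrow> real^'n \<Rightarrow> real^'m" where
  "normal_connection G F a \<xi> x = normal_part G F x (cov_along G F a \<xi> x)"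

text \<open>$g(R^\perp(u,v)\xi,\eta)$ at \<open>x\<close>. Since $R^\perp$ is a tensor, $R^\perp(\partial_a,\partial_b)\xi$ may be
  computed from any normal field extending the normal vector \<open>\<xi>\<close>; the extension used here
  projects the constant field \<open>\<xi>\<close> to the normal spaces at nearby points. There is no bracket term
  because coordinate fields commute.\<close>

definition normal_curvature ::
  "(real^'m::finite \<Rightarrow> real^'m^'m) \<Rightarrow> (real^'n::finite \<Rightarrow> real^'m) \<Rightarrow> real^'n \<Rightarrow>
     real^'n \<Rightarrow> real^'n \<Rightarrow> real^'m \<Rightarrow> real^'m \<Rightarrow> real" where
  "normal_curvature G F x u v \<xi> \<eta> =
     (let N = (\<lambda>z. normal_part G F z \<xi>) in
      \<Sum>a\<in>UNIV. \<Sum>b\<in>UNIV. u $ a * v $ b *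
        ginner G (F x)
          (normal_connection G F a (normal_connection G F b N) x
           - normal_connection G F b (normal_connection G F a N) x) \<eta>)"

text \<open>Values at a point of local orthonormal frames, indexed by \<open>{1..n}\<close> and \<open>{1..m-n}\<close>.\<close>

definition tangent_frame ::
  "(real^'m::finite \<Rightarrow> real^'m^'m) \<Rightarrow> (real^'n::finite \<Rightarrow> real^'m) \<Rightarrow> real^'n \<Rightarrow>
     (nat \<Rightarrow> real^'n) \<Rightarrow> bool" where
  "tangent_frame G F x e \<longleftrightarrow>
     (\<forall>i\<in>{1..CARD('n)}. \<forall>j\<in>{1..CARD('n)}.
        ginner (induced_metric G F) x (e i) (e j) = (if i = j then 1 else 0))"

definition normal_frame ::
  "(real^'m::finite \<Rightarrow> real^'m^'m) \<Rightarrow> (real^'n::finite \<Rightarrow> real^'m) \<Rightarrow> real^'n \<Rightarrow>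
     (nat \<Rightarrow> real^'m) \<Rightarrow> bool" where
  "normal_frame G F x \<upsilon> \<longleftrightarrow>
     (\<forall>r\<in>{1..CARD('m) - CARD('n)}. \<forall>v. ginner G (F x) (\<upsilon> r) (differential F x v) = 0) \<and>
     (\<forall>r\<in>{1..CARD('m) - CARD('n)}. \<forall>s\<in>{1..CARD('m) - CARD('n)}.
        ginner G (F x) (\<upsilon> r) (\<upsilon> s) = (if r = s then 1 else 0))"

definition rho ::
  "(real^'m::finite \<Rightarrow> real^'m^'m) \<Rightarrow> (real^'n::finite \<Rightarrow> real^'m) \<Rightarrow> real^'n \<Rightarrow>
     (nat \<Rightarrow> real^'n) \<Rightarrow> real" where
  "rho G F x e =
     2 / (real CARD('n) * (real CARD('n) - 1)) *
       (\<Sum>(i,j) | 1 \<le> i \<and> i < j \<and> j \<le> CARD('n).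
          sectional_curvature (induced_metric G F) x (e i) (e j))"

definition rho_perp ::
  "(real^'m::finite \<Rightarrow> real^'m^'m) \<Rightarrow> (real^'n::finite \<Rightarrow> real^'m) \<Rightarrow> real^'n \<Rightarrow>
     (nat \<Rightarrow> real^'n) \<Rightarrow> (nat \<Rightarrow> real^'m) \<Rightarrow> real" where
  "rho_perp G F x e \<upsilon> =
     2 / (real CARD('n) * (real CARD('n) - 1)) *
       sqrt (\<Sum>(i,j) | 1 \<le> i \<and> i < j \<and> j \<le> CARD('n).
             \<Sum>(r,s) | 1 \<le> r \<and> r < s \<and> s \<le> CARD('m) - CARD('n).
               (normal_curvature G F x (e i) (e j) (\<upsilon> r) (\<upsilon> s))\<^sup>2)"

definition ambient_term ::
  "(real^'m::finite \<Rightarrow> real^'m^'m) \<Rightarrow> (real^'n::finite \<Rightarrow> real^'m) \<Rightarrow> real^'n \<Rightarrow>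
     (nat \<Rightarrow> real^'n) \<Rightarrow> real" where
  "ambient_term G F x e =
     2 / (real CARD('n) * (real CARD('m) - 2)) *
       (\<Sum>j = 1..CARD('n). ricci G (F x) (differential F x (e j)) (differential F x (e j)))
     - 2 * scalar_tau G (F x) / ((real CARD('m) - 1) * (real CARD('m) - 2))"

section \<open>Smooth and Riemannian manifolds\<close>

text \<open>A chart is a domain together with a coordinate map, whose values off the domain are irrelevant.
  An atlas need not be maximal.\<close>

type_synonym ('a, 'n) chart = "'a set \<times> ('a \<Rightarrow> real^'n)"

definition chart_inv :: "('a, 'n) chart \<Rightarrow> real^'n \<Rightarrow> 'a" where
  "chart_inv c = inv_into (fst c) (snd c)"

definition smooth_manifold :: "'a topology \<Rightarrow> ('a, 'n::finite) chart set \<Rightarrow> bool" where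
  "smooth_manifold X A \<longleftrightarrow>
     topspace X \<noteq> {} \<and> Hausdorff_space X \<and> second_countable X \<and>
     (\<Union>c\<in>A. fst c) = topspace X \<and>
     (\<forall>(U,\<phi>)\<in>A. openin X U \<and> open (\<phi> ` U) \<and>
        homeomorphic_map (subtopology X U) (top_of_set (\<phi> ` U)) \<phi>) \<and>
     (\<forall>c\<in>A. \<forall>d\<in>A. smooth_on (snd c ` (fst c \<inter> fst d)) (snd d \<circ> chart_inv c))"

text \<open>A Riemannian metric is given by its matrices of components in the charts of the atlas, which
  transform as a covariant 2-tensor.\<close>

type_synonym ('a, 'n) metric_components = "('a, 'n) chart \<Rightarrow> real^'n \<Rightarrow> real^'n^'n"

definition riemannian_metric ::
  "('a, 'n::finite) chart set \<Rightarrow> ('a, 'n) metric_components \<Rightarrow> bool" where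
  "riemannian_metric A g \<longleftrightarrow>
     (\<forall>c\<in>A. smooth_on (snd c ` fst c) (g c) \<and>
        (\<forall>x\<in>snd c ` fst c. transpose (g c x) = g c x \<and>
           (\<forall>v. v \<noteq> 0 \<longrightarrow> ginner (g c) x v v > 0))) \<and>
     (\<forall>c\<in>A. \<forall>d\<in>A. \<forall>x\<in>snd c ` (fst c \<inter> fst d). \<forall>v w.
        ginner (g c) x v w =
          (let T = snd d \<circ> chart_inv c
           in ginner (g d) (T x) (differential T x v) (differential T x w)))"

text \<open>Each point has a neighbourhood \<open>W\<close> and a smooth function \<open>u\<close> on \<open>W\<close> such that $e^{2u}g$ is flat
  on \<open>W\<close>, i.e. has vanishing curvature tensor.\<close>

definition conformally_flat ::
  "'a topology \<Rightarrow> ('a, 'n::finite) chart set \<Rightarrow> ('a, 'n) metric_components \<Rightarrow> bool" where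
  "conformally_flat X A g \<longleftrightarrow>
     (\<forall>p\<in>topspace X. \<exists>W u. openin X W \<and> p \<in> W \<and>
        (\<forall>c\<in>A. smooth_on (snd c ` (fst c \<inter> W)) ((u :: 'a \<Rightarrow> real) \<circ> chart_inv c)) \<and>
        (\<forall>c\<in>A. \<forall>x\<in>snd c ` (fst c \<inter> W). \<forall>v1 v2 v3.
           riem (\<lambda>z. exp (2 * u (chart_inv c z)) *\<^sub>R g c z) x v1 v2 v3 = 0))"

definition immersion ::
  "'a topology \<Rightarrow> ('a, 'n::finite) chart set \<Rightarrow> 'b topology \<Rightarrow> ('b, 'm::finite) chart set \<Rightarrow>
     ('a \<Rightarrow> 'b) \<Rightarrow> bool" where
  "immersion X A Y B f \<longleftrightarrow>
     continuous_map X Y f \<and>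
     (\<forall>c\<in>A. \<forall>d\<in>B.
        let S = snd c ` (fst c \<inter> f -` fst d); F = snd d \<circ> f \<circ> chart_inv c
        in smooth_on S F \<and> (\<forall>x\<in>S. inj (differential F x)))"

text \<open>\<open>x\<close>, \<open>F\<close>, \<open>G\<close> are the coordinates of \<open>p\<close>, the coordinate expression of \<open>f\<close> and the components
  of the ambient metric, with respect to some charts around \<open>p\<close> and \<open>f p\<close>. All geometric quantities
  below are independent of the charts and the orthonormal frames, and are evaluated in arbitrary
  ones.\<close>

definition coordinates_at ::
  "('a, 'n::finite) chart set \<Rightarrow> ('b, 'm::finite) chart set \<Rightarrow> ('b, 'm) metric_components \<Rightarrow>
     ('a \<Rightarrow> 'b) \<Rightarrow> 'a \<Rightarrow> (real^'m \<Rightarrow> real^'m^'m) \<Rightarrow> (real^'n \<Rightarrow> real^'m) \<Rightarrow> real^'n \<Rightarrow> bool" where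
  "coordinates_at A B g f p G F x \<longleftrightarrow>
     (\<exists>c\<in>A. \<exists>d\<in>B. p \<in> fst c \<and> f p \<in> fst d \<and>
        x = snd c p \<and> F = snd d \<circ> f \<circ> chart_inv c \<and> G = g d)"

definition minimal_immersion ::
  "'a topology \<Rightarrow> ('a, 'n::finite) chart set \<Rightarrow> 'b topology \<Rightarrow> ('b, 'm::finite) chart set \<Rightarrow>
     ('b, 'm) metric_components \<Rightarrow> ('a \<Rightarrow> 'b) \<Rightarrow> bool" where
  "minimal_immersion X A Y B g f \<longleftrightarrow>
     immersion X A Y B f \<and>
     (\<forall>p\<in>topspace X. \<forall>G F x. coordinates_at A B g f p G F x \<longrightarrow> minimal_at G F x)"

definition ambient_condition ::
  "'a topology \<Rightarrow> ('a, 'n::finite) chart set \<Rightarrow> ('b, 'm::finite) chart set \<Rightarrow>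
     ('b, 'm) metric_components \<Rightarrow> ('a \<Rightarrow> 'b) \<Rightarrow> bool" where
  "ambient_condition X A B g f \<longleftrightarrow>
     (\<forall>p\<in>topspace X. \<forall>G F x e. coordinates_at A B g f p G F x \<longrightarrow> tangent_frame G F x e \<longrightarrow>
        ambient_term G F x e \<le> 0)"

end

theory Submission
  imports Defs
begin

text \<open>
  A conformally flat metric has a curvature tensor of the form $-g \owedge P$ for a symmetric bilinear
  form $P$. Taking traces, the ambient term of the hypothesis equals
  $-\frac{2}{n} \sum_j P(e_j, e_j)$, which is also the contribution of the ambient curvature to $\rho$ in
  the Gauss equation, and the ambient curvature drops out of the Ricci equation. Let $A_r$ be the matrices
  of the second fundamental form in a normal frame. At a minimal point these are trace free and the two
  equations give $n(n-1)\rho = n(n-1)\,\mathrm{ambient} - \sum_r |A_r|^2$ and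
  $n(n-1)\rho^\perp = (\sum_{r,s} |[A_r, A_s]|^2)^{1/2}$. Hence $\rho + \rho^\perp$ is at most the ambient
  term by the inequality $\sum_{r,s} |[A_r, A_s]|^2 \le (\sum_r |A_r|^2)^2$ for symmetric matrices.

  To prove the latter, rotate the family to make it orthogonal, say $A_r = \sqrt{x_r}\, Q_r$ with the $Q_r$
  orthonormal. Decomposing $x$ into its level sets reduces the claim to
  $\sum_{s \in K} |[Q_r, Q_s]|^2 \le |K|$ for $r \in K$; diagonalizing $Q_r$ with eigenvalues $\lambda_i$, this
  follows from Bessel's inequality and $\sum_{i<j} ((\lambda_i - \lambda_j)^2 - 1)^+ \le 1$.
\<close>

section \<open>The commutator inequality for symmetric matrices\<close>

text \<open>Bounds for single commutators do not suffice: orthonormal symmetric Q_r, Q_s can have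
  |[Q_r, Q_s]|^2 = 2, and adding up such bounds fails once there are three matrices of equal norm.
  What holds is a bound for a whole row, and the induction over level sets uses row bounds only. In
  a row, (\<lambda>_i - \<lambda>_j)^2 is compared with 1: the constant 1 adds up to the number of
  matrices, and the excess over 1 costs at most one more, which the vanishing commutator of Q_r with
  itself pays for. On the geometric side, conformal flatness is given by a flat metric exp(2u) g and
  not by a Weyl tensor, so P has to be computed from the change of the connection. To keep component
  sums out of this, the Christoffel symbols are treated as a bilinear map characterised by the
  Koszul formula. The normal curvature is defined through one particular extension of a normal
  vector, and the Ricci equation is derived for exactly this extension.\<close>

text \<open>The quadratic form x \<bullet> f x attains its maximum on the unit sphere of the
  invariant subspace, and a maximum point \<open>v\<close> is an eigenvector: if the residual
  \<open>w = f v - c *\<^sub>R v\<close> were nonzero, moving from \<open>v\<close> towards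
  \<open>w\<close> would increase the form.\<close>

lemma self_adjoint_has_eigenvector:
  fixes f :: "'a::euclidean_space \<Rightarrow> 'a"
  assumes lin: "linear f" and sa: "\<And>x y. f x \<bullet> y = x \<bullet> f y"
    and S: "subspace S" "f ` S \<subseteq> S" "S \<noteq> {0}"
  obtains v c where "v \<in> S" "norm v = 1" "f v = c *\<^sub>R v"
proof -
  let ?K = "S \<inter> sphere 0 1"
  obtain x where x: "x \<in> S" "x \<noteq> 0" using S subspace_0 by blast
  have "x /\<^sub>R norm x \<in> ?K" using x S by (simp add: subspace_scale)
  then have ne: "?K \<noteq> {}" by blast
  have co: "compact ?K" using S by (simp add: closed_Int_compact closed_subspace)
  have "continuous_on ?K (\<lambda>x. x \<bullet> f x)"
    by (intro continuous_intros linear_continuous_on lin linear_conv_bounded_linear[THEN iffD1])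
  then obtain v where v: "v \<in> ?K" and vm: "\<And>y. y \<in> ?K \<Longrightarrow> y \<bullet> f y \<le> v \<bullet> f v"
    using continuous_attains_sup[OF co ne] by blast
  define c where "c = v \<bullet> f v"
  have vv: "v \<bullet> v = 1" "v \<in> S" using v by (auto simp: norm_eq_1)
  have le: "y \<bullet> f y \<le> c * (y \<bullet> y)" if "y \<in> S" for y
  proof (cases "y = 0")
    case False
    have "y /\<^sub>R norm y \<in> ?K" using that False S by (simp add: subspace_scale)
    from vm[OF this] have "(y \<bullet> f y) / (norm y)\<^sup>2 \<le> c"
      using lin by (simp add: linear_cmul c_def power2_eq_square field_simps)
    then show ?thesis using False by (simp add: field_simps power2_norm_eq_inner)
  qed (simp)
  define w where "w = f v - c *\<^sub>R v"
  have wS: "w \<in> S" using S vv unfolding w_def by (simp add: subspace_diff subspace_scale image_subset_iff)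
  define K where "K = c * (w \<bullet> w) - w \<bullet> f w"
  \<comment> \<open>The maximum property at the point \<open>v + t *\<^sub>R w\<close>; the left
    side is its first-order term in \<open>t\<close>.\<close>
  have ineq: "2 * t * (w \<bullet> w) \<le> t\<^sup>2 * K" for t
  proof -
    have "v + t *\<^sub>R w \<in> S" using vv wS S by (simp add: subspace_add subspace_scale)
    from le[OF this] have "c + 2 * t * (w \<bullet> f v) + t\<^sup>2 * (w \<bullet> f w) \<le> c * (1 + 2 * t * (w \<bullet> v) + t\<^sup>2 * (w \<bullet> w))"
      using lin sa[of v w] vv(1)
      by (simp add: linear_add linear_cmul inner_add inner_commute[of v w] inner_commute[of "f v" w]
          c_def algebra_simps power2_eq_square)
    moreover have "w \<bullet> f v = w \<bullet> w + c * (w \<bullet> v)"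
      unfolding w_def by (simp add: algebra_simps inner_diff inner_commute)
    ultimately show ?thesis unfolding K_def by (simp add: algebra_simps)
  qed
  have "w = 0"
  proof (rule ccontr)
    assume "w \<noteq> 0"
    then have p: "w \<bullet> w > 0" by simp
    \<comment> \<open>Small enough that t * K is at most w \<bullet> w, contradicting the factor 2
      in \<open>ineq\<close>; the summand 1 keeps the denominator positive.\<close>
    define t where "t = (w \<bullet> w) / (\<bar>K\<bar> + 1)"
    have t: "t > 0" using p by (simp add: t_def)
    from ineq[of t] have "2 * (w \<bullet> w) \<le> t * K" using t by (simp add: power2_eq_square)
    also have "\<dots> \<le> t * (\<bar>K\<bar> + 1)" using t by (intro mult_left_mono) auto
    also have "\<dots> = w \<bullet> w" by (simp add: t_def)
    finally show False using p by simp
  qed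
  then show thesis using that[of v c] v unfolding w_def by auto
qed

text \<open>An orthonormal set of eigenvectors of largest cardinality is a basis: its orthogonal
  complement is invariant under \<open>f\<close>, so a nonzero complement would contain a further
  eigenvector.\<close>

theorem self_adjoint_orthonormal_eigenbasis:
  fixes f :: "'a::euclidean_space \<Rightarrow> 'a"
  assumes lin: "linear f" and sa: "\<And>x y. f x \<bullet> y = x \<bullet> f y"
  obtains B where "pairwise orthogonal B" "\<And>b. b \<in> B \<Longrightarrow> norm b = 1"
    "\<And>b. b \<in> B \<Longrightarrow> \<exists>c. f b = c *\<^sub>R b" "card B = DIM('a)" "finite B"
proof -
  define good where "good B \<longleftrightarrow> pairwise orthogonal B \<and> (\<forall>b\<in>B. norm b = 1 \<and> (\<exists>c. f b = c *\<^sub>R b))" for B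
  have indep: "independent B" if "good B" for B
    using that pairwise_orthogonal_independent[of B] unfolding good_def by force
  have bnd: "card B \<le> DIM('a)" if "good B" for B
    using independent_bound indep[OF that] by blast
  have "good {}" by (simp add: good_def)
  then obtain B where B: "good B" and Bmax: "\<And>B'. good B' \<Longrightarrow> card B' \<le> card B"
    using ex_has_greatest_nat[of good "{}" card "Suc (DIM('a))"] bnd by (metis less_Suc_eq_le)
  have fin: "finite B" using indep[OF B] independent_imp_finite by blast
  let ?S = "{y. \<forall>x\<in>B. orthogonal x y}"
  have S0: "?S = {0}"
  proof (rule ccontr)
    assume ne: "?S \<noteq> {0}"
    have inv: "f ` ?S \<subseteq> ?S"
    proof (clarsimp)
      fix y x assume y: "\<forall>x\<in>B. orthogonal x y" and x: "x \<in> B"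
      obtain c where "f x = c *\<^sub>R x" using B x by (auto simp: good_def)
      then show "orthogonal x (f y)" using sa[of x y] y x by (auto simp: orthogonal_def)
    qed
    obtain v c where v: "v \<in> ?S" "norm v = 1" "f v = c *\<^sub>R v"
      by (rule self_adjoint_has_eigenvector[OF lin sa subspace_orthogonal_to_vectors inv ne]) (rule that)
    have "v \<notin> B" using v by (auto simp: orthogonal_def)
    moreover have "good (insert v B)"
      using B v unfolding good_def by (auto simp: pairwise_insert orthogonal_commute)
    ultimately show False using Bmax[of "insert v B"] fin by simp
  qed
  have "{y \<in> UNIV. \<forall>x\<in>span B. orthogonal x y} \<subseteq> ?S"
    using span_base by blast
  then have "{y \<in> UNIV. \<forall>x\<in>span B. orthogonal x y} \<subseteq> {0}"
    unfolding S0 .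
  then have "dim {y \<in> UNIV. \<forall>x\<in>span B. orthogonal x y} = 0"
    using dim_eq_0 by blast
  then have "dim (span B) = dim (UNIV :: 'a set)"
    using dim_subspace_orthogonal_to_vectors[OF subspace_span[of B] subspace_UNIV subset_UNIV]
    by (simp only: add_0)
  then have "dim B = DIM('a)" by simp
  then have "card B = DIM('a)" using indep[OF B] by (simp add: dim_eq_card_independent)
  then show thesis using that[of B] B fin by (auto simp: good_def)
qed

definition orthonormal_family :: "('i \<Rightarrow> 'a::real_inner) \<Rightarrow> bool" where
  "orthonormal_family v \<longleftrightarrow> (\<forall>i j. v i \<bullet> v j = (if i = j then 1 else 0))"

lemma symmetric_matrix_inner:
  fixes M :: "real^'n^'n"
  assumes "transpose M = M"
  shows "x \<bullet> (M *v y) = (M *v x) \<bullet> y"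
  using dot_lmul_matrix[of x M y] transpose_matrix_vector[of M x] assms by simp

lemma symmetric_matrix_eigenbasis:
  fixes M :: "real^'n^'n"
  assumes "transpose M = M"
  shows "\<exists>(v :: 'n \<Rightarrow> real^'n) l. orthonormal_family v \<and> (\<forall>i. M *v v i = l i *\<^sub>R v i)"
proof -
  have "(M *v x) \<bullet> y = x \<bullet> (M *v y)" for x y
    using symmetric_matrix_inner[OF assms] by simp
  then obtain B where B: "pairwise orthogonal B" "\<And>b. b \<in> B \<Longrightarrow> norm b = 1"
      "\<And>b. b \<in> B \<Longrightarrow> \<exists>c. M *v b = c *\<^sub>R b" "card B = CARD('n)" "finite B"
    using self_adjoint_orthonormal_eigenbasis[of "(*v) M"] by auto
  obtain v where v: "bij_betw v (UNIV::'n set) B"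
    using finite_same_card_bij[of "UNIV::'n set" B] B by auto
  then have vB: "v i \<in> B" for i by (auto simp: bij_betw_def)
  have "v i \<bullet> v j = (if i = j then 1 else 0)" for i j
  proof (cases "i = j")
    case False
    then have "v i \<noteq> v j" using v by (simp add: bij_betw_def inj_eq)
    then show ?thesis using B(1) vB False by (simp add: pairwise_def orthogonal_def)
  qed (use B(2)[OF vB[of i]] in \<open>simp add: norm_eq_1\<close>)
  then have "orthonormal_family v" by (simp add: orthonormal_family_def)
  moreover have "\<forall>i. \<exists>c. M *v v i = c *\<^sub>R v i" using B(3)[OF vB] by blast
  then have "\<exists>l. \<forall>i. M *v v i = l i *\<^sub>R v i" unfolding choice_iff .
  ultimately show ?thesis by blast
qed

lemma orthonormal_family_expand:
  fixes v :: "'n::finite \<Rightarrow> 'a::euclidean_space"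
  assumes v: "orthonormal_family v" and card: "CARD('n) = DIM('a)"
  shows "(\<Sum>i\<in>UNIV. (x \<bullet> v i) *\<^sub>R v i) = x"
proof -
  have inj: "inj v"
  proof (rule injI)
    fix i j assume "v i = v j"
    then have "v i \<bullet> v j = v i \<bullet> v i" by simp
    then show "i = j" using v by (simp add: orthonormal_family_def split: if_splits)
  qed
  have o: "pairwise orthogonal (range v)" and n: "\<And>b. b \<in> range v \<Longrightarrow> norm b = 1"
    using v by (auto simp: orthonormal_family_def pairwise_def orthogonal_def norm_eq_1)
  have "0 \<notin> range v"
  proof
    assume "0 \<in> range v"
    from n[OF this] show False by simp
  qed
  then have "independent (range v)" using o by (rule pairwise_orthogonal_independent[rotated])
  then have "span (range v) = UNIV"
    using card_eq_dim[of "range v" UNIV] card inj by (auto simp: card_image)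
  then have "(\<Sum>b\<in>range v. (x \<bullet> b) *\<^sub>R b) = x"
    using orthonormal_basis_expand[OF o n] by simp
  then show ?thesis using inj by (simp add: sum.reindex)
qed

lemma orthonormal_family_parseval:
  fixes v :: "'n::finite \<Rightarrow> 'a::euclidean_space"
  assumes v: "orthonormal_family v" and card: "CARD('n) = DIM('a)"
  shows "(\<Sum>i\<in>UNIV. (x \<bullet> v i) * (y \<bullet> v i)) = x \<bullet> y"
proof -
  have "x \<bullet> y = x \<bullet> (\<Sum>i\<in>UNIV. (y \<bullet> v i) *\<^sub>R v i)"
    using orthonormal_family_expand[OF assms] by simp
  then show ?thesis by (simp add: inner_sum_right mult.commute)
qed

lemma bessel_inequality:
  fixes Q :: "'i \<Rightarrow> 'a::real_inner"
  assumes "finite J" and Q: "\<And>i j. i \<in> J \<Longrightarrow> j \<in> J \<Longrightarrow> Q i \<bullet> Q j = (if i = j then 1 else 0)"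
  shows "(\<Sum>i\<in>J. (Q i \<bullet> x)\<^sup>2) \<le> x \<bullet> x"
proof -
  let ?p = "\<Sum>i\<in>J. (Q i \<bullet> x) *\<^sub>R Q i"
  have px: "?p \<bullet> x = (\<Sum>i\<in>J. (Q i \<bullet> x)\<^sup>2)"
    by (simp add: inner_sum_left power2_eq_square)
  have "?p \<bullet> ?p = (\<Sum>i\<in>J. \<Sum>j\<in>J. (Q i \<bullet> x) * (Q j \<bullet> x) * (Q i \<bullet> Q j))"
    by (simp add: inner_sum_left inner_sum_right sum_distrib_left inner_commute mult_ac)
  also have "\<dots> = (\<Sum>i\<in>J. \<Sum>j\<in>J. if i = j then (Q i \<bullet> x) * (Q j \<bullet> x) else 0)"
    by (intro sum.cong refl) (simp add: Q)
  also have "\<dots> = (\<Sum>i\<in>J. (Q i \<bullet> x)\<^sup>2)"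
    using assms(1) by (simp add: power2_eq_square)
  finally have pp: "?p \<bullet> ?p = (\<Sum>i\<in>J. (Q i \<bullet> x)\<^sup>2)" .
  have "0 \<le> (x - ?p) \<bullet> (x - ?p)" by (rule inner_ge_zero)
  also have "\<dots> = x \<bullet> x - 2 * (?p \<bullet> x) + ?p \<bullet> ?p"
    unfolding inner_diff_left inner_diff_right inner_commute[of x ?p] by (simp only: algebra_simps)
  finally show ?thesis unfolding px pp by simp
qed

section \<open>Two elementary inequalities for real numbers\<close>

lemma weighted_pairs_le:
  fixes c :: "'i \<Rightarrow> 'i \<Rightarrow> real"
  assumes "finite J" and sym: "\<And>i j. c i j = c j i"
    and row: "\<And>K i. K \<subseteq> J \<Longrightarrow> i \<in> K \<Longrightarrow> (\<Sum>j\<in>K. c i j) \<le> card K"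
    and "\<And>i. i \<in> J \<Longrightarrow> x i \<ge> 0"
  shows "(\<Sum>i\<in>J. \<Sum>j\<in>J. x i * x j * c i j) \<le> (\<Sum>i\<in>J. x i)\<^sup>2"
  \<comment> \<open>Subtracting the minimum of \<open>x\<close> splits off a constant vector and leaves one supported on a smaller set.\<close>
  using assms(1,3,4)
proof (induction "card J" arbitrary: J x)
  case (Suc k)
  then have fin: "finite J" and ne: "J \<noteq> {}" by auto
  obtain a where a: "a \<in> J" and amin: "\<And>i. i \<in> J \<Longrightarrow> x a \<le> x i"
    using arg_min_if_finite(1)[OF fin ne] arg_min_least[OF fin ne] by blast
  define m where "m = x a"
  define y where "y i = x i - m" for i
  have m0: "m \<ge> 0" using Suc.prems(3) a by (simp add: m_def)
  have y0: "y i \<ge> 0" if "i \<in> J" for i using amin that by (simp add: y_def m_def)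
  have ya: "y a = 0" by (simp add: y_def m_def)
  let ?n = "real (card J)"
  have IH: "(\<Sum>i\<in>J-{a}. \<Sum>j\<in>J-{a}. y i * y j * c i j) \<le> (\<Sum>i\<in>J-{a}. y i)\<^sup>2"
  proof (rule Suc.hyps)
    show "k = card (J - {a})" using Suc.hyps(2) a fin by simp
    show "(\<Sum>j\<in>K. c i j) \<le> card K" if "K \<subseteq> J - {a}" "i \<in> K" for K i
      using Suc.prems(2)[of K i] that by blast
  qed (use fin y0 in auto)
  have red: "(\<Sum>i\<in>J-{a}. y i * h i) = (\<Sum>i\<in>J. y i * h i)" for h
    using sum.remove[OF fin a, of "\<lambda>i. y i * h i"] ya by simp
  have red2: "(\<Sum>i\<in>J-{a}. \<Sum>j\<in>J-{a}. y i * y j * c i j) = (\<Sum>i\<in>J. \<Sum>j\<in>J. y i * y j * c i j)"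
    using red by (simp add: mult.assoc sum_distrib_left[symmetric])
  have yy: "(\<Sum>i\<in>J. \<Sum>j\<in>J. y i * y j * c i j) \<le> (\<Sum>i\<in>J. y i)\<^sup>2"
    using IH red2 red[of "\<lambda>_. 1"] by simp
  have r: "(\<Sum>j\<in>J. c i j) \<le> ?n" if "i \<in> J" for i using Suc.prems(2)[of J i] that by simp
  have one: "(\<Sum>i\<in>J. \<Sum>j\<in>J. c i j) \<le> ?n * ?n"
    using sum_mono[of J "\<lambda>i. \<Sum>j\<in>J. c i j" "\<lambda>_. ?n"] r by simp
  have ony: "(\<Sum>i\<in>J. y i * (\<Sum>j\<in>J. c i j)) \<le> (\<Sum>i\<in>J. y i) * ?n"
    unfolding sum_distrib_right by (intro sum_mono mult_left_mono r y0)
  have sw: "(\<Sum>i\<in>J. \<Sum>j\<in>J. y j * c i j) = (\<Sum>i\<in>J. y i * (\<Sum>j\<in>J. c i j))"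
    by (subst sum.swap) (simp add: sum_distrib_left sym)
  have xm: "x i = m + y i" for i by (simp add: y_def)
  have "(\<Sum>i\<in>J. \<Sum>j\<in>J. x i * x j * c i j) =
      (\<Sum>i\<in>J. \<Sum>j\<in>J. m * m * c i j + m * (y j * c i j) + m * (y i * c i j) + y i * y j * c i j)"
    by (simp add: xm algebra_simps)
  also have "\<dots> = m * m * (\<Sum>i\<in>J. \<Sum>j\<in>J. c i j) + m * (\<Sum>i\<in>J. \<Sum>j\<in>J. y j * c i j)
     + m * (\<Sum>i\<in>J. y i * (\<Sum>j\<in>J. c i j)) + (\<Sum>i\<in>J. \<Sum>j\<in>J. y i * y j * c i j)"
    by (simp add: sum.distrib sum_distrib_left)
  \<comment> \<open>The row bounds for all of \<open>J\<close> control the constant and the mixed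
    terms, the induction hypothesis the last one; together they form the square of n m + (sum of
    \<open>y\<close>).\<close>
  also have "\<dots> \<le> m * m * (?n * ?n) + m * ((\<Sum>i\<in>J. y i) * ?n) + m * ((\<Sum>i\<in>J. y i) * ?n) + (\<Sum>i\<in>J. y i)\<^sup>2"
    unfolding sw using one ony yy m0 by (intro add_mono mult_left_mono) auto
  also have "\<dots> = (\<Sum>i\<in>J. x i)\<^sup>2"
    by (simp add: xm sum.distrib power2_eq_square algebra_simps)
  finally show ?case .
qed auto

text \<open>The pairs with a gap above 1 form a star: they all share one end. For a star the
  estimate is Cauchy-Schwarz.\<close>

lemma sum_gap_excess_le_1:
  fixes l :: "'n::finite \<Rightarrow> real"
  assumes "(\<Sum>i\<in>UNIV. (l i)\<^sup>2) \<le> 1"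
  shows "(\<Sum>(i,j) | l i - l j > 1. (l i - l j)\<^sup>2 - 1) \<le> 1"
proof -
  \<comment> \<open>With k leaves, sum s and square sum q, the left side is k a^2 - 2 a s + q - k.
    Here -2 a s \<le> a^2 + s^2 and s^2 \<le> k q \<le> k (1 - a^2), so all multiples of k cancel
    and a^2 + q \<le> 1 remains.\<close>
  have star: "(\<Sum>j\<in>L. (a - t j)\<^sup>2 - 1) \<le> 1"
    if "finite L" "a\<^sup>2 + (\<Sum>j\<in>L. (t j)\<^sup>2) \<le> 1" for a and t :: "'n \<Rightarrow> real" and L
  proof -
    let ?s = "\<Sum>j\<in>L. t j" and ?q = "\<Sum>j\<in>L. (t j)\<^sup>2" and ?k = "real (card L)"
    have cs: "?s\<^sup>2 \<le> ?k * ?q"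
      using Cauchy_Schwarz_ineq_sum[of "\<lambda>_. 1" t L] by simp
    have q: "?q \<le> 1 - a\<^sup>2" using that by simp
    have e: "(\<Sum>j\<in>L. (a - t j)\<^sup>2 - 1) = ?k * a\<^sup>2 - 2 * a * ?s + ?q - ?k"
      by (simp add: power2_diff sum.distrib sum_subtractf mult.assoc flip: sum_distrib_left)
    have "- 2 * a * ?s \<le> a\<^sup>2 + ?s\<^sup>2"
      using zero_le_power2[of "a + ?s"] by (simp add: power2_sum)
    moreover have "?s\<^sup>2 \<le> ?k * (1 - a\<^sup>2)" using cs q by (meson mult_left_mono of_nat_0_le_iff order_trans)
    ultimately show ?thesis using q e by (simp add: algebra_simps)
  qed
  let ?P = "{(i,j). l i - l j > 1}"
  have small: "(\<Sum>i\<in>K. (l i)\<^sup>2) \<le> 1" for K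
    using sum_mono2[of UNIV K "\<lambda>i. (l i)\<^sup>2"] assms by (meson finite order_trans subset_UNIV zero_le_power2)
  \<comment> \<open>Two disjoint gaps larger than 1 would need \<open>\<Sum>(l i)\<^sup>2 > 1\<close>, and two consecutive ones add up to a gap
    larger than 2. So all large gaps have the same upper end or all have the same lower end.\<close>
  have meet: "i = i' \<or> j = j'" if "(i,j) \<in> ?P" "(i',j') \<in> ?P" for i j i' j'
  proof (rule ccontr)
    assume ne: "\<not> (i = i' \<or> j = j')"
    have sq: "1 < (l p - l q)\<^sup>2" if "l p - l q > 1" for p q using that by (simp add: one_less_power)
    have sq2: "4 < (l p - l q)\<^sup>2" if "l p - l q > 2" for p q
      using power_strict_mono[OF that, of 2] by simp
    have bd: "(l p - l q)\<^sup>2 \<le> 2 * ((l p)\<^sup>2 + (l q)\<^sup>2)" for p q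
      using zero_le_power2[of "l p + l q"] by (simp add: power2_sum power2_diff)
    have bd1: "(l p - l q)\<^sup>2 \<le> 2" if "p \<noteq> q" for p q
      using bd[of p q] small[of "{p,q}"] that by simp
    have d: "i \<noteq> j" "i' \<noteq> j'" using that by auto
    show False
    proof (cases "i = j' \<or> i' = j")
      case True
      then have "l i' - l j > 2 \<or> l i - l j' > 2" using that by auto
      then show False using sq2 bd1 by (smt (verit, best))
    next
      case False
      then have "(l i)\<^sup>2 + (l j)\<^sup>2 + (l i')\<^sup>2 + (l j')\<^sup>2 \<le> 1"
        using small[of "{i,j,i',j'}"] ne d by (simp add: eq_commute[of j])
      moreover have "1 < (l i - l j)\<^sup>2" "1 < (l i' - l j')\<^sup>2" using sq that by auto
      moreover have "a + b + c + d \<le> 1 \<Longrightarrow> 1 < x \<Longrightarrow> 1 < y \<Longrightarrow> x \<le> 2 * (a + b) \<Longrightarrow> y \<le> 2 * (c + d) \<Longrightarrow> False"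
        for a b c d x y :: real by argo
      ultimately show False using bd[of i j] bd[of i' j'] by blast
    qed
  qed
  show ?thesis
  proof (cases "?P = {}")
    case False
    then obtain a b where ab: "(a,b) \<in> ?P" by auto
    consider "\<forall>p\<in>?P. fst p = a" | "\<forall>p\<in>?P. snd p = b"
    proof (cases "\<forall>p\<in>?P. fst p = a")
      case nf: False
      then obtain a' b' where p: "(a',b') \<in> ?P" "a' \<noteq> a" by auto
      \<comment> \<open>The pairs (a, b) and (a', b') have different upper ends, hence b' = b. A
        further pair misses one of these two upper ends, so it meets the corresponding pair in its
        lower end b.\<close>
      have "snd q = b" if "q \<in> ?P" for q
        using meet[OF ab, of "fst q" "snd q"] meet[OF p(1), of "fst q" "snd q"] meet[OF p(1) ab] p that
        by (auto simp: split_beta)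
      then show ?thesis using that by blast
    qed (use that in blast)
    then show ?thesis
    proof cases
      case 1
      let ?L = "{j. l a - l j > 1}"
      have P: "?P = Pair a ` ?L" using 1 by auto
      have "(l a)\<^sup>2 + (\<Sum>j\<in>?L. (l j)\<^sup>2) \<le> 1" using small[of "insert a ?L"] by simp
      then have "(\<Sum>j\<in>?L. (l a - l j)\<^sup>2 - 1) \<le> 1" by (rule star[OF finite])
      moreover have "(\<Sum>(i,j)\<in>?P. (l i - l j)\<^sup>2 - 1) = (\<Sum>j\<in>?L. (l a - l j)\<^sup>2 - 1)"
        unfolding P by (subst sum.reindex) (simp_all add: inj_on_def)
      ultimately show ?thesis by (simp only:)
    next
      case 2
      let ?L = "{i. l i - l b > 1}"
      have b: "j = b" if "l i - l j > 1" for i j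
        using bspec[OF 2, of "(i,j)"] that by simp
      have P: "?P = (\<lambda>i. (i, b)) ` ?L"
      proof (intro equalityI subsetI)
        fix p assume "p \<in> ?P"
        then show "p \<in> (\<lambda>i. (i, b)) ` ?L"
          using b[of "fst p" "snd p"] by (intro image_eqI[of _ _ "fst p"]) (auto simp: split_beta prod_eq_iff)
      qed blast
      have "(l b)\<^sup>2 + (\<Sum>j\<in>?L. (l j)\<^sup>2) \<le> 1" using small[of "insert b ?L"] by simp
      then have "(\<Sum>i\<in>?L. (l b - l i)\<^sup>2 - 1) \<le> 1" by (rule star[OF finite])
      moreover have "(\<Sum>(i,j)\<in>?P. (l i - l j)\<^sup>2 - 1) = (\<Sum>i\<in>?L. (l b - l i)\<^sup>2 - 1)"
        unfolding P by (subst sum.reindex) (simp_all add: inj_on_def power2_commute)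
      ultimately show ?thesis by (simp only:)
    qed
  next
    case True
    show ?thesis unfolding True by (simp only: sum.empty zero_le_one)
  qed
qed

section \<open>The inequality for commutators\<close>

definition commutator :: "real^'n^'n \<Rightarrow> real^'n^'n \<Rightarrow> real^'n^'n" where
  "commutator A B = A ** B - B ** A"

text \<open>On matrices \<bullet> is the Frobenius inner product. Its invariance under a change of
  orthonormal basis is Parseval's identity, applied to the vectors \<open>M *v v j\<close> and then
  to the rows of \<open>M\<close>.\<close>

lemma inner_matrix_eigen_sum:
  fixes M :: "real^'n^'n" and v :: "'n \<Rightarrow> real^'n"
  assumes v: "orthonormal_family v"
  shows "M \<bullet> M = (\<Sum>i\<in>UNIV. \<Sum>j\<in>UNIV. (v i \<bullet> (M *v v j))\<^sup>2)"
proof -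
  have "(\<Sum>i\<in>UNIV. \<Sum>j\<in>UNIV. (v i \<bullet> (M *v v j))\<^sup>2) = (\<Sum>j\<in>UNIV. (M *v v j) \<bullet> (M *v v j))"
    by (subst sum.swap)
      (simp add: power2_eq_square inner_commute[of "v _"] orthonormal_family_parseval[OF v])
  also have "\<dots> = (\<Sum>j\<in>UNIV. \<Sum>i\<in>UNIV. (M $ i \<bullet> v j) * (M $ i \<bullet> v j))"
    by (simp add: inner_vec_def matrix_vector_mult_def)
  also have "\<dots> = (\<Sum>i\<in>UNIV. M $ i \<bullet> M $ i)"
    by (subst sum.swap) (simp add: orthonormal_family_parseval[OF v])
  finally show ?thesis by (simp add: inner_vec_def)
qed

text \<open>In an eigenbasis of \<open>A\<close> the entries of [A, Q r] are (l i - l j) times those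
  of \<open>Q r\<close>, so the sum equals \<Sum> (l i - l j)^2 \<open>W i j\<close> with
  nonnegative weights of total mass \<open>card J\<close>. Writing (l i - l j)^2 as 1 plus an
  excess, the 1 contributes \<open>card J\<close>. The excess is positive only for gaps above 1,
  where the weight is at most 1/2; each such pair occurs in two orders, so
  \<open>sum_gap_excess_le_1\<close> bounds the rest by 1.\<close>

lemma sum_commutator_orthonormal_le:
  fixes A :: "real^'n^'n" and Q :: "'i \<Rightarrow> real^'n^'n"
  assumes fin: "finite J" and A: "transpose A = A" "A \<bullet> A = 1"
    and sym: "\<And>r. r \<in> J \<Longrightarrow> transpose (Q r) = Q r"
    and Q: "\<And>r s. r \<in> J \<Longrightarrow> s \<in> J \<Longrightarrow> Q r \<bullet> Q s = (if r = s then 1 else 0)"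
  shows "(\<Sum>r\<in>J. commutator A (Q r) \<bullet> commutator A (Q r)) \<le> card J + 1"
proof -
  obtain v :: "'n \<Rightarrow> real^'n" and l where v: "orthonormal_family v" and l': "\<forall>i. A *v v i = l i *\<^sub>R v i"
    using symmetric_matrix_eigenbasis[OF A(1)] by blast
  have l: "A *v v i = l i *\<^sub>R v i" for i using l' by blast
  have vv: "v i \<bullet> v j = (if i = j then 1 else 0)" for i j
    using v by (simp add: orthonormal_family_def)
  define W where "W i j = (\<Sum>r\<in>J. (v i \<bullet> (Q r *v v j))\<^sup>2)" for i j
  have W0: "W i j \<ge> 0" for i j by (simp add: W_def sum_nonneg)
  note sa = symmetric_matrix_inner
  have Qs: "v i \<bullet> (Q r *v v j) = v j \<bullet> (Q r *v v i)" if "r \<in> J" for r i j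
    unfolding sa[OF sym[OF that], of "v i" "v j"] by (rule inner_commute)
  have Wsym: "W i j = W j i" for i j unfolding W_def by (intro sum.cong refl) (simp add: Qs)
  have "1 = (\<Sum>i\<in>UNIV. \<Sum>j\<in>UNIV. (l j * (v i \<bullet> v j))\<^sup>2)"
    using inner_matrix_eigen_sum[OF v, of A] A(2) by (simp add: l)
  also have "\<dots> = (\<Sum>i\<in>UNIV. (l i)\<^sup>2)"
    by (simp add: vv if_distrib[of "\<lambda>x. (_ * x)\<^sup>2"] cong: if_cong)
  finally have l1: "(\<Sum>i\<in>UNIV. (l i)\<^sup>2) \<le> 1" by simp
  have comm: "v i \<bullet> (commutator A (Q r) *v v j) = (l i - l j) * (v i \<bullet> (Q r *v v j))" for i j r
    by (simp add: commutator_def matrix_vector_mult_diff_rdistrib inner_diff_right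
        flip: matrix_vector_mul_assoc)
       (simp add: sa[OF A(1)] l matrix_vector_mult_scaleR algebra_simps)
  have lhs: "(\<Sum>r\<in>J. commutator A (Q r) \<bullet> commutator A (Q r)) = (\<Sum>i\<in>UNIV. \<Sum>j\<in>UNIV. (l i - l j)\<^sup>2 * W i j)"
    unfolding inner_matrix_eigen_sum[OF v] comm W_def sum_distrib_left power_mult_distrib
    by (subst sum.swap, intro sum.cong refl, subst sum.swap) simp
  have tot: "(\<Sum>i\<in>UNIV. \<Sum>j\<in>UNIV. W i j) = card J"
  proof -
    have "(\<Sum>i\<in>UNIV. \<Sum>j\<in>UNIV. W i j) = (\<Sum>r\<in>J. Q r \<bullet> Q r)"
      unfolding inner_matrix_eigen_sum[OF v] W_def
      by (subst (2) sum.swap, intro sum.cong refl, subst sum.swap) simp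
    then show ?thesis by (simp add: Q)
  qed
  \<comment> \<open>Bessel's inequality for the symmetric matrix \<open>v\<^sub>i v\<^sub>j\<^sup>T + v\<^sub>j v\<^sub>i\<^sup>T\<close>, of squared norm 2\<close>
  have Wh: "2 * W i j \<le> 1" if "i \<noteq> j" for i j
  proof -
    define E :: "real^'n^'n" where "E = (\<chi> a b. v i $ a * v j $ b + v j $ a * v i $ b)"
    have ip: "M \<bullet> (\<chi> a b. x $ a * y $ b) = x \<bullet> (M *v y)" for M :: "real^'n^'n" and x y
      by (simp add: inner_vec_def matrix_vector_mult_def sum_distrib_left mult_ac)
    have E': "E = (\<chi> a b. v i $ a * v j $ b) + (\<chi> a b. v j $ a * v i $ b)"
      by (simp add: E_def vec_eq_iff)
    have QE: "Q r \<bullet> E = 2 * (v i \<bullet> (Q r *v v j))" if "r \<in> J" for r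
      unfolding E' inner_add_right ip using Qs[OF that, of i j] by simp
    have op: "(\<chi> a b. x $ a * y $ b) *v z = (y \<bullet> z) *\<^sub>R x" for x y z :: "real^'n"
      by (simp add: vec_eq_iff matrix_vector_mult_def inner_vec_def sum_distrib_left mult_ac)
    have "E *v v j = v i" "E *v v i = v j"
      using that by (simp_all add: E' matrix_vector_mult_add_rdistrib op vv)
    then have "E \<bullet> E = 2" unfolding E' inner_add_right by (simp flip: E' add: ip vv)
    then have "(\<Sum>r\<in>J. (2 * (v i \<bullet> (Q r *v v j)))\<^sup>2) \<le> 2"
      using bessel_inequality[OF fin Q, of E] by (simp add: QE)
    then show ?thesis unfolding W_def by (simp add: power_mult_distrib flip: sum_distrib_left)
  qed
  let ?f = "\<lambda>i j. ((l i - l j)\<^sup>2 - 1) * W i j"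
  let ?P = "{(i,j). l i - l j > 1}" and ?N = "{(i,j). l j - l i > 1}"
  \<comment> \<open>\<open>?P\<close> and \<open>?N\<close> hold the two orders of a pair with a gap
    above 1, where the weight is replaced by its bound 1/2; all other terms are at most 0.\<close>
  have bd: "(case p of (i,j) \<Rightarrow> ?f i j) \<le> 
     (if p \<in> ?P then (case p of (i,j) \<Rightarrow> (l i - l j)\<^sup>2 - 1) / 2 else 0) +
     (if p \<in> ?N then (case p of (i,j) \<Rightarrow> (l i - l j)\<^sup>2 - 1) / 2 else 0)" for p
  proof -
    obtain i j where p: "p = (i,j)" by force
    show ?thesis
    proof (cases "\<bar>l i - l j\<bar> > 1")
      case True
      then have "i \<noteq> j" and "(l i - l j)\<^sup>2 \<ge> 1" by (auto simp: abs_square_le_1 one_le_power[of "\<bar>l i - l j\<bar>" 2, simplified])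
      then have "?f i j \<le> ((l i - l j)\<^sup>2 - 1) * (1/2)" using Wh by (intro mult_left_mono) (auto simp: mult.commute)
      then show ?thesis using True by (auto simp: p)
    next
      case False
      then have "(l i - l j)\<^sup>2 \<le> 1" by (simp add: abs_square_le_1)
      then show ?thesis using False W0[of i j] by (auto simp: p mult_nonpos_nonneg)
    qed
  qed
  have N: "(\<Sum>p\<in>?N. (case p of (i,j) \<Rightarrow> (l i - l j)\<^sup>2 - 1)) = (\<Sum>p\<in>?P. (case p of (i,j) \<Rightarrow> (l i - l j)\<^sup>2 - 1))"
    by (rule sum.reindex_bij_witness[of _ prod.swap prod.swap]) (auto simp: power2_commute)
  have "(\<Sum>i\<in>UNIV. \<Sum>j\<in>UNIV. ?f i j) = (\<Sum>p\<in>UNIV. case p of (i,j) \<Rightarrow> ?f i j)"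
    by (simp add: sum.cartesian_product)
  also have "\<dots> \<le> (\<Sum>p\<in>?P. (case p of (i,j) \<Rightarrow> (l i - l j)\<^sup>2 - 1) / 2) + (\<Sum>p\<in>?N. (case p of (i,j) \<Rightarrow> (l i - l j)\<^sup>2 - 1) / 2)"
    by (rule order_trans[OF sum_mono[OF bd]]) (simp add: sum.distrib sum.If_cases)
  also have "\<dots> \<le> 1"
    using sum_gap_excess_le_1[OF l1] N by (simp flip: sum_divide_distrib)
  finally have "(\<Sum>i\<in>UNIV. \<Sum>j\<in>UNIV. ?f i j) \<le> 1" .
  then show ?thesis unfolding lhs using tot
    by (simp add: left_diff_distrib sum_subtractf)
qed

lemma commutator_scaleR:
  "commutator (a *\<^sub>R A) (b *\<^sub>R B) = (a * b) *\<^sub>R commutator A B"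
  by (simp add: commutator_def scalar_matrix_assoc matrix_scalar_ac scaleR_diff_right mult.commute flip: scalar_mult_eq_scaleR)

lemma commutator_sum:
  fixes f :: "'i \<Rightarrow> real^'a^'a" and h :: "'j \<Rightarrow> real^'a^'a"
  shows
  "commutator (\<Sum>p\<in>K. f p) (\<Sum>q\<in>L. h q) = (\<Sum>p\<in>K. \<Sum>q\<in>L. commutator (f p) (h q))"
proof -
  have matrix_add_rdistrib: "(A + B) ** C = A ** C + B ** C" for A B C :: "real^'a^'a"
    by (simp add: vec_eq_iff matrix_matrix_mult_def sum.distrib distrib_right)
  have l: "commutator (\<Sum>p\<in>K. f p) B = (\<Sum>p\<in>K. commutator (f p) B)" for B
    by (induction K rule: infinite_finite_induct)
      (simp_all add: commutator_def matrix_add_ldistrib matrix_add_rdistrib)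
  have r: "commutator A (\<Sum>q\<in>L. h q) = (\<Sum>q\<in>L. commutator A (h q))" for A
    by (induction L rule: infinite_finite_induct)
      (simp_all add: commutator_def matrix_add_ldistrib matrix_add_rdistrib)
  show ?thesis unfolding l r by (rule sum.swap)
qed

text \<open>Dividing each \<open>B r\<close> by its norm turns the left side into the form of
  \<open>weighted_pairs_le\<close>, with the squared norms as weights. The set \<open>J\<close>
  leaves out the zero matrices, which have no direction.\<close>

lemma commutator_sum_le_orthogonal:
  fixes B :: "'k::finite \<Rightarrow> real^'n^'n"
  assumes sym: "\<And>r. transpose (B r) = B r" and orth: "\<And>r s. r \<noteq> s \<Longrightarrow> B r \<bullet> B s = 0"
  shows "(\<Sum>r\<in>UNIV. \<Sum>s\<in>UNIV. commutator (B r) (B s) \<bullet> commutator (B r) (B s)) \<le> (\<Sum>r\<in>UNIV. B r \<bullet> B r)\<^sup>2"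
proof -
  define Q where "Q r = B r /\<^sub>R norm (B r)" for r
  define J where "J = {r. B r \<noteq> 0}"
  define c where "c r s = commutator (Q r) (Q s) \<bullet> commutator (Q r) (Q s)" for r s
  have BQ: "B r = norm (B r) *\<^sub>R Q r" for r by (cases "B r = 0") (simp_all add: Q_def)
  have Qsym: "transpose (Q r) = Q r" for r
    using sym[of r] by (simp add: Q_def transpose_scalar)
  have QQ: "Q r \<bullet> Q s = (if r = s then 1 else 0)" if "r \<in> J" for r s
    using that orth[of r s] by (cases "r = s") (auto simp: Q_def J_def dot_square_norm power2_eq_square field_simps)
  have c_sym: "c r s = c s r" for r s
  proof -
    have "commutator (Q r) (Q s) = - commutator (Q s) (Q r)" by (simp add: commutator_def)
    then show ?thesis by (simp add: c_def)
  qed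
  have row: "(\<Sum>s\<in>K. c r s) \<le> card K" if K: "K \<subseteq> J" "r \<in> K" for K r
  proof -
    have rJ: "r \<in> J" using K by blast
    \<comment> \<open>Leaving out the index \<open>r\<close>, whose own term is zero, lowers the
      cardinality by one and so absorbs the \<open>+ 1\<close>.\<close>
    have "(\<Sum>s\<in>K-{r}. c r s) \<le> card (K - {r}) + 1"
      unfolding c_def
    proof (rule sum_commutator_orthonormal_le[OF _ Qsym])
      show "Q r \<bullet> Q r = 1" using QQ[OF rJ, of r] by simp
      show "Q p \<bullet> Q q = (if p = q then 1 else 0)" if "p \<in> K - {r}" for p q
        using QQ[of p q] that K(1) by blast
    qed (simp_all add: Qsym)
    moreover have "c r r = 0" by (simp add: c_def commutator_def)
    moreover have "card K = card (K - {r}) + 1"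
      using card.remove[of K r] K(2) by simp
    moreover have "(\<Sum>s\<in>K. c r s) = c r r + (\<Sum>s\<in>K-{r}. c r s)"
      by (rule sum.remove) (use K(2) in simp_all)
    ultimately show ?thesis by simp
  qed
  have w: "(\<Sum>r\<in>J. \<Sum>s\<in>J. (norm (B r))\<^sup>2 * (norm (B s))\<^sup>2 * c r s) \<le> (\<Sum>r\<in>J. (norm (B r))\<^sup>2)\<^sup>2"
    by (rule weighted_pairs_le) (use c_sym row in auto)
  have e: "commutator (B r) (B s) \<bullet> commutator (B r) (B s) = (norm (B r))\<^sup>2 * (norm (B s))\<^sup>2 * c r s" for r s
    by (subst (1 2) BQ, subst (3 4) BQ) (simp only: commutator_scaleR c_def inner_scaleR_left inner_scaleR_right power2_eq_square mult_ac)
  have "(\<Sum>r\<in>UNIV. h ((norm (B r))\<^sup>2) r) = (\<Sum>r\<in>J. h ((norm (B r))\<^sup>2) r)" if "\<And>r. h 0 r = 0" for h :: "real \<Rightarrow> 'k \<Rightarrow> real"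
    by (rule sum.mono_neutral_right) (auto simp: J_def that)
  note red = this
  have "(\<Sum>s\<in>UNIV. (norm (B r))\<^sup>2 * (norm (B s))\<^sup>2 * c r s) = (\<Sum>s\<in>J. (norm (B r))\<^sup>2 * (norm (B s))\<^sup>2 * c r s)" for r
    by (rule red[of "\<lambda>x s. (norm (B r))\<^sup>2 * x * c r s"]) simp
  moreover have "(\<Sum>r\<in>UNIV. \<Sum>s\<in>J. (norm (B r))\<^sup>2 * (norm (B s))\<^sup>2 * c r s) = (\<Sum>r\<in>J. \<Sum>s\<in>J. (norm (B r))\<^sup>2 * (norm (B s))\<^sup>2 * c r s)"
    by (rule red[of "\<lambda>x r. \<Sum>s\<in>J. x * (norm (B s))\<^sup>2 * c r s"]) simp
  moreover have "(\<Sum>r\<in>UNIV. (norm (B r))\<^sup>2) = (\<Sum>r\<in>J. (norm (B r))\<^sup>2)"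
    by (rule red[of "\<lambda>x r. x"]) simp
  ultimately show ?thesis using w by (simp only: e flip: dot_square_norm)
qed

text \<open>The matrix with rows \<open>v r\<close> is orthogonal, so its columns are orthonormal
  too; this is Parseval's identity for two coordinate vectors. The values \<open>X p\<close> range
  over an arbitrary inner product space because the lemma is applied to the matrices themselves and,
  one index at a time, to their commutators.\<close>

lemma sum_inner_rotation:
  fixes X :: "'k::finite \<Rightarrow> 'a::real_inner" and v :: "'k \<Rightarrow> real^'k"
  assumes v: "orthonormal_family v"
  shows "(\<Sum>r\<in>UNIV. (\<Sum>p\<in>UNIV. v r $ p *\<^sub>R X p) \<bullet> (\<Sum>q\<in>UNIV. v r $ q *\<^sub>R X q)) = (\<Sum>p\<in>UNIV. X p \<bullet> X p)"
proof -
  have o: "(\<Sum>r\<in>UNIV. v r $ p * v r $ q) = (if p = q then 1 else 0)" for p q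
    using orthonormal_family_parseval[OF v, of "axis p 1" "axis q 1"]
    by (simp add: inner_axis' inner_axis_axis) (simp add: axis_def)
  have "(\<Sum>r\<in>UNIV. (\<Sum>p\<in>UNIV. v r $ p *\<^sub>R X p) \<bullet> (\<Sum>q\<in>UNIV. v r $ q *\<^sub>R X q))
      = (\<Sum>r\<in>UNIV. \<Sum>p\<in>UNIV. \<Sum>q\<in>UNIV. (v r $ p * v r $ q) * (X p \<bullet> X q))"
    by (simp add: inner_sum_left inner_sum_right sum_distrib_left mult_ac inner_commute)
  also have "\<dots> = (\<Sum>p\<in>UNIV. \<Sum>q\<in>UNIV. \<Sum>r\<in>UNIV. (v r $ p * v r $ q) * (X p \<bullet> X q))"
    by (rule trans[OF sum.swap], rule sum.cong[OF refl], rule sum.swap)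
  also have "\<dots> = (\<Sum>p\<in>UNIV. X p \<bullet> X p)"
    by (simp add: o if_distrib[of "\<lambda>x. x * _"] cong: if_cong flip: sum_distrib_right)
  finally show ?thesis .
qed

text \<open>Both sides are unchanged when the family is rotated. Eigenvectors of the Gram matrix
  \<open>M\<close> give a rotated family \<open>B\<close> with
  \<open>B r \<bullet> B s = v r \<bullet> (M *v v s)\<close>, which is zero for distinct indices.
  The name abbreviates De Smet, Dillen, Verstraelen and Vrancken.\<close>

theorem ddvv_inequality:
  fixes A :: "'k::finite \<Rightarrow> real^'n^'n"
  assumes sym: "\<And>r. transpose (A r) = A r"
  shows "(\<Sum>r\<in>UNIV. \<Sum>s\<in>UNIV. commutator (A r) (A s) \<bullet> commutator (A r) (A s)) \<le> (\<Sum>r\<in>UNIV. A r \<bullet> A r)\<^sup>2"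
proof -
  define M :: "real^'k^'k" where "M = (\<chi> r s. A r \<bullet> A s)"
  have "transpose M = M" by (simp add: M_def transpose_def vec_eq_iff inner_commute)
  then obtain v :: "'k \<Rightarrow> real^'k" and l where v: "orthonormal_family v" and l: "\<forall>r. M *v v r = l r *\<^sub>R v r"
    using symmetric_matrix_eigenbasis by blast
  define B where "B r = (\<Sum>p\<in>UNIV. v r $ p *\<^sub>R A p)" for r
  have iv: "x \<bullet> y = (\<Sum>p\<in>UNIV. x $ p * y $ p)" for x y :: "real^'k"
    by (simp add: inner_vec_def)
  have orth: "B r \<bullet> B s = 0" if "r \<noteq> s" for r s
  proof -
    have "B r \<bullet> B s = v r \<bullet> (M *v v s)"
      by (simp add: B_def M_def iv matrix_vector_mult_def inner_sum_left inner_sum_right sum_distrib_left mult_ac) (rule sum.swap)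
    then show ?thesis using l v that by (simp add: orthonormal_family_def)
  qed
  have symB: "transpose (B r) = B r" for r
    using sym by (simp add: B_def vec_eq_iff transpose_def)
  have comm: "commutator (B r) (B s) = (\<Sum>p\<in>UNIV. v r $ p *\<^sub>R (\<Sum>q\<in>UNIV. v s $ q *\<^sub>R commutator (A p) (A q)))" for r s
    by (simp add: B_def commutator_sum commutator_scaleR scaleR_sum_right)
  have "(\<Sum>r\<in>UNIV. \<Sum>s\<in>UNIV. commutator (B r) (B s) \<bullet> commutator (B r) (B s))
     = (\<Sum>s\<in>UNIV. \<Sum>r\<in>UNIV. commutator (B r) (B s) \<bullet> commutator (B r) (B s))"
    by (rule sum.swap)
  also have "\<dots> = (\<Sum>s\<in>UNIV. \<Sum>p\<in>UNIV. (\<Sum>q\<in>UNIV. v s $ q *\<^sub>R commutator (A p) (A q)) \<bullet> (\<Sum>q\<in>UNIV. v s $ q *\<^sub>R commutator (A p) (A q)))"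
    unfolding comm sum_inner_rotation[OF v] ..
  also have "\<dots> = (\<Sum>p\<in>UNIV. \<Sum>s\<in>UNIV. (\<Sum>q\<in>UNIV. v s $ q *\<^sub>R commutator (A p) (A q)) \<bullet> (\<Sum>q\<in>UNIV. v s $ q *\<^sub>R commutator (A p) (A q)))"
    by (rule sum.swap)
  also have "\<dots> = (\<Sum>p\<in>UNIV. \<Sum>q\<in>UNIV. commutator (A p) (A q) \<bullet> commutator (A p) (A q))"
    unfolding sum_inner_rotation[OF v] ..
  finally have 1: "(\<Sum>r\<in>UNIV. \<Sum>s\<in>UNIV. commutator (B r) (B s) \<bullet> commutator (B r) (B s))
     = (\<Sum>p\<in>UNIV. \<Sum>q\<in>UNIV. commutator (A p) (A q) \<bullet> commutator (A p) (A q))" .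
  have 2: "(\<Sum>r\<in>UNIV. B r \<bullet> B r) = (\<Sum>r\<in>UNIV. A r \<bullet> A r)"
    unfolding B_def by (rule sum_inner_rotation[OF v])
  show ?thesis using commutator_sum_le_orthogonal[of B, OF symB orth] unfolding 1 2 .
qed

section \<open>Functions of class \<open>C\<^sup>k\<close>\<close>

abbreviation dd :: "('a::real_normed_vector \<Rightarrow> 'b::real_normed_vector) \<Rightarrow> 'a \<Rightarrow> 'a \<Rightarrow> 'b" where
  "dd f x v \<equiv> frechet_derivative f (at x) v"

lemma dd_eq: "(f has_derivative f') (at x) \<Longrightarrow> dd f x v = f' v"
  using frechet_derivative_at by metis

text \<open>Holds without differentiability as well: if neither function has a derivative at
  \<open>x\<close>, the choice operator in \<open>frechet_derivative\<close> is applied to the same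
  empty predicate in both cases.\<close>

lemma dd_cong:
  assumes "open S" "x \<in> S" "\<And>y. y \<in> S \<Longrightarrow> f y = g y"
  shows "dd f x v = dd g x v"
proof (cases "f differentiable (at x)")
  case True
  then show ?thesis using frechet_derivative_transform_within_open[OF True assms(1,2)] assms(3) by simp
next
  case False
  have "\<not> g differentiable (at x)"
    using False has_derivative_transform_within_open[of g _ x UNIV S f] assms
    unfolding differentiable_def by auto
  moreover have "\<And>f'. (f has_derivative f') (at x) \<longleftrightarrow> (g has_derivative f') (at x)"
    using False \<open>\<not> g differentiable (at x)\<close> unfolding differentiable_def by blast
  ultimately show ?thesis unfolding frechet_derivative_def by simp
qed

lemma differentiable_cong_open:
  assumes "open S" "x \<in> S" "\<And>y. y \<in> S \<Longrightarrow> f y = g y" "f differentiable (at x)"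
  shows "g differentiable (at x)"
  using assms has_derivative_transform_within_open[of f _ x UNIV S g]
  unfolding differentiable_def by auto

lemma Ck_on_cong:
  assumes "open S" "Ck_on k S f" "\<And>x. x \<in> S \<Longrightarrow> f x = g x"
  shows "Ck_on k S g"
  using assms(2,3)
proof (induction k arbitrary: f g)
  case 0
  then show ?case using continuous_on_cong by (metis Ck_on.simps(1))
next
  case (Suc k)
  have "g differentiable (at x)" if "x \<in> S" for x
    using differentiable_cong_open[OF assms(1) that Suc.prems(2)] Suc.prems(1) that by simp
  moreover have "Ck_on k S (\<lambda>x. dd g x v)" for v
    by (rule Suc.IH[of "\<lambda>x. dd f x v"]) (use Suc.prems dd_cong[OF assms(1) _ Suc.prems(2)] in auto)
  ultimately show ?case by simp
qed

lemma Ck_on_SucD: "Ck_on (Suc k) S f \<Longrightarrow> Ck_on k S f"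
proof (induction k arbitrary: f)
  case 0
  then show ?case
    by (auto intro!: continuous_at_imp_continuous_on differentiable_imp_continuous_within)
next
  case (Suc k)
  then show ?case by (metis Ck_on.simps(2))
qed

lemma Ck_on_subset: "Ck_on k S f \<Longrightarrow> T \<subseteq> S \<Longrightarrow> Ck_on k T f"
  by (induction k arbitrary: f) (auto intro: continuous_on_subset)

text \<open>Lets the inductions on \<open>k\<close> below work with an explicit derivative formula
  in place of the one given by choice.\<close>

lemma Ck_on_SucI:
  assumes "open S" "\<And>x. x \<in> S \<Longrightarrow> (f has_derivative f' x) (at x)" "\<And>v. Ck_on k S (\<lambda>x. f' x v)"
  shows "Ck_on (Suc k) S f"
proof -
  have "Ck_on k S (\<lambda>x. dd f x v)" for v
    by (rule Ck_on_cong[OF assms(1,3)]) (simp add: dd_eq[OF assms(2)])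
  then show ?thesis using assms(2) by (auto simp: differentiable_def)
qed

lemma Ck_on_has_derivative:
  "Ck_on (Suc k) S f \<Longrightarrow> x \<in> S \<Longrightarrow> (f has_derivative dd f x) (at x)"
  by (simp add: frechet_derivative_works[symmetric])

lemma Ck_on_const: "open S \<Longrightarrow> Ck_on k S (\<lambda>x. c)"
proof (induction k arbitrary: c)
  case (Suc k)
  then show ?case by (intro Ck_on_SucI[where f' = "\<lambda>x v. 0"]) auto
qed simp

lemma Ck_on_add:
  "open S \<Longrightarrow> Ck_on k S f \<Longrightarrow> Ck_on k S g \<Longrightarrow> Ck_on k S (\<lambda>x. f x + g x)"
proof (induction k arbitrary: f g)
  case (Suc k)
  show ?case
    by (rule Ck_on_SucI[OF Suc.prems(1) has_derivative_add[OF Ck_on_has_derivative[OF Suc.prems(2)] Ck_on_has_derivative[OF Suc.prems(3)]]])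
      (use Suc in auto)
qed (auto intro: continuous_on_add)

lemma Ck_on_sum:
  assumes "open S" "\<And>i. i \<in> I \<Longrightarrow> Ck_on k S (f i)"
  shows "Ck_on k S (\<lambda>x. \<Sum>i\<in>I. f i x)"
  using assms(2) by (induction I rule: infinite_finite_induct) (simp_all add: Ck_on_const Ck_on_add assms(1))

lemma Ck_on_linear:
  assumes L: "bounded_linear L"
  shows "open S \<Longrightarrow> Ck_on k S f \<Longrightarrow> Ck_on k S (\<lambda>x. L (f x))"
proof (induction k arbitrary: f)
  case 0
  then show ?case using L by (auto intro: bounded_linear.continuous_on)
next
  case (Suc k)
  show ?case
    by (rule Ck_on_SucI[OF Suc.prems(1) bounded_linear.has_derivative[OF L Ck_on_has_derivative[OF Suc.prems(2)]]])
      (use Suc in auto)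
qed

lemma Ck_on_bilinear:
  assumes B: "bounded_bilinear B"
  shows "open S \<Longrightarrow> Ck_on k S f \<Longrightarrow> Ck_on k S g \<Longrightarrow> Ck_on k S (\<lambda>x. B (f x) (g x))"
proof (induction k arbitrary: f g)
  case 0
  then show ?case using B by (auto intro: bounded_bilinear.continuous_on)
next
  case (Suc k)
  show ?case
    by (rule Ck_on_SucI[OF Suc.prems(1) bounded_bilinear.FDERIV[OF B Ck_on_has_derivative[OF Suc.prems(2)] Ck_on_has_derivative[OF Suc.prems(3)]]])
      (use Suc Ck_on_SucD[OF Suc.prems(2)] Ck_on_SucD[OF Suc.prems(3)] in \<open>auto intro!: Ck_on_add\<close>)
qed

lemma Ck_on_prod:
  fixes f :: "'i \<Rightarrow> 'a::real_normed_vector \<Rightarrow> real"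
  assumes "open S" "\<And>i. i \<in> I \<Longrightarrow> Ck_on k S (f i)"
  shows "Ck_on k S (\<lambda>x. \<Prod>i\<in>I. f i x)"
  using assms(2)
  by (induction I rule: infinite_finite_induct)
    (simp_all add: Ck_on_const Ck_on_bilinear[OF bounded_bilinear_mult] assms(1))

lemma Ck_on_inverse:
  fixes f :: "'a::real_normed_vector \<Rightarrow> real"
  shows "open S \<Longrightarrow> Ck_on k S f \<Longrightarrow> (\<And>x. x \<in> S \<Longrightarrow> f x \<noteq> 0) \<Longrightarrow> Ck_on k S (\<lambda>x. inverse (f x))"
proof (induction k)
  case 0
  then show ?case by (auto intro: continuous_on_inverse)
next
  case (Suc k)
  note C = Ck_on_bilinear[OF bounded_bilinear_mult Suc.prems(1)]
  have i: "Ck_on k S (\<lambda>x. inverse (f x))" using Suc Ck_on_SucD[OF Suc.prems(2)] by blast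
  show ?case
  proof (rule Ck_on_SucI[OF Suc.prems(1)])
    show "((\<lambda>x. inverse (f x)) has_derivative (\<lambda>v. (- 1) * (inverse (f x) * dd f x v * inverse (f x)))) (at x)" if "x \<in> S" for x
      using Deriv.has_derivative_inverse[OF Suc.prems(3)[OF that] Ck_on_has_derivative[OF Suc.prems(2) that]] by simp
    show "Ck_on k S (\<lambda>x. (- 1) * (inverse (f x) * dd f x v * inverse (f x)))" for v
      using Suc.prems(2) by (intro C i Ck_on_const Suc.prems(1)) auto
  qed
qed

text \<open>The chain rule differentiates \<open>g\<close> in the direction \<open>dd f x v\<close>,
  which varies with \<open>x\<close>, whereas \<open>Ck_on\<close> speaks of constant directions.
  Expanding that direction over \<open>Basis\<close> leaves products of coefficients with
  \<open>dd g (f x) b\<close>, and the induction hypothesis, general in \<open>g\<close>, covers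
  these.\<close>

lemma Ck_on_compose:
  fixes g :: "'b::euclidean_space \<Rightarrow> 'c::real_normed_vector" and f :: "'a::real_normed_vector \<Rightarrow> 'b"
  assumes S: "open S" and T: "open T" and ST: "f ` S \<subseteq> T"
  shows "Ck_on k T g \<Longrightarrow> Ck_on k S f \<Longrightarrow> Ck_on k S (\<lambda>x. g (f x))"
proof (induction k arbitrary: g)
  case 0
  then show ?case using ST by (auto intro: continuous_on_compose2)
next
  case (Suc k)
  have f: "Ck_on k S f" using Ck_on_SucD[OF Suc.prems(2)] .
  show ?case
  proof (rule Ck_on_SucI[OF S])
    fix x assume x: "x \<in> S"
    have dg: "(g has_derivative dd g (f x)) (at (f x))"
      using Ck_on_has_derivative[OF Suc.prems(1)] ST x by blast
    have df: "(f has_derivative dd f x) (at x)" using Ck_on_has_derivative[OF Suc.prems(2) x] .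
    have l: "linear (dd g (f x))" using dg has_derivative_linear by blast
    have e: "dd g (f x) v = (\<Sum>b\<in>Basis. (v \<bullet> b) *\<^sub>R dd g (f x) b)" for v
    proof -
      have "dd g (f x) (\<Sum>b\<in>Basis. (v \<bullet> b) *\<^sub>R b) = (\<Sum>b\<in>Basis. (v \<bullet> b) *\<^sub>R dd g (f x) b)"
        by (simp only: linear_sum[OF l] linear_cmul[OF l] o_def)
      then show ?thesis by (simp only: euclidean_representation)
    qed
    show "((\<lambda>x. g (f x)) has_derivative (\<lambda>v. \<Sum>b\<in>Basis. (dd f x v \<bullet> b) *\<^sub>R dd g (f x) b)) (at x)"
      by (rule has_derivative_eq_rhs[OF has_derivative_compose[OF df dg]]) (rule ext, rule e)
  next
    show "Ck_on k S (\<lambda>x. \<Sum>b\<in>Basis. (dd f x v \<bullet> b) *\<^sub>R dd g (f x) b)" for v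
    proof (intro Ck_on_sum S Ck_on_bilinear[OF bounded_bilinear_scaleR S] Ck_on_linear[OF bounded_linear_inner_left S])
      show "Ck_on k S (\<lambda>x. dd f x v)" using Suc.prems(2) by simp
      show "Ck_on k S (\<lambda>x. dd g (f x) b)" for b
        using Suc.IH[OF _ f, of "\<lambda>y. dd g y b"] Suc.prems(1) by simp
    qed
  qed
qed

lemma Ck_on_exp: "Ck_on k UNIV (exp :: real \<Rightarrow> real)"
proof (induction k)
  case (Suc k)
  show ?case
    by (rule Ck_on_SucI[where f' = "\<lambda>x v. exp x * v"])
      (auto intro!: Ck_on_bilinear[OF bounded_bilinear_mult] Suc Ck_on_const derivative_eq_intros)
qed (simp add: continuous_on_exp)

lemma Ck_on_componentwise:
  fixes f :: "'a::real_normed_vector \<Rightarrow> 'b::real_normed_vector^'n"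
  assumes S: "open S" and f: "\<And>i. Ck_on k S (\<lambda>x. f x $ i)"
  shows "Ck_on k S f"
proof -
  have l: "bounded_linear (\<lambda>c::'b. \<chi> j. if j = i then c else 0)" for i :: 'n
    by (rule bounded_linear_intro[of _ 1])
      (auto simp: vec_eq_iff norm_vec_def L2_set_def if_distrib[of "\<lambda>x. (norm x)\<^sup>2"] cong: if_cong)
  have "Ck_on k S (\<lambda>x. \<Sum>i\<in>UNIV. \<chi> j. if j = i then f x $ i else 0)"
    by (intro Ck_on_sum S Ck_on_linear[OF l] f)
  moreover have "(\<Sum>i\<in>UNIV. \<chi> j. if j = i then f x $ i else 0) = f x" for x
    by (simp add: vec_eq_iff if_distrib cong: if_cong)
  ultimately show ?thesis by simp
qed

lemma Ck_on_matrixI: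
  fixes f :: "'a::real_normed_vector \<Rightarrow> real^'n^'m"
  assumes "open S" and "\<And>i j. Ck_on k S (\<lambda>x. f x $ i $ j)"
  shows "Ck_on k S f"
  by (intro Ck_on_componentwise assms)

lemma Ck_on_component:
  "open S \<Longrightarrow> Ck_on k S f \<Longrightarrow> Ck_on k S (\<lambda>x. f x $ i)"
  by (rule Ck_on_linear[OF bounded_linear_vec_nth])

lemma Ck_on_det:
  fixes f :: "'a::real_normed_vector \<Rightarrow> real^'n^'n"
  assumes S: "open S" and f: "\<And>i j. Ck_on k S (\<lambda>x. f x $ i $ j)"
  shows "Ck_on k S (\<lambda>x. det (f x))"
  unfolding det_def
  by (intro Ck_on_sum Ck_on_bilinear[OF bounded_bilinear_mult] Ck_on_prod Ck_on_const f S)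

lemma
  fixes M :: "real^'n^'n"
  assumes "invertible M"
  shows matrix_inv_mult_right: "M ** matrix_inv M = mat 1"
    and matrix_inv_mult_left: "matrix_inv M ** M = mat 1"
  using someI_ex[OF assms[unfolded invertible_def]] unfolding matrix_inv_def by auto

text \<open>Cramer's rule for the columns of the inverse; it exhibits the entries as rational
  functions of those of \<open>M\<close>, which makes the inverse metric smooth.\<close>

lemma matrix_inv_cramer:
  fixes M :: "real^'n^'n"
  assumes "det M \<noteq> 0"
  shows "matrix_inv M $ k $ j = det (\<chi> i l. if l = k then axis j 1 $ i else M $ i $ l) * inverse (det M)"
proof -
  have "M *v (matrix_inv M *v axis j 1) = axis j 1"
    using assms by (simp add: matrix_vector_mul_assoc invertible_det_nz matrix_inv_mult_right)
  then have "matrix_inv M *v axis j 1 = (\<chi> k. det (\<chi> i l. if l = k then axis j 1 $ i else M $ i $ l) / det M)"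
    by (simp only: cramer[OF assms])
  moreover have "(matrix_inv M *v axis j 1) $ k = matrix_inv M $ k $ j"
    by (simp add: matrix_vector_mult_basis column_def)
  ultimately show ?thesis by (simp add: divide_inverse)
qed

lemma Ck_on_matrix_inv:
  fixes f :: "'a::real_normed_vector \<Rightarrow> real^'n^'n"
  assumes S: "open S" and f: "Ck_on k S f" and d: "\<And>x. x \<in> S \<Longrightarrow> det (f x) \<noteq> 0"
  shows "Ck_on k S (\<lambda>x. matrix_inv (f x))"
proof -
  have c: "Ck_on k S (\<lambda>x. f x $ i $ j)" for i j by (intro Ck_on_component S f)
  have c': "Ck_on k S (\<lambda>x. det (\<chi> i l. if l = p then axis q 1 $ i else f x $ i $ l) * inverse (det (f x)))" for p q
  proof (intro Ck_on_bilinear[OF bounded_bilinear_mult S] Ck_on_inverse[OF S] Ck_on_det[OF S] c d)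
    fix i j show "Ck_on k S (\<lambda>x. (\<chi> i l. if l = p then axis q 1 $ i else f x $ i $ l) $ i $ j)"
      by (cases "j = p") (simp_all add: c Ck_on_const S)
  qed
  have "Ck_on k S (\<lambda>x. matrix_inv (f x) $ p $ q)" for p q
    by (rule Ck_on_cong[OF S c'[of p q]]) (simp add: matrix_inv_cramer[OF d])
  then show ?thesis by (intro Ck_on_matrixI S)
qed

section \<open>Symmetry of second derivatives\<close>

text \<open>The mean value theorem is applied to the increment \<open>p\<close> in the direction
  \<open>u\<close>, then to \<open>dd f\<close> along \<open>v\<close>. The second difference is
  symmetric in \<open>u\<close> and \<open>v\<close> while the right side is not, which is the
  source of \<open>dd_commute_real\<close>.\<close>

lemma second_difference_mvt:
  fixes f :: "'a::real_normed_vector \<Rightarrow> real"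
  assumes S: "ball x r \<subseteq> S" and f: "Ck_on 2 S f" and h: "h > 0" "h * (norm u + norm v) < r"
  shows "\<exists>y. dist y x \<le> h * (norm u + norm v) \<and>
    f (x + h *\<^sub>R u + h *\<^sub>R v) - f (x + h *\<^sub>R u) - f (x + h *\<^sub>R v) + f x = h\<^sup>2 * dd (\<lambda>z. dd f z u) y v"
proof -
  have bd: "norm (s *\<^sub>R u + t *\<^sub>R v) \<le> h * (norm u + norm v)" if "0 \<le> s" "s \<le> h" "0 \<le> t" "t \<le> h" for s t
  proof -
    have "norm (s *\<^sub>R u + t *\<^sub>R v) \<le> s * norm u + t * norm v"
      using norm_triangle_ineq[of "s *\<^sub>R u" "t *\<^sub>R v"] that by simp
    also have "\<dots> \<le> h * norm u + h * norm v" using that by (intro add_mono mult_right_mono) auto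
    finally show ?thesis by (simp add: distrib_left)
  qed
  have inS: "x + (s *\<^sub>R u + t *\<^sub>R v) \<in> S" if "0 \<le> s" "s \<le> h" "0 \<le> t" "t \<le> h" for s t
  proof -
    have "dist (x + (s *\<^sub>R u + t *\<^sub>R v)) x < r" using bd[OF that] h by (simp add: dist_norm)
    then show ?thesis using S by (auto simp: dist_commute)
  qed
  have f1: "(f has_derivative dd f y) (at y)" if "y \<in> S" for y
    using f that Ck_on_has_derivative[of 1 S f y] by (simp add: numeral_2_eq_2)
  have f2: "((\<lambda>z. dd f z u) has_derivative dd (\<lambda>z. dd f z u) y) (at y)" if "y \<in> S" for y
    using f that Ck_on_has_derivative[of 0 S "\<lambda>z. dd f z u" y] by (simp add: numeral_2_eq_2)
  have line: "((\<lambda>s. g (a + s *\<^sub>R w)) has_real_derivative g' w) (at s)"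
    if "(g has_derivative g') (at (a + s *\<^sub>R w))" for g :: "'a \<Rightarrow> real" and g' a w s
  proof -
    have "((\<lambda>s. a + s *\<^sub>R w) has_derivative (\<lambda>t. t *\<^sub>R w)) (at s)"
      by (auto intro!: derivative_eq_intros)
    from has_derivative_compose[OF this that] show ?thesis
      using linear_cmul[OF has_derivative_linear[OF that]]
      by (simp add: has_field_derivative_def mult.commute[of _ "g' w"])
  qed
  define p where "p s = f (x + h *\<^sub>R v + s *\<^sub>R u) - f (x + s *\<^sub>R u)" for s
  have "\<exists>s. 0 < s \<and> s < h \<and> p h - p 0 = (h - 0) * (dd f (x + h *\<^sub>R v + s *\<^sub>R u) u - dd f (x + s *\<^sub>R u) u)"
    unfolding p_def
  proof (rule MVT2[OF h(1)])
    fix s assume s: "0 \<le> s" "s \<le> h"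
    have "x + h *\<^sub>R v + s *\<^sub>R u \<in> S" "x + s *\<^sub>R u \<in> S"
      using inS[OF s, of h] inS[OF s, of 0] h by (simp_all add: algebra_simps)
    then show "((\<lambda>s. f (x + h *\<^sub>R v + s *\<^sub>R u) - f (x + s *\<^sub>R u)) has_real_derivative
      dd f (x + h *\<^sub>R v + s *\<^sub>R u) u - dd f (x + s *\<^sub>R u) u) (at s)"
      by (intro DERIV_diff line f1)
  qed
  then obtain s where s: "0 < s" "s < h" and
    ps: "p h - p 0 = h * (dd f (x + h *\<^sub>R v + s *\<^sub>R u) u - dd f (x + s *\<^sub>R u) u)" by auto
  have "\<exists>t. 0 < t \<and> t < h \<and> dd f (x + s *\<^sub>R u + h *\<^sub>R v) u - dd f (x + s *\<^sub>R u + 0 *\<^sub>R v) u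
      = (h - 0) * dd (\<lambda>z. dd f z u) (x + s *\<^sub>R u + t *\<^sub>R v) v"
  proof (rule MVT2[OF h(1)])
    fix t assume "0 \<le> t" "t \<le> h"
    then have "x + s *\<^sub>R u + t *\<^sub>R v \<in> S" using inS[of s t] s by (simp add: algebra_simps)
    then show "((\<lambda>t. dd f (x + s *\<^sub>R u + t *\<^sub>R v) u) has_real_derivative
      dd (\<lambda>z. dd f z u) (x + s *\<^sub>R u + t *\<^sub>R v) v) (at t)"
      by (rule line[OF f2])
  qed
  then obtain t where t: "0 < t" "t < h" and
    pt: "dd f (x + s *\<^sub>R u + h *\<^sub>R v) u - dd f (x + s *\<^sub>R u) u = h * dd (\<lambda>z. dd f z u) (x + s *\<^sub>R u + t *\<^sub>R v) v"
    by auto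
  have "p h - p 0 = h * (h * dd (\<lambda>z. dd f z u) (x + s *\<^sub>R u + t *\<^sub>R v) v)"
    unfolding ps pt[symmetric] by (simp add: add_ac)
  moreover have "p h - p 0 = f (x + h *\<^sub>R u + h *\<^sub>R v) - f (x + h *\<^sub>R u) - f (x + h *\<^sub>R v) + f x"
    by (simp add: p_def add_ac)
  moreover have "dist (x + s *\<^sub>R u + t *\<^sub>R v) x \<le> h * (norm u + norm v)"
    using bd[of s t] s t by (simp add: dist_norm add.assoc)
  ultimately show ?thesis
    by (intro exI[of _ "x + s *\<^sub>R u + t *\<^sub>R v"]) (simp add: power2_eq_square mult.assoc)
qed

lemma dd_commute_real:
  fixes f :: "'a::real_normed_vector \<Rightarrow> real"
  assumes S: "open S" "x \<in> S" and f: "Ck_on 2 S f"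
  shows "dd (\<lambda>z. dd f z u) x v = dd (\<lambda>z. dd f z v) x u"
proof (rule ccontr)
  let ?A = "\<lambda>y. dd (\<lambda>z. dd f z u) y v" and ?B = "\<lambda>y. dd (\<lambda>z. dd f z v) y u"
  assume ne: "?A x \<noteq> ?B x"
  define e where "e = \<bar>?A x - ?B x\<bar> / 2"
  have e: "e > 0" using ne by (simp add: e_def)
  have cont: "continuous (at x) ?A" "continuous (at x) ?B"
    using f S by (simp_all add: numeral_2_eq_2 continuous_on_eq_continuous_at)
  obtain d1 where d1: "d1 > 0" "\<And>y. dist y x < d1 \<Longrightarrow> \<bar>?A y - ?A x\<bar> < e"
    using cont(1) e unfolding continuous_at_eps_delta dist_real_def by blast
  obtain d2 where d2: "d2 > 0" "\<And>y. dist y x < d2 \<Longrightarrow> \<bar>?B y - ?B x\<bar> < e"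
    using cont(2) e unfolding continuous_at_eps_delta dist_real_def by blast
  obtain d3 where d3: "d3 > 0" "ball x d3 \<subseteq> S" using S open_contains_ball by blast
  define r where "r = min d1 (min d2 d3)"
  have r: "r > 0" "r \<le> d1" "r \<le> d2" "ball x r \<subseteq> S" using d1(1) d2(1) d3 by (auto simp: r_def subset_eq)
  \<comment> \<open>Keeps both intermediate points within \<open>r\<close> of \<open>x\<close>; the
    1 in the denominator allows \<open>u\<close> and \<open>v\<close> to vanish.\<close>
  define h where "h = r / (norm u + norm v + 1)"
  have n: "norm u + norm v + 1 > 0" by (simp add: add_nonneg_pos)
  have h: "h > 0" using r n by (simp add: h_def)
  have hr: "h * (norm u + norm v) < r" using r n by (simp add: h_def field_simps)
  then have hr': "h * (norm v + norm u) < r" by (simp add: add.commute)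
  obtain y where y: "dist y x \<le> h * (norm u + norm v)"
    "f (x + h *\<^sub>R u + h *\<^sub>R v) - f (x + h *\<^sub>R u) - f (x + h *\<^sub>R v) + f x = h\<^sup>2 * ?A y"
    using second_difference_mvt[OF r(4) f h hr] by blast
  obtain y' where y': "dist y' x \<le> h * (norm v + norm u)"
    "f (x + h *\<^sub>R v + h *\<^sub>R u) - f (x + h *\<^sub>R v) - f (x + h *\<^sub>R u) + f x = h\<^sup>2 * ?B y'"
    using second_difference_mvt[OF r(4) f h hr'] by blast
  have "h\<^sup>2 * ?A y = h\<^sup>2 * ?B y'"
    unfolding y(2)[symmetric] y'(2)[symmetric] by (simp add: add_ac)
  then have "?A y = ?B y'" using h by simp
  moreover have "\<bar>?A y - ?A x\<bar> < e" using d1(2) y(1) hr r by simp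
  moreover have "\<bar>?B y' - ?B x\<bar> < e" using d2(2) y'(1) hr' r by simp
  ultimately show False unfolding e_def by argo
qed

lemma dd_linear:
  assumes L: "bounded_linear L" and f: "f differentiable (at x)"
  shows "dd (\<lambda>z. L (f z)) x v = L (dd f x v)"
  using bounded_linear.has_derivative[OF L frechet_derivative_works[THEN iffD1, OF f]]
  by (rule dd_eq)

theorem dd_commute:
  fixes f :: "'a::real_normed_vector \<Rightarrow> 'b::euclidean_space"
  assumes S: "open S" "x \<in> S" and f: "Ck_on 2 S f"
  shows "dd (\<lambda>z. dd f z u) x v = dd (\<lambda>z. dd f z v) x u"
proof (rule euclidean_eqI)
  fix b :: 'b
  have L: "bounded_linear (\<lambda>z::'b. z \<bullet> b)" by (rule bounded_linear_inner_left)
  have d1: "f differentiable (at z)" if "z \<in> S" for z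
    using f that by (simp add: numeral_2_eq_2)
  have d2: "(\<lambda>z. dd f z w) differentiable (at x)" for w
    using f S by (simp add: numeral_2_eq_2)
  have *: "dd (\<lambda>z. dd f z u) x v \<bullet> b = dd (\<lambda>z. dd (\<lambda>y. f y \<bullet> b) z u) x v" for u v
    unfolding dd_linear[OF L d2, symmetric]
    by (rule dd_cong[OF S]) (simp add: dd_linear[OF L d1])
  have "Ck_on 2 S (\<lambda>y. f y \<bullet> b)" by (rule Ck_on_linear[OF L S(1) f])
  then show "dd (\<lambda>z. dd f z u) x v \<bullet> b = dd (\<lambda>z. dd f z v) x u \<bullet> b"
    unfolding * by (rule dd_commute_real[OF S])
qed

section \<open>Levi-Civita connection and curvature in coordinates\<close>

lemma differentiable_has_dd: "f differentiable (at x) \<Longrightarrow> (f has_derivative dd f x) (at x)"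
  by (rule frechet_derivative_works[THEN iffD1])

lemma linear_dd: "f differentiable (at x) \<Longrightarrow> linear (dd f x)"
  by (rule linear_frechet_derivative)

lemma vec_axis_expand: "(\<Sum>i\<in>UNIV. u $ i *\<^sub>R axis i 1) = (u :: real^'n)"
  by (simp add: vec_eq_iff axis_def if_distrib[of "\<lambda>x. _ * x"] cong: if_cong)

lemma linear_axis_expand:
  fixes f :: "real^'n \<Rightarrow> 'b::real_vector"
  assumes "linear f"
  shows "f u = (\<Sum>i\<in>UNIV. u $ i *\<^sub>R f (axis i 1))"
proof -
  have "f (\<Sum>i\<in>UNIV. u $ i *\<^sub>R axis i 1) = (\<Sum>i\<in>UNIV. u $ i *\<^sub>R f (axis i 1))"
    using assms by (simp only: linear_sum[OF assms] linear_cmul[OF assms] o_def)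
  then show ?thesis by (simp only: vec_axis_expand)
qed

text \<open>Product rule for a linear map that depends on the point. Differentiability is asked only
  for fixed arguments; expanding the argument in coordinate axes does the rest. It serves the
  metric, the Christoffel map and the differential of an immersion.\<close>

lemma linear_has_derivative_family:
  fixes L :: "'a::real_normed_vector \<Rightarrow> real^'p \<Rightarrow> 'c::real_normed_vector"
  assumes S: "open S" "x \<in> S" and L: "\<And>z. z \<in> S \<Longrightarrow> linear (L z)"
    and d: "\<And>v. (\<lambda>z. L z v) differentiable (at x)"
    and W: "(W has_derivative W') (at x)"
  shows "((\<lambda>z. L z (W z)) has_derivative (\<lambda>h. dd (\<lambda>z. L z (W x)) x h + L x (W' h))) (at x)"
proof -
  have fam: "((\<lambda>z. \<Sum>i\<in>UNIV. c i z *\<^sub>R L z (axis i 1)) has_derivative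
      (\<lambda>h. (\<Sum>i\<in>UNIV. c i x *\<^sub>R dd (\<lambda>z. L z (axis i 1)) x h + c' i h *\<^sub>R L x (axis i 1)))) (at x)"
    if "\<And>i. (c i has_derivative c' i) (at x)" for c c'
    by (intro has_derivative_sum has_derivative_scaleR that differentiable_has_dd d)
  have W': "((\<lambda>z. W z $ i) has_derivative (\<lambda>h. W' h $ i)) (at x)" for i
    by (rule bounded_linear.has_derivative[OF bounded_linear_vec_nth W])
  have "dd (\<lambda>z. L z (W x)) x h = dd (\<lambda>z. \<Sum>i\<in>UNIV. W x $ i *\<^sub>R L z (axis i 1)) x h" for h
    by (rule dd_cong[OF S]) (rule linear_axis_expand[OF L])
  then have e: "dd (\<lambda>z. L z (W x)) x h = (\<Sum>i\<in>UNIV. W x $ i *\<^sub>R dd (\<lambda>z. L z (axis i 1)) x h)" for h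
    using dd_eq[OF fam[of "\<lambda>i z. W x $ i" "\<lambda>i h. 0"]] by simp
  have "((\<lambda>z. L z (W z)) has_derivative (\<lambda>h. \<Sum>i\<in>UNIV. W x $ i *\<^sub>R dd (\<lambda>z. L z (axis i 1)) x h + W' h $ i *\<^sub>R L x (axis i 1))) (at x)"
    by (rule has_derivative_transform_within_open[OF fam[OF W'] S]) (rule linear_axis_expand[OF L, symmetric])
  moreover have "(\<lambda>h. dd (\<lambda>z. L z (W x)) x h + L x (W' h)) =
      (\<lambda>h. \<Sum>i\<in>UNIV. W x $ i *\<^sub>R dd (\<lambda>z. L z (axis i 1)) x h + W' h $ i *\<^sub>R L x (axis i 1))"
    by (rule ext) (simp add: e sum.distrib linear_axis_expand[OF L[OF S(2)], of "W' _"])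
  ultimately show ?thesis by simp
qed

lemma linear_dd_family:
  assumes L: "\<And>z. linear (L z)" and d: "\<And>v. (\<lambda>z. L z v) differentiable (at x)"
  shows "linear (\<lambda>v. dd (\<lambda>z. L z v) x h)"
proof (rule linearI)
  show "dd (\<lambda>z. L z (u + v)) x h = dd (\<lambda>z. L z u) x h + dd (\<lambda>z. L z v) x h" for u v
    using has_derivative_add[OF d[THEN differentiable_has_dd, of u] d[THEN differentiable_has_dd, of v]]
    unfolding linear_add[OF L] by (rule dd_eq)
  show "dd (\<lambda>z. L z (c *\<^sub>R u)) x h = c *\<^sub>R dd (\<lambda>z. L z u) x h" for c u
    using has_derivative_scaleR_right[OF d[THEN differentiable_has_dd, of u], of c]
    unfolding linear_cmul[OF L] by (rule dd_eq)
qed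

lemma bilinear_axis_expand:
  fixes f :: "real^'n \<Rightarrow> real^'p \<Rightarrow> 'b::real_vector"
  assumes "\<And>v. linear (\<lambda>u. f u v)" "\<And>u. linear (f u)"
  shows "f u v = (\<Sum>i\<in>UNIV. \<Sum>j\<in>UNIV. (u $ i * v $ j) *\<^sub>R f (axis i 1) (axis j 1))"
  unfolding linear_axis_expand[OF assms(1), of u v]
  by (subst linear_axis_expand[OF assms(2)]) (simp add: scaleR_sum_right)

lemma ginner_simps:
  "ginner G y (u + u') v = ginner G y u v + ginner G y u' v"
  "ginner G y u (v + v') = ginner G y u v + ginner G y u v'"
  "ginner G y (u - u') v = ginner G y u v - ginner G y u' v"
  "ginner G y u (v - v') = ginner G y u v - ginner G y u v'"
  "ginner G y (c *\<^sub>R u) v = c * ginner G y u v"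
  "ginner G y u (c *\<^sub>R v) = c * ginner G y u v"
  "ginner G y (- u) v = - ginner G y u v"
  "ginner G y u (- v) = - ginner G y u v"
  "ginner G y 0 v = 0" "ginner G y u 0 = 0"
  using matrix_vector_mult_scaleR[of "G y" "- 1" v]
  by (simp_all add: ginner_def inner_add_left inner_add_right inner_diff_left inner_diff_right
      matrix_vector_right_distrib matrix_vector_mult_diff_distrib matrix_vector_mult_scaleR)

lemma ginner_sum_left: "ginner G y (\<Sum>i\<in>I. f i) v = (\<Sum>i\<in>I. ginner G y (f i) v)"
  by (simp add: ginner_def inner_sum_left)

lemma ginner_sum_right: "ginner G y u (\<Sum>i\<in>I. f i) = (\<Sum>i\<in>I. ginner G y u (f i))"
  by (induction I rule: infinite_finite_induct) (simp_all add: ginner_simps)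

lemma linear_ginner_left: "linear (\<lambda>u. ginner G y u v)"
  by (rule linearI) (simp_all add: ginner_simps)

lemma linear_ginner_right: "linear (ginner G y u)"
  by (rule linearI) (simp_all add: ginner_simps)

lemma ginner_axis: "ginner G y (axis i 1) (axis j 1) = G y $ i $ j"
  by (simp add: ginner_def inner_axis' matrix_vector_mult_basis column_def)

lemma bounded_linear_ginner: "bounded_linear (\<lambda>M :: real^'m^'n. v \<bullet> (M *v w))"
  unfolding linear_conv_bounded_linear[symmetric]
  by (rule linearI) (simp_all add: matrix_vector_mult_add_rdistrib inner_add_right scaleR_matrix_vector_assoc[symmetric])

lemma christoffel_vec_axis: "christoffel_vec G y (axis i 1) (axis j 1) $ k = christoffel G k i j y"
  by (simp add: christoffel_vec_def axis_def if_distrib[of "\<lambda>x. _ * x"] if_distrib[of "\<lambda>x. x * _"] cong: if_cong)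

lemma linear_christoffel_vec_left: "linear (\<lambda>u. christoffel_vec G y u v)"
  by (rule linearI)
    (simp_all add: vec_eq_iff christoffel_vec_def algebra_simps sum.distrib sum_distrib_left)

lemma linear_christoffel_vec_right: "linear (christoffel_vec G y u)"
  by (rule linearI)
    (simp_all add: vec_eq_iff christoffel_vec_def algebra_simps sum.distrib sum_distrib_left)

lemmas christoffel_vec_simps =
  linear_add[OF linear_christoffel_vec_left] linear_add[OF linear_christoffel_vec_right]
  linear_diff[OF linear_christoffel_vec_left] linear_diff[OF linear_christoffel_vec_right]
  linear_cmul[OF linear_christoffel_vec_left] linear_cmul[OF linear_christoffel_vec_right]

section \<open>The Levi-Civita connection and curvature of one metric\<close>

text \<open>Kept free of charts so that it can be instantiated several times: for the ambient
  metric, for its conformal multiple and for the induced metric.\<close>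

locale riemannian_coords =
  fixes U :: "(real^'m::finite) set" and G :: "real^'m \<Rightarrow> real^'m^'m"
  assumes open_U: "open U" and Ck_G: "\<And>k. Ck_on k U G"
    and sym_G: "\<And>y. y \<in> U \<Longrightarrow> transpose (G y) = G y"
    and pos_G: "\<And>y v. y \<in> U \<Longrightarrow> v \<noteq> 0 \<Longrightarrow> ginner G y v v > 0"
begin

abbreviation "g \<equiv> ginner G"
abbreviation "\<Gamma> \<equiv> christoffel_vec G"

lemma g_commute: "y \<in> U \<Longrightarrow> g y u v = g y v u"
  unfolding ginner_def using dot_lmul_matrix[of u "G y" v] transpose_matrix_vector[of "G y" u] sym_G[of y]
  by (simp add: inner_commute)

lemma g_nondegenerate:
  assumes "y \<in> U" "\<And>w. g y u w = g y v w"
  shows "u = v"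
proof (rule ccontr)
  assume "u \<noteq> v"
  then have "g y (u - v) (u - v) > 0" using pos_G[OF assms(1)] by simp
  then show False using assms(2)[of "u - v"] by (simp add: ginner_simps)
qed

lemma invertible_G: "y \<in> U \<Longrightarrow> invertible (G y)"
  unfolding invertible_left_inverse matrix_left_invertible_ker
  using pos_G[of y] by (auto simp: ginner_def) (metis inner_zero_right less_irrefl)

lemma det_G: "y \<in> U \<Longrightarrow> det (G y) \<noteq> 0"
  using invertible_G by (simp add: invertible_det_nz)

lemma g_matrix_inv: "y \<in> U \<Longrightarrow> g y (matrix_inv (G y) *v z) w = z \<bullet> w"
  by (subst g_commute)
    (simp_all add: ginner_def matrix_vector_mul_assoc matrix_inv_mult_right invertible_G inner_commute)

lemma Ck_g: "Ck_on k U (\<lambda>z. g z v w)"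
  unfolding ginner_def by (rule Ck_on_linear[OF bounded_linear_ginner open_U Ck_G])

lemma Ck_dg: "Ck_on k U (\<lambda>y. dd (\<lambda>z. g z v w) y u)"
  using Ck_g[of "Suc k" v w] by simp

lemma differentiable_g: "y \<in> U \<Longrightarrow> (\<lambda>z. g z v w) differentiable (at y)"
  using Ck_g[of "Suc 0" v w] by simp

lemma dg_commute: "y \<in> U \<Longrightarrow> dd (\<lambda>z. g z v w) y u = dd (\<lambda>z. g z w v) y u"
  by (rule dd_cong[OF open_U]) (auto intro: g_commute)

lemma linear_dg:
  assumes "y \<in> U"
  shows "linear (dd (\<lambda>z. g z v w) y)" "linear (\<lambda>v. dd (\<lambda>z. g z v w) y u)" "linear (\<lambda>w. dd (\<lambda>z. g z v w) y u)"
  by (rule linear_dd[OF differentiable_g[OF assms]] linear_dd_family linear_ginner_left linear_ginner_right differentiable_g[OF assms])+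

text \<open>The Koszul formula for the inner product of nabla_u v with w, for constant fields, whose
  brackets vanish.\<close>

definition koszul :: "real^'m \<Rightarrow> real^'m \<Rightarrow> real^'m \<Rightarrow> real^'m \<Rightarrow> real" where
  "koszul y u v w = (dd (\<lambda>z. g z v w) y u + dd (\<lambda>z. g z u w) y v - dd (\<lambda>z. g z u v) y w) / 2"

lemma linear_koszul:
  assumes "y \<in> U"
  shows "linear (\<lambda>u. koszul y u v w)" "linear (\<lambda>v. koszul y u v w)" "linear (koszul y u v)"
proof -
  note l = linear_dg[OF assms, THEN linear_add] linear_dg[OF assms, THEN linear_cmul]
  show "linear (\<lambda>u. koszul y u v w)" "linear (\<lambda>v. koszul y u v w)" "linear (koszul y u v)"
    unfolding koszul_def by (rule linearI; unfold l; simp add: algebra_simps add_divide_distrib diff_divide_distrib)+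
qed

text \<open>The index definition of the Christoffel symbols is the Koszul expression with its last
  slot raised by the inverse metric; bilinearity carries this from axes to all vectors.\<close>

lemma christoffel_vec_eq_koszul:
  assumes y: "y \<in> U"
  shows "\<Gamma> y u v = matrix_inv (G y) *v (\<chi> l. koszul y u v (axis l 1))"
proof -
  have k: "christoffel G k i j y = (\<Sum>l\<in>UNIV. matrix_inv (G y) $ k $ l * koszul y (axis i 1) (axis j 1) (axis l 1))" for k i j
    by (simp add: christoffel_def koszul_def pd_def ginner_axis sum_distrib_left)
  have ex: "koszul y u v w = (\<Sum>i\<in>UNIV. \<Sum>j\<in>UNIV. (u $ i * v $ j) * koszul y (axis i 1) (axis j 1) w)" for w
    using bilinear_axis_expand[of "\<lambda>u v. koszul y u v w" u v, OF linear_koszul(1,2)[OF y]]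
    by (simp only: real_scaleR_def)
  show ?thesis
  proof (rule vec_eq_iff[THEN iffD2], rule allI)
    fix k
    have "\<Gamma> y u v $ k = (\<Sum>i\<in>UNIV. \<Sum>j\<in>UNIV. \<Sum>l\<in>UNIV. matrix_inv (G y) $ k $ l * (u $ i * v $ j * koszul y (axis i 1) (axis j 1) (axis l 1)))"
      by (simp add: christoffel_vec_def k sum_distrib_left sum_distrib_right mult_ac)
    also have "\<dots> = (\<Sum>i\<in>UNIV. \<Sum>l\<in>UNIV. \<Sum>j\<in>UNIV. matrix_inv (G y) $ k $ l * (u $ i * v $ j * koszul y (axis i 1) (axis j 1) (axis l 1)))"
      by (rule sum.cong[OF refl], rule sum.swap)
    also have "\<dots> = (\<Sum>l\<in>UNIV. \<Sum>i\<in>UNIV. \<Sum>j\<in>UNIV. matrix_inv (G y) $ k $ l * (u $ i * v $ j * koszul y (axis i 1) (axis j 1) (axis l 1)))"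
      by (rule sum.swap)
    also have "\<dots> = (matrix_inv (G y) *v (\<chi> l. koszul y u v (axis l 1))) $ k"
      by (simp add: matrix_vector_mult_def ex[of "axis _ 1"] sum_distrib_left)
    finally show "\<Gamma> y u v $ k = (matrix_inv (G y) *v (\<chi> l. koszul y u v (axis l 1))) $ k" .
  qed
qed

lemma g_christoffel:
  assumes y: "y \<in> U"
  shows "g y (\<Gamma> y u v) w = koszul y u v w"
proof -
  have "g y (\<Gamma> y u v) w = (\<chi> l. koszul y u v (axis l 1)) \<bullet> w"
    unfolding christoffel_vec_eq_koszul[OF y] by (rule g_matrix_inv[OF y])
  also have "\<dots> = koszul y u v w"
    using linear_axis_expand[OF linear_koszul(3)[OF y], of u v w] by (simp add: inner_vec_def mult.commute)
  finally show ?thesis .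
qed

text \<open>Nondegeneracy of the metric. This is the way to verify a guessed formula for a
  connection, such as that of the conformally changed metric.\<close>

lemma christoffel_vec_unique:
  "y \<in> U \<Longrightarrow> (\<And>w. g y c w = koszul y u v w) \<Longrightarrow> c = \<Gamma> y u v"
  by (rule g_nondegenerate[of y]) (simp_all add: g_christoffel)

lemma christoffel_vec_commute: "y \<in> U \<Longrightarrow> \<Gamma> y u v = \<Gamma> y v u"
  by (rule christoffel_vec_unique) (simp_all add: g_christoffel koszul_def dg_commute[of y u v])

lemma metric_compatible:
  assumes y: "y \<in> U"
  shows "dd (\<lambda>z. g z v w) y u = g y (\<Gamma> y u v) w + g y v (\<Gamma> y u w)"
  unfolding g_commute[OF y, of v] g_christoffel[OF y] koszul_def
  using dg_commute[OF y, of v w u] dg_commute[OF y, of u w v] dg_commute[OF y, of u v w] by argo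

lemma Ck_christoffel_vec: "Ck_on k U (\<lambda>y. \<Gamma> y u v)"
proof (rule Ck_on_cong[OF open_U])
  show "matrix_inv (G y) *v (\<chi> l. koszul y u v (axis l 1)) = \<Gamma> y u v" if "y \<in> U" for y
    using christoffel_vec_eq_koszul[OF that] by simp
  have i: "Ck_on k U (\<lambda>y. matrix_inv (G y) $ i $ j)" for i j
    by (intro Ck_on_component open_U Ck_on_matrix_inv Ck_G det_G)
  have kz: "Ck_on k U (\<lambda>y. koszul y u v w)" for w
  proof -
    have "Ck_on k U (\<lambda>y. (1/2) * (dd (\<lambda>z. g z v w) y u + (dd (\<lambda>z. g z u w) y v + (-1) * dd (\<lambda>z. g z u v) y w)))"
      by (intro Ck_on_bilinear[OF bounded_bilinear_mult open_U] Ck_on_add open_U Ck_on_const Ck_dg)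
    then show ?thesis by (rule Ck_on_cong[OF open_U]) (simp add: koszul_def)
  qed
  show "Ck_on k U (\<lambda>y. matrix_inv (G y) *v (\<chi> l. koszul y u v (axis l 1)))"
    by (rule Ck_on_componentwise[OF open_U])
      (simp add: matrix_vector_mult_def Ck_on_sum Ck_on_bilinear[OF bounded_bilinear_mult open_U] open_U i kz)
qed

lemma differentiable_christoffel_vec: "y \<in> U \<Longrightarrow> (\<lambda>z. \<Gamma> z u v) differentiable (at y)"
  using Ck_christoffel_vec[of "Suc 0" u v] by simp

text \<open>Both sides are trilinear, so it suffices to compare them on coordinate axes, where the
  right side unfolds to \<open>riem_comp\<close>.\<close>

lemma riem_eq:
  assumes y: "y \<in> U"
  shows "riem G y u v w = dd (\<lambda>z. \<Gamma> z v w) y u - dd (\<lambda>z. \<Gamma> z u w) y v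
    + \<Gamma> y u (\<Gamma> y v w) - \<Gamma> y v (\<Gamma> y u w)"
proof -
  define T where "T u v w = dd (\<lambda>z. \<Gamma> z v w) y u - dd (\<lambda>z. \<Gamma> z u w) y v
    + \<Gamma> y u (\<Gamma> y v w) - \<Gamma> y v (\<Gamma> y u w)" for u v w
  have ld: "linear (dd (\<lambda>z. \<Gamma> z v w) y)" "linear (\<lambda>v. dd (\<lambda>z. \<Gamma> z v w) y u)" "linear (\<lambda>w. dd (\<lambda>z. \<Gamma> z v w) y u)" for u v w
    by (rule linear_dd[OF differentiable_christoffel_vec[OF y]] linear_dd_family linear_christoffel_vec_left linear_christoffel_vec_right differentiable_christoffel_vec[OF y])+
  note lds = ld[THEN linear_add] ld[THEN linear_cmul]
  have T1: "linear (\<lambda>u. T u v w)" for v w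
    unfolding T_def by (rule linearI; unfold lds; simp add: christoffel_vec_simps algebra_simps)
  have T2: "linear (\<lambda>v. T u v w)" for u w
    unfolding T_def by (rule linearI; unfold lds; simp add: christoffel_vec_simps algebra_simps)
  have T3: "linear (T u v)" for u v
    unfolding T_def by (rule linearI; unfold lds; simp add: christoffel_vec_simps algebra_simps)
  have c: "T (axis i 1) (axis j 1) (axis k 1) $ l = riem_comp G l i j k y" for i j k l
  proof -
    have p: "pd a (christoffel G l b c) y = dd (\<lambda>z. \<Gamma> z (axis b 1) (axis c 1)) y (axis a 1) $ l" for a b c
      unfolding pd_def
      using dd_linear[OF bounded_linear_vec_nth differentiable_christoffel_vec[OF y], of "axis b 1" "axis c 1" l "axis a 1"]
      by (simp add: christoffel_vec_axis)
    have q: "\<Gamma> y (axis a 1) x $ l = (\<Sum>s\<in>UNIV. christoffel G l a s y * x $ s)" for a x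
      by (subst linear_axis_expand[OF linear_christoffel_vec_right])
        (simp add: christoffel_vec_axis mult.commute)
    show ?thesis unfolding T_def riem_comp_def p
      by (simp add: q christoffel_vec_axis sum_subtractf)
  qed
  have "T u v w $ l = riem G y u v w $ l" for l
  proof -
    have "T u v w = (\<Sum>i\<in>UNIV. \<Sum>j\<in>UNIV. (u $ i * v $ j) *\<^sub>R T (axis i 1) (axis j 1) w)"
      by (rule bilinear_axis_expand[of "\<lambda>u v. T u v w", OF T1 T2])
    also have "\<dots> = (\<Sum>i\<in>UNIV. \<Sum>j\<in>UNIV. (u $ i * v $ j) *\<^sub>R (\<Sum>k\<in>UNIV. w $ k *\<^sub>R T (axis i 1) (axis j 1) (axis k 1)))"
      by (subst linear_axis_expand[OF T3]) (rule refl)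
    finally show ?thesis
      by (simp add: riem_def c sum_distrib_left mult_ac)
  qed
  then show ?thesis by (simp add: vec_eq_iff T_def)
qed

end

section \<open>Curvature of a conformally flat metric and its traces\<close>

context riemannian_coords
begin

text \<open>Multiplying the metric by exp(2 \<phi>) adds s(b) c + s(c) b - g(b, c) q to the
  connection (\<open>Gam\<close>). Putting this into \<open>riem_eq\<close> expresses the new
  curvature by the old one and the first two derivatives of \<phi>; since the new curvature is zero
  at \<open>y\<close>, the old one is determined.\<close>

lemma curvature_of_conformally_flat_metric:
  fixes \<phi> :: "real^'m \<Rightarrow> real"
  assumes phi: "\<And>k. Ck_on k U \<phi>" and y: "y \<in> U"
    and flat: "\<And>a b c. riem (\<lambda>z. exp (2 * \<phi> z) *\<^sub>R G z) y a b c = 0"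
  shows "\<exists>P. (\<forall>u v. P u v = P v u) \<and> (\<forall>u. linear (P u)) \<and>
    (\<forall>a b c d. g y (riem G y a b c) d =
      - (g y a d * P b c - g y b d * P a c + g y b c * P a d - g y a c * P b d))"
proof -
  define G' where "G' z = exp (2 * \<phi> z) *\<^sub>R G z" for z
  have g': "ginner G' z v w = exp (2 * \<phi> z) * g z v w" for z v w
    by (simp add: ginner_def G'_def scaleR_matrix_vector_assoc[symmetric])
  have Ck_e: "Ck_on k U (\<lambda>z. exp (2 * \<phi> z))" for k
    by (rule Ck_on_compose[OF open_U open_UNIV subset_UNIV Ck_on_exp])
      (intro Ck_on_bilinear[OF bounded_bilinear_mult] Ck_on_const open_U phi)
  interpret C: riemannian_coords U G'
  proof
    show "Ck_on k U G'" for k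
      unfolding G'_def by (intro Ck_on_bilinear[OF bounded_bilinear_scaleR] open_U Ck_e Ck_G)
    show "transpose (G' z) = G' z" if "z \<in> U" for z
      using sym_G[OF that] by (simp add: G'_def transpose_scalar)
    show "ginner G' z v v > 0" if "z \<in> U" "v \<noteq> 0" for z v
      using pos_G[OF that] by (simp add: g')
  qed (rule open_U)
  define s where "s z u = dd \<phi> z u" for z u
  define q where "q z = matrix_inv (G z) *v (\<chi> i. s z (axis i 1))" for z
  \<comment> \<open>The coordinate Hessian of \<phi>; the covariant one is obtained by subtracting
    \<open>s y (\<Gamma> y b c)\<close>, as in \<open>P\<close> below.\<close>
  define H where "H b a = dd (\<lambda>z. s z b) y a" for a b
  have dphi: "(\<phi> has_derivative s z) (at z)" if "z \<in> U" for z
    unfolding s_def using Ck_on_has_derivative[OF phi that] .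
  have lin_s: "linear (s z)" if "z \<in> U" for z using dphi[OF that] by (rule has_derivative_linear)
  have Ck_s: "Ck_on k U (\<lambda>z. s z u)" for k u using phi[of "Suc k"] by (simp add: s_def)
  have Ck_q: "Ck_on k U q" for k
    unfolding q_def
    by (rule Ck_on_componentwise[OF open_U])
      (simp add: matrix_vector_mult_def Ck_on_sum Ck_on_bilinear[OF bounded_bilinear_mult open_U]
        open_U Ck_s Ck_on_component Ck_on_matrix_inv[OF open_U Ck_G det_G])
  have gq: "g z (q z) v = s z v" if "z \<in> U" for z v
    unfolding q_def g_matrix_inv[OF that]
    using linear_axis_expand[OF lin_s[OF that], of v] by (simp add: inner_vec_def mult.commute)
  have gq': "g z v (q z) = s z v" if "z \<in> U" for z v
    using gq[OF that] g_commute[OF that] by metis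
  have ds: "((\<lambda>z. s z b) has_derivative H b) (at y)" for b
    unfolding H_def using Ck_on_has_derivative[OF Ck_s y] .
  have dq: "(q has_derivative dd q y) (at y)" using Ck_on_has_derivative[OF Ck_q y] .
  have Hsym: "H a b = H b a" for a b
    unfolding H_def s_def by (rule dd_commute[OF open_U y phi])
  have linH: "linear (H b)" for b using ds by (rule has_derivative_linear)
  have dg': "dd (\<lambda>z. ginner G' z v w) z u = exp (2 * \<phi> z) * (2 * s z u * g z v w + dd (\<lambda>z. g z v w) z u)"
    if z: "z \<in> U" for z u v w
    unfolding g'
    by (rule dd_eq) (auto intro!: derivative_eq_intros dphi[OF z] differentiable_has_dd[OF differentiable_g[OF z]] simp: algebra_simps)
  have Gam: "christoffel_vec G' z b c = \<Gamma> z b c + s z b *\<^sub>R c + s z c *\<^sub>R b - g z b c *\<^sub>R q z"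
    if z: "z \<in> U" for z b c
  proof (rule C.christoffel_vec_unique[OF z, symmetric])
    fix w
    show "ginner G' z (\<Gamma> z b c + s z b *\<^sub>R c + s z c *\<^sub>R b - g z b c *\<^sub>R q z) w = C.koszul z b c w"
      unfolding C.koszul_def dg'[OF z] unfolding g' ginner_simps g_christoffel[OF z] gq[OF z] koszul_def
      by (simp add: algebra_simps add_divide_distrib diff_divide_distrib)
  qed
  have dGam: "dd (\<lambda>z. christoffel_vec G' z b c) y a = dd (\<lambda>z. \<Gamma> z b c) y a + H b a *\<^sub>R c + H c a *\<^sub>R b
      - (dd (\<lambda>z. g z b c) y a *\<^sub>R q y + g y b c *\<^sub>R dd q y a)" for a b c
  proof -
    have "dd (\<lambda>z. christoffel_vec G' z b c) y a
        = dd (\<lambda>z. \<Gamma> z b c + s z b *\<^sub>R c + s z c *\<^sub>R b - g z b c *\<^sub>R q z) y a"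
      by (rule dd_cong[OF open_U y]) (rule Gam)
    also have "\<dots> = dd (\<lambda>z. \<Gamma> z b c) y a + H b a *\<^sub>R c + H c a *\<^sub>R b
      - (dd (\<lambda>z. g z b c) y a *\<^sub>R q y + g y b c *\<^sub>R dd q y a)"
      by (rule dd_eq)
        (auto intro!: derivative_eq_intros ds dq differentiable_has_dd[OF differentiable_g[OF y]]
          differentiable_has_dd[OF differentiable_christoffel_vec[OF y]])
    finally show ?thesis .
  qed
  \<comment> \<open>Differentiating g(q, d) = s(d) gives the derivative of the gradient without
    differentiating the inverse matrix in its definition.\<close>
  have gdq: "g y (dd q y a) d = H d a - (g y (\<Gamma> y a (q y)) d + s y (\<Gamma> y a d))" for a d
  proof -
    have "((\<lambda>z. g z (q z) d) has_derivative (\<lambda>h. dd (\<lambda>z. g z (q y) d) y h + g y (dd q y h) d)) (at y)"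
      by (rule linear_has_derivative_family[OF open_UNIV UNIV_I linear_ginner_left differentiable_g[OF y] dq])
    then have "dd (\<lambda>z. g z (q z) d) y a = dd (\<lambda>z. g z (q y) d) y a + g y (dd q y a) d"
      by (rule dd_eq)
    moreover have "dd (\<lambda>z. g z (q z) d) y a = H d a"
      unfolding H_def by (rule dd_cong[OF open_U y]) (rule gq)
    ultimately show ?thesis using metric_compatible[OF y, of "q y" d a] gq[OF y] by simp
  qed
  \<comment> \<open>By the transformation law of the Schouten tensor under \<open>g \<mapsto> e\<^sup>2\<^sup>\<phi> g\<close>, where the new one vanishes,
    \<open>P\<close> is minus the Schouten tensor of \<open>g\<close>; \<open>q\<close> is the gradient of \<open>\<phi>\<close> and \<open>s\<close> its differential.\<close>
  define P where "P b c = s y b * s y c - g y b c * g y (q y) (q y) / 2 - (H b c - s y (\<Gamma> y b c))" for b c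
  note ls = linear_add[OF lin_s[OF y]] linear_diff[OF lin_s[OF y]] linear_cmul[OF lin_s[OF y]]
  \<comment> \<open>The new curvature is lowered with the old metric \<open>g\<close>, so no
    exponential factor appears.\<close>
  have main: "g y (riem G' y a b c) d = g y (riem G y a b c) d
      + (g y a d * P b c - g y b d * P a c + g y b c * P a d - g y a c * P b d)" for a b c d
  proof -
    have com: "g y b (\<Gamma> y a c) = g y (\<Gamma> y a c) b" "g y a (\<Gamma> y b c) = g y (\<Gamma> y b c) a"
      "\<Gamma> y b a = \<Gamma> y a b" "g y b a = g y a b" "H b a = H a b" "H c b = H b c" "H c a = H a c" "H d a = H a d" "H d b = H b d"
      by (rule g_commute[OF y] christoffel_vec_commute[OF y] Hsym)+
    show ?thesis
      unfolding C.riem_eq[OF y] riem_eq[OF y] dGam Gam[OF y] ginner_simps christoffel_vec_simps ls gdq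
        metric_compatible[OF y] gq[OF y] gq'[OF y] P_def com
      by (simp add: algebra_simps diff_divide_distrib add_divide_distrib)
  qed
  have "linear (P u)" for u
    using linH[of u] unfolding P_def
    by (intro linearI) (simp_all add: linear_add linear_cmul ls christoffel_vec_simps ginner_simps algebra_simps add_divide_distrib)
  moreover have "P u v = P v u" for u v
    unfolding P_def using g_commute[OF y, of u v] christoffel_vec_commute[OF y, of u v] Hsym[of u v] by simp
  moreover have "g y (riem G y a b c) d =
      - (g y a d * P b c - g y b d * P a c + g y b c * P a d - g y a c * P b d)" for a b c d
  proof -
    have "riem G' y a b c = 0" using flat by (simp add: G'_def[abs_def])
    then have "0 = g y (riem G y a b c) d
      + (g y a d * P b c - g y b d * P a c + g y b c * P a d - g y a c * P b d)"
      using main[of a b c d] by (simp only: ginner_simps)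
    then show ?thesis by argo
  qed
  ultimately show ?thesis by blast
qed

text \<open>Raising an index of \<open>P\<close> to get \<open>S\<close> makes R(a, b) c an explicit
  vector that can be traced over \<open>a\<close>: the term in \<open>a\<close> yields the dimension
  times P, the terms in \<open>b\<close> and \<open>S b\<close> each take one P away, and the trace
  of \<open>S\<close> is \<open>t\<close>. Contracting once more with the inverse metric gives (m -
  2) t + m t = 2 (m - 1) t, up to sign.\<close>

lemma ricci_tau_of_conformally_flat_metric:
  fixes P :: "real^'m \<Rightarrow> real^'m \<Rightarrow> real"
  assumes y: "y \<in> U" and sym: "\<And>u v. P u v = P v u" and lin: "\<And>u. linear (P u)"
    and R: "\<And>a b c d. g y (riem G y a b c) d =
      - (g y a d * P b c - g y b d * P a c + g y b c * P a d - g y a c * P b d)"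
  defines "t \<equiv> (\<Sum>i\<in>UNIV. \<Sum>j\<in>UNIV. matrix_inv (G y) $ i $ j * P (axis i 1) (axis j 1))"
  shows "ricci G y v w = - ((real CARD('m) - 2) * P v w + t * g y v w)"
    and "scalar_tau G y = - (real CARD('m) - 1) * t"
proof -
  define S where "S a = matrix_inv (G y) *v (\<chi> i. P a (axis i 1))" for a
  have gS: "g y (S a) d = P a d" for a d
    unfolding S_def g_matrix_inv[OF y] using linear_axis_expand[OF lin, of a d] by (simp add: inner_vec_def mult.commute)
  have Rv: "riem G y a b c = - (P b c *\<^sub>R a - P a c *\<^sub>R b + g y b c *\<^sub>R S a - g y a c *\<^sub>R S b)" for a b c
    by (rule g_nondegenerate[OF y]) (simp add: R ginner_simps gS mult.commute)
  have tS: "(\<Sum>i\<in>UNIV. S (axis i 1) $ i) = t"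
    by (simp add: S_def t_def matrix_vector_mult_def)
  have ric: "ricci G y v w = - ((real CARD('m) - 2) * P v w + t * g y v w)" for v w
  proof -
    have m: "(\<Sum>i\<in>(UNIV::'m set). axis i 1 $ i :: real) = CARD('m)" by simp
    have p: "(\<Sum>i\<in>UNIV. P (axis i 1) w * v $ i) = P v w"
      using linear_axis_expand[OF lin, of w v] by (simp add: sym[of w] mult.commute)
    have gs: "(\<Sum>i\<in>UNIV. g y (axis i 1) w * S v $ i) = P v w"
      using linear_axis_expand[OF linear_ginner_left[of G y w], of "S v"] by (simp add: gS mult.commute)
    have "ricci G y v w = (\<Sum>i\<in>UNIV. - (P v w * axis i 1 $ i - P (axis i 1) w * v $ i + g y v w * S (axis i 1) $ i - g y (axis i 1) w * S v $ i))"
      unfolding ricci_def Rv by (simp only: vector_minus_component vector_add_component vector_scaleR_component minus_diff_eq) simp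
    also have "\<dots> = - (P v w * CARD('m) - P v w + g y v w * t - P v w)"
      by (simp only: sum_negf sum.distrib sum_subtractf sum_distrib_left[symmetric] m p gs tS)
    finally show ?thesis by (simp add: algebra_simps)
  qed
  show "ricci G y v w = - ((real CARD('m) - 2) * P v w + t * g y v w)" by (rule ric)
  have gi: "(\<Sum>i\<in>UNIV. \<Sum>j\<in>UNIV. matrix_inv (G y) $ i $ j * g y (axis i 1) (axis j 1)) = CARD('m)"
  proof -
    have "G y $ i $ j = G y $ j $ i" for i j
      using sym_G[OF y] by (metis transpose_def vec_lambda_beta)
    then have "(\<Sum>j\<in>UNIV. matrix_inv (G y) $ i $ j * g y (axis i 1) (axis j 1)) = (matrix_inv (G y) ** G y) $ i $ i" for i
      by (simp add: matrix_matrix_mult_def ginner_axis)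
    then show ?thesis by (simp add: matrix_inv_mult_left[OF invertible_G[OF y]] mat_def)
  qed
  have "(\<Sum>i\<in>UNIV. \<Sum>j\<in>UNIV. matrix_inv (G y) $ i $ j * ricci G y (axis i 1) (axis j 1))
    = - ((real CARD('m) - 2) * t + t * CARD('m))"
  proof -
    have "(\<Sum>i\<in>UNIV. \<Sum>j\<in>UNIV. matrix_inv (G y) $ i $ j * ricci G y (axis i 1) (axis j 1))
      = (\<Sum>i\<in>UNIV. \<Sum>j\<in>UNIV. - ((real CARD('m) - 2) * (matrix_inv (G y) $ i $ j * P (axis i 1) (axis j 1))
          + t * (matrix_inv (G y) $ i $ j * g y (axis i 1) (axis j 1))))"
      unfolding ric by (simp add: algebra_simps)
    also have "\<dots> = - ((real CARD('m) - 2) * t + t * CARD('m))"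
      by (simp only: sum_negf sum.distrib sum_distrib_left[symmetric] gi t_def[symmetric])
    finally show ?thesis .
  qed
  then show "scalar_tau G y = - (real CARD('m) - 1) * t"
    unfolding scalar_tau_def by (simp add: algebra_simps)
qed

end

section \<open>Gauss and Ricci equations\<close>

lemma symmetric_matrix_inv:
  fixes M :: "real^'n^'n"
  assumes "transpose M = M" "invertible M"
  shows "transpose (matrix_inv M) = matrix_inv M"
proof -
  have "M ** transpose (matrix_inv M) = transpose (matrix_inv M ** M)"
    by (simp add: matrix_transpose_mul assms(1))
  then have "M ** transpose (matrix_inv M) = mat 1"
    by (simp add: matrix_inv_mult_left[OF assms(2)] transpose_mat)
  then have "matrix_inv M ** (M ** transpose (matrix_inv M)) = matrix_inv M" by (simp add: matrix_mul_rid)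
  then show ?thesis by (simp add: matrix_mul_assoc matrix_inv_mult_left[OF assms(2)] matrix_mul_lid)
qed

locale submanifold_coords = riemannian_coords U G
  for U :: "(real^'m::finite) set" and G +
  fixes S :: "(real^'n::finite) set" and F :: "real^'n \<Rightarrow> real^'m"
  assumes open_S: "open S" and Ck_F: "\<And>k. Ck_on k S F" and F_in_U: "\<And>x. x \<in> S \<Longrightarrow> F x \<in> U"
    and inj_dF: "\<And>x. x \<in> S \<Longrightarrow> inj (differential F x)"
begin

abbreviation "dF \<equiv> differential F"
abbreviation "gam \<equiv> induced_metric G F"

lemma pd_F: "pd a F x = dF x (axis a 1)"
  by (simp add: pd_def differential_def)

lemma F_has_derivative: "x \<in> S \<Longrightarrow> (F has_derivative dF x) (at x)"
  unfolding differential_def by (rule Ck_on_has_derivative[OF Ck_F])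

lemma linear_dF: "x \<in> S \<Longrightarrow> linear (dF x)"
  using F_has_derivative has_derivative_linear by blast

lemma Ck_dF: "Ck_on k S (\<lambda>z. dF z v)"
  using Ck_F[of "Suc k"] by (simp add: differential_def)

text \<open>\<open>B\<close> stands for the metric or for the Christoffel map: a bilinear map
  depending on the ambient point and evaluated on two fields along \<open>F\<close>. Hence the
  general codomain, here and in \<open>has_derivative_along\<close>.\<close>

lemma Ck_along:
  fixes B :: "real^'m \<Rightarrow> real^'m \<Rightarrow> real^'m \<Rightarrow> 'c::real_normed_vector"
  assumes l: "\<And>y v. linear (\<lambda>u. B y u v)" "\<And>y u. linear (B y u)"
    and B: "\<And>u v. Ck_on k U (\<lambda>y. B y u v)" and V: "Ck_on k S V" and W: "Ck_on k S W"
  shows "Ck_on k S (\<lambda>z. B (F z) (V z) (W z))"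
  unfolding bilinear_axis_expand[of "B (F _)" "V _" "W _", OF l]
  by (intro Ck_on_sum open_S Ck_on_bilinear[OF bounded_bilinear_scaleR] Ck_on_bilinear[OF bounded_bilinear_mult]
      Ck_on_component V W Ck_on_compose[OF open_S open_U _ B Ck_F]) (use F_in_U in auto)

lemma chain_F:
  assumes "x \<in> S" "f differentiable (at (F x))"
  shows "((\<lambda>z. f (F z)) has_derivative (\<lambda>h. dd f (F x) (dF x h))) (at x)"
  by (rule has_derivative_compose[OF F_has_derivative[OF assms(1)] differentiable_has_dd[OF assms(2)]])

lemma has_derivative_along:
  fixes B :: "real^'m \<Rightarrow> real^'m \<Rightarrow> real^'m \<Rightarrow> 'c::real_normed_vector"
  assumes x: "x \<in> S" and l: "\<And>y v. linear (\<lambda>u. B y u v)" "\<And>y u. linear (B y u)"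
    and B: "\<And>u v. (\<lambda>y. B y u v) differentiable (at (F x))"
    and V: "(V has_derivative V') (at x)" and W: "(W has_derivative W') (at x)"
  shows "((\<lambda>z. B (F z) (V z) (W z)) has_derivative
    (\<lambda>h. dd (\<lambda>y. B y (V x) (W x)) (F x) (dF x h) + B (F x) (V' h) (W x) + B (F x) (V x) (W' h))) (at x)"
proof -
  have 1: "((\<lambda>z. B (F z) u v) has_derivative (\<lambda>h. dd (\<lambda>y. B y u v) (F x) (dF x h))) (at x)" for u v
    by (rule chain_F[OF x B])
  have 2: "((\<lambda>z. B (F z) (V z) v) has_derivative
      (\<lambda>h. dd (\<lambda>z. B (F z) (V x) v) x h + B (F x) (V' h) v)) (at x)" for v
    by (rule linear_has_derivative_family[OF open_UNIV UNIV_I l(1) _ V]) (use 1 in \<open>auto simp: differentiable_def\<close>)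
  have "((\<lambda>z. B (F z) (V z) (W z)) has_derivative
      (\<lambda>h. dd (\<lambda>z. B (F z) (V z) (W x)) x h + B (F x) (V x) (W' h))) (at x)"
    by (rule linear_has_derivative_family[OF open_UNIV UNIV_I l(2) _ W]) (use 2 in \<open>auto simp: differentiable_def\<close>)
  then show ?thesis
    by (simp only: dd_eq[OF 2] dd_eq[OF 1])
qed

lemma Ck_g_along: "Ck_on k S V \<Longrightarrow> Ck_on k S W \<Longrightarrow> Ck_on k S (\<lambda>z. g (F z) (V z) (W z))"
  by (rule Ck_along[OF linear_ginner_left linear_ginner_right Ck_g])

section \<open>The pull-back connection and the induced metric\<close>

text \<open>The pull-back of the ambient Levi-Civita connection along \<open>F\<close>. Its
  directions are constant in the parameter domain, hence commute, and no bracket terms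
  arise.\<close>

definition cov :: "real^'n \<Rightarrow> (real^'n \<Rightarrow> real^'m) \<Rightarrow> real^'n \<Rightarrow> real^'m" where
  "cov u W x = dd W x u + \<Gamma> (F x) (dF x u) (W x)"

lemma cov_along_eq: "cov_along G F a W x = cov (axis a 1) W x"
  by (simp add: cov_along_def cov_def pd_def differential_def)

lemma Ck_cov:
  assumes W: "Ck_on (Suc k) S W"
  shows "Ck_on k S (cov u W)"
proof -
  have "Ck_on k S (\<lambda>x. \<Gamma> (F x) (dF x u) (W x))"
    by (rule Ck_along[OF linear_christoffel_vec_left linear_christoffel_vec_right Ck_christoffel_vec Ck_dF Ck_on_SucD[OF W]])
  moreover have "Ck_on k S (\<lambda>x. dd W x u)" using W by simp
  ultimately show ?thesis unfolding cov_def[abs_def] by (intro Ck_on_add open_S)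
qed

lemma linear_cov:
  assumes "x \<in> S" "W differentiable (at x)"
  shows "linear (\<lambda>u. cov u W x)"
  unfolding cov_def
  using linear_compose_add[OF linear_dd[OF assms(2)] linear_compose[OF linear_dF[OF assms(1)] linear_christoffel_vec_left]]
  by (simp only: o_def)

lemma cov_diff:
  assumes "V differentiable (at x)" "W differentiable (at x)"
  shows "cov u (\<lambda>z. V z - W z) x = cov u V x - cov u W x"
  unfolding cov_def christoffel_vec_simps
  by (subst dd_eq[OF has_derivative_diff[OF assms[THEN differentiable_has_dd]]]) simp

lemma g_along_derivative:
  assumes x: "x \<in> S" and V: "V differentiable (at x)" and W: "W differentiable (at x)"
  shows "dd (\<lambda>z. g (F z) (V z) (W z)) x u = g (F x) (cov u V x) (W x) + g (F x) (V x) (cov u W x)"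
proof -
  have "dd (\<lambda>z. g (F z) (V z) (W z)) x u = dd (\<lambda>y. g y (V x) (W x)) (F x) (dF x u)
      + g (F x) (dd V x u) (W x) + g (F x) (V x) (dd W x u)"
    by (rule dd_eq[OF has_derivative_along[OF x linear_ginner_left linear_ginner_right
          differentiable_g[OF F_in_U[OF x]] V[THEN differentiable_has_dd] W[THEN differentiable_has_dd]]])
  then show ?thesis
    unfolding metric_compatible[OF F_in_U[OF x]] cov_def ginner_simps by simp
qed

lemma differentiable_if_Ck: "Ck_on (Suc 0) S W \<Longrightarrow> x \<in> S \<Longrightarrow> W differentiable (at x)"
  by simp

lemma dF_differentiable: "x \<in> S \<Longrightarrow> (\<lambda>z. dF z v) differentiable (at x)"
  by (rule differentiable_if_Ck[OF Ck_dF])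

lemma cov_dF_commute:
  assumes x: "x \<in> S"
  shows "cov u (\<lambda>z. dF z v) x = cov v (\<lambda>z. dF z u) x"
  unfolding cov_def differential_def
  using dd_commute[OF open_S x Ck_F[of 2], of v u] christoffel_vec_commute[OF F_in_U[OF x]] by metis

text \<open>The second derivatives of \<open>W\<close> and of \<open>F\<close> are symmetric and
  cancel; what is left is the ambient curvature formula \<open>riem_eq\<close> at
  \<open>F x\<close>.\<close>

lemma cov_curvature:
  assumes x: "x \<in> S" and W: "Ck_on 2 S W"
  shows "cov u (\<lambda>z. cov v W z) x - cov v (\<lambda>z. cov u W z) x = riem G (F x) (dF x u) (dF x v) (W x)"
proof -
  have W1: "W differentiable (at x)" and W2: "(\<lambda>z. dd W z b) differentiable (at x)" for b
    using W x by (simp_all add: numeral_2_eq_2)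
  have c: "dd (cov b W) x a = dd (\<lambda>z. dd W z b) x a + (dd (\<lambda>y. \<Gamma> y (dF x b) (W x)) (F x) (dF x a)
      + \<Gamma> (F x) (dd (\<lambda>z. dF z b) x a) (W x) + \<Gamma> (F x) (dF x b) (dd W x a))" for a b
    unfolding cov_def[abs_def]
    by (rule dd_eq[OF has_derivative_add[OF differentiable_has_dd[OF W2]
        has_derivative_along[OF x linear_christoffel_vec_left linear_christoffel_vec_right
          differentiable_christoffel_vec[OF F_in_U[OF x]] dF_differentiable[OF x, THEN differentiable_has_dd] W1[THEN differentiable_has_dd]]]])
  have s1: "dd (\<lambda>z. dd W z b) x a = dd (\<lambda>z. dd W z a) x b" for a b
    by (rule dd_commute[OF open_S x W])
  have s2: "dd (\<lambda>z. dF z b) x a = dd (\<lambda>z. dF z a) x b" for a b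
    unfolding differential_def by (rule dd_commute[OF open_S x Ck_F])
  have cc: "cov a (cov b W) x = dd (\<lambda>z. dd W z b) x a + (dd (\<lambda>y. \<Gamma> y (dF x b) (W x)) (F x) (dF x a)
      + \<Gamma> (F x) (dd (\<lambda>z. dF z b) x a) (W x) + \<Gamma> (F x) (dF x b) (dd W x a))
      + \<Gamma> (F x) (dF x a) (dd W x b + \<Gamma> (F x) (dF x b) (W x))" for a b
    using c[of b a] by (simp add: cov_def[of a "cov b W"] cov_def[of b W x])
  show ?thesis
    unfolding cc riem_eq[OF F_in_U[OF x]] s1[of v u] s2[of v u] christoffel_vec_simps by simp
qed

lemma induced_inner:
  assumes x: "x \<in> S"
  shows "ginner gam x u v = g (F x) (dF x u) (dF x v)"
proof -
  have b: "linear (\<lambda>u. g (F x) (dF x u) (dF x v))" "linear (\<lambda>v. g (F x) (dF x u) (dF x v))" for u v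
    using linear_compose[OF linear_dF[OF x] linear_ginner_left] linear_compose[OF linear_dF[OF x] linear_ginner_right]
    by (simp_all add: o_def)
  have "g (F x) (dF x u) (dF x v) = (\<Sum>a\<in>UNIV. \<Sum>b\<in>UNIV. (u $ a * v $ b) *\<^sub>R g (F x) (dF x (axis a 1)) (dF x (axis b 1)))"
    by (rule bilinear_axis_expand[of "\<lambda>u v. g (F x) (dF x u) (dF x v)", OF b])
  also have "\<dots> = ginner gam x u v"
    by (simp add: ginner_def[of gam] inner_vec_def matrix_vector_mult_def induced_metric_def pd_F sum_distrib_left mult_ac)
  finally show ?thesis by simp
qed

text \<open>Supplies the intrinsic connection and curvature; positivity of the induced metric comes
  from injectivity of the differential.\<close>

sublocale I: riemannian_coords S gam
proof
  show "Ck_on k S gam" for k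
    by (rule Ck_on_matrixI[OF open_S]) (simp add: induced_metric_def pd_F Ck_g_along Ck_dF)
  show "transpose (gam x) = gam x" if "x \<in> S" for x
    using g_commute[OF F_in_U[OF that]] by (simp add: transpose_def induced_metric_def vec_eq_iff)
  show "ginner gam x v v > 0" if "x \<in> S" "v \<noteq> 0" for x v
  proof -
    have "dF x v \<noteq> 0"
      using inj_dF[OF that(1)] linear_0[OF linear_dF[OF that(1)]] that(2) unfolding inj_def by metis
    then show ?thesis unfolding induced_inner[OF that(1)] by (rule pos_G[OF F_in_U[OF that(1)]])
  qed
qed (rule open_S)

text \<open>The ambient derivative projects to the intrinsic connection. Substituting
  \<open>d\<close> into the intrinsic Koszul expression, the symmetry \<open>cov_dF_commute\<close>
  cancels all terms but one.\<close>

lemma g_cov_dF: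
  assumes x: "x \<in> S"
  shows "g (F x) (cov u (\<lambda>z. dF z v) x) (dF x w) = I.g x (I.\<Gamma> x u v) w"
proof -
  have d: "dd (\<lambda>z. I.g z v w) x u = g (F x) (cov u (\<lambda>z. dF z v) x) (dF x w) + g (F x) (dF x v) (cov u (\<lambda>z. dF z w) x)" for u v w
    unfolding g_along_derivative[OF x dF_differentiable[OF x] dF_differentiable[OF x], symmetric]
    by (rule dd_cong[OF open_S x]) (rule induced_inner)
  show ?thesis
    unfolding I.g_christoffel[OF x] I.koszul_def d
    unfolding cov_dF_commute[OF x, of v u] cov_dF_commute[OF x, of w u] cov_dF_commute[OF x, of w v]
      g_commute[OF F_in_U[OF x], of "dF x _" "cov _ _ _"]
    by simp
qed

section \<open>Tangential and normal parts, and the Gauss equation\<close>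

text \<open>Takes values in the parameter domain, so the orthogonal projection of \<open>w\<close>
  to the tangent space is \<open>dF x (tangential x w)\<close>.\<close>

definition tangential :: "real^'n \<Rightarrow> real^'m \<Rightarrow> real^'n" where
  "tangential x w = matrix_inv (gam x) *v (\<chi> a. g (F x) w (pd a F x))"

lemma induced_inner_tangential:
  assumes x: "x \<in> S"
  shows "I.g x (tangential x w) v = g (F x) w (dF x v)"
proof -
  have "linear (\<lambda>v. g (F x) w (dF x v))"
    using linear_compose[OF linear_dF[OF x] linear_ginner_right] by (simp add: o_def)
  from linear_axis_expand[OF this, of v] show ?thesis
    unfolding tangential_def I.g_matrix_inv[OF x] by (simp add: inner_vec_def pd_F mult.commute)
qed

lemma tangential_unique:
  assumes x: "x \<in> S" and t: "\<And>v. I.g x t v = g (F x) w (dF x v)"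
  shows "tangential x w = t"
  by (rule I.g_nondegenerate[OF x]) (simp only: induced_inner_tangential[OF x] t)

lemma normal_part_eq:
  assumes x: "x \<in> S"
  shows "normal_part G F x w = w - dF x (tangential x w)"
proof -
  have s: "matrix_inv (gam x) $ a $ b = matrix_inv (gam x) $ b $ a" for a b
    using arg_cong[OF symmetric_matrix_inv[OF I.sym_G[OF x] I.invertible_G[OF x]], of "\<lambda>M. M $ b $ a"]
    by (simp add: transpose_def)
  have "dF x (tangential x w) = (\<Sum>b\<in>UNIV. tangential x w $ b *\<^sub>R pd b F x)"
    unfolding pd_F by (rule linear_axis_expand[OF linear_dF[OF x]])
  also have "\<dots> = (\<Sum>b\<in>UNIV. \<Sum>a\<in>UNIV. (matrix_inv (gam x) $ a $ b * g (F x) w (pd a F x)) *\<^sub>R pd b F x)"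
    by (simp add: tangential_def matrix_vector_mult_def scaleR_sum_left) (simp only: s)
  also have "\<dots> = (\<Sum>a\<in>UNIV. \<Sum>b\<in>UNIV. (matrix_inv (gam x) $ a $ b * g (F x) w (pd a F x)) *\<^sub>R pd b F x)"
    by (rule sum.swap)
  finally show ?thesis by (simp add: normal_part_def)
qed

lemma Ck_normal_part: "Ck_on k S W \<Longrightarrow> Ck_on k S (\<lambda>z. normal_part G F z (W z))"
proof -
  assume W: "Ck_on k S W"
  have "Ck_on k S (\<lambda>z. W z + (-1) *\<^sub>R (\<Sum>a\<in>UNIV. \<Sum>b\<in>UNIV.
      (matrix_inv (gam z) $ a $ b * g (F z) (W z) (pd a F z)) *\<^sub>R pd b F z))"
    unfolding pd_F
    by (intro Ck_on_add open_S W Ck_on_bilinear[OF bounded_bilinear_scaleR] Ck_on_const Ck_on_sum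
        Ck_on_bilinear[OF bounded_bilinear_mult] Ck_on_component Ck_on_matrix_inv I.Ck_G I.det_G Ck_g_along Ck_dF)
  then show ?thesis by (rule Ck_on_cong[OF open_S]) (simp add: normal_part_def)
qed

definition normal :: "real^'n \<Rightarrow> real^'m \<Rightarrow> bool" where
  "normal x \<eta> \<longleftrightarrow> (\<forall>v. g (F x) \<eta> (dF x v) = 0)"

lemma normal_part_normal: "x \<in> S \<Longrightarrow> normal x (normal_part G F x w)"
  by (simp add: normal_def normal_part_eq ginner_simps induced_inner[symmetric] induced_inner_tangential)

lemma normal_part_of_normal:
  assumes "x \<in> S" "normal x \<xi>"
  shows "normal_part G F x \<xi> = \<xi>"
proof -
  have "tangential x \<xi> = 0"
    using assms by (intro tangential_unique) (simp_all add: normal_def ginner_simps)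
  then show ?thesis using linear_0[OF linear_dF[OF assms(1)]] by (simp add: normal_part_eq[OF assms(1)])
qed

lemma normalD: "x \<in> S \<Longrightarrow> normal x \<eta> \<Longrightarrow> g (F x) \<eta> (dF x v) = 0" "x \<in> S \<Longrightarrow> normal x \<eta> \<Longrightarrow> g (F x) (dF x v) \<eta> = 0"
  using g_commute[OF F_in_U] by (auto simp: normal_def)

lemma g_normal_part: "x \<in> S \<Longrightarrow> normal x \<eta> \<Longrightarrow> g (F x) (normal_part G F x w) \<eta> = g (F x) w \<eta>"
  by (simp add: normal_part_eq ginner_simps normalD)

text \<open>Extends \<open>second_ff\<close> from coordinate axes to all tangent vectors.
  Subtracting the intrinsic connection amounts to taking the normal part, by
  \<open>g_cov_dF\<close>.\<close>

definition sff :: "real^'n \<Rightarrow> real^'n \<Rightarrow> real^'n \<Rightarrow> real^'m" where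
  "sff x u v = cov u (\<lambda>z. dF z v) x - dF x (I.\<Gamma> x u v)"

lemma normal_part_cov_dF:
  assumes x: "x \<in> S"
  shows "normal_part G F x (cov u (\<lambda>z. dF z v) x) = sff x u v"
  unfolding normal_part_eq[OF x] sff_def
  by (subst tangential_unique[OF x, of "I.\<Gamma> x u v"]) (simp_all add: g_cov_dF[OF x])

lemma second_ff_eq: "x \<in> S \<Longrightarrow> second_ff G F a b x = sff x (axis a 1) (axis b 1)"
  by (simp add: second_ff_def cov_along_eq pd_F[abs_def] normal_part_cov_dF)

lemma normal_sff: "x \<in> S \<Longrightarrow> normal x (sff x u v)"
  by (simp add: normal_part_cov_dF[symmetric] normal_part_normal)

lemma sff_commute: "x \<in> S \<Longrightarrow> sff x u v = sff x v u"
  using cov_dF_commute[of x u v] I.christoffel_vec_commute[of x u v] by (simp add: sff_def)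

lemma linear_sff:
  assumes x: "x \<in> S"
  shows "linear (\<lambda>u. sff x u v)" "linear (sff x u)"
proof -
  show 1: "linear (\<lambda>u. sff x u v)" for v
    unfolding sff_def
    using linear_compose_sub[OF linear_cov[OF x dF_differentiable[OF x]] linear_compose[OF linear_christoffel_vec_left linear_dF[OF x]]]
    by (simp add: o_def)
  have "sff x u = (\<lambda>v. sff x v u)" by (rule ext) (rule sff_commute[OF x])
  then show "linear (sff x u)" using 1 by simp
qed

text \<open>The identity \<open>g_cov_dF\<close> holds at every point of \<open>S\<close>, so it can
  be differentiated: the left side by metric compatibility along \<open>F\<close>, the right side
  intrinsically. Antisymmetrising the result \<open>key\<close> produces both curvatures.\<close>

theorem gauss_equation:
  assumes x: "x \<in> S"
  shows "I.g x (riem gam x u v w) c = g (F x) (riem G (F x) (dF x u) (dF x v) (dF x w)) (dF x c)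
    + g (F x) (sff x v w) (sff x u c) - g (F x) (sff x u w) (sff x v c)"
proof -
  have Ckc: "Ck_on k S (cov b (\<lambda>z. dF z w))" for b k by (rule Ck_cov[OF Ck_dF])
  have key: "g (F x) (cov a (cov b (\<lambda>z. dF z w)) x) (dF x c)
      = I.g x (dd (\<lambda>z. I.\<Gamma> z b w) x a + I.\<Gamma> x a (I.\<Gamma> x b w)) c - g (F x) (sff x b w) (sff x a c)" for a b
  proof -
    have "g (F x) (cov a (cov b (\<lambda>z. dF z w)) x) (dF x c) + g (F x) (cov b (\<lambda>z. dF z w) x) (cov a (\<lambda>z. dF z c) x)
      = dd (\<lambda>z. g (F z) (cov b (\<lambda>z. dF z w) z) (dF z c)) x a"
      by (rule g_along_derivative[OF x differentiable_if_Ck[OF Ckc x] dF_differentiable[OF x], symmetric])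
    also have "\<dots> = dd (\<lambda>z. I.g z (I.\<Gamma> z b w) c) x a"
      by (rule dd_cong[OF open_S x]) (rule g_cov_dF)
    also have "\<dots> = dd (\<lambda>z. I.g z (I.\<Gamma> x b w) c) x a + I.g x (dd (\<lambda>z. I.\<Gamma> z b w) x a) c"
      by (rule dd_eq[OF linear_has_derivative_family[OF open_UNIV UNIV_I linear_ginner_left I.differentiable_g[OF x]
          I.differentiable_christoffel_vec[OF x, THEN differentiable_has_dd]]])
    also have "\<dots> = I.g x (I.\<Gamma> x a (I.\<Gamma> x b w)) c + I.g x (I.\<Gamma> x b w) (I.\<Gamma> x a c) + I.g x (dd (\<lambda>z. I.\<Gamma> z b w) x a) c"
      unfolding I.metric_compatible[OF x] ..
    finally have e: "g (F x) (cov a (cov b (\<lambda>z. dF z w)) x) (dF x c) + g (F x) (cov b (\<lambda>z. dF z w) x) (cov a (\<lambda>z. dF z c) x)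
      = I.g x (I.\<Gamma> x a (I.\<Gamma> x b w)) c + I.g x (I.\<Gamma> x b w) (I.\<Gamma> x a c) + I.g x (dd (\<lambda>z. I.\<Gamma> z b w) x a) c" .
    have s: "cov p (\<lambda>z. dF z q) x = dF x (I.\<Gamma> x p q) + sff x p q" for p q by (simp add: sff_def)
    \<comment> \<open>Tangential and normal parts are orthogonal. The intrinsic product obtained
      here cancels against the one in \<open>e\<close>.\<close>
    have "g (F x) (cov b (\<lambda>z. dF z w) x) (cov a (\<lambda>z. dF z c) x) = I.g x (I.\<Gamma> x b w) (I.\<Gamma> x a c) + g (F x) (sff x b w) (sff x a c)"
      unfolding s ginner_simps normalD[OF x normal_sff[OF x]] induced_inner[OF x] by simp
    then show ?thesis using e by (simp add: ginner_simps)
  qed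
  have "g (F x) (riem G (F x) (dF x u) (dF x v) (dF x w)) (dF x c)
      = g (F x) (cov u (cov v (\<lambda>z. dF z w)) x) (dF x c) - g (F x) (cov v (cov u (\<lambda>z. dF z w)) x) (dF x c)"
    unfolding cov_curvature[OF x Ck_dF, symmetric] by (simp add: ginner_simps)
  then show ?thesis unfolding key I.riem_eq[OF x] by (simp add: ginner_simps)
qed

end

section \<open>Orthonormal frames\<close>

context riemannian_coords
begin

definition orthonormal_at :: "real^'m \<Rightarrow> 'i set \<Rightarrow> ('i \<Rightarrow> real^'m) \<Rightarrow> bool" where
  "orthonormal_at y I f \<longleftrightarrow> (\<forall>i\<in>I. \<forall>j\<in>I. g y (f i) (f j) = (if i = j then 1 else 0))"

lemma orthonormal_at_sum:
  assumes "finite I" "orthonormal_at y I f" "j \<in> I"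
  shows "g y (\<Sum>i\<in>I. c i *\<^sub>R f i) (f j) = c j"
proof -
  have "g y (\<Sum>i\<in>I. c i *\<^sub>R f i) (f j) = (\<Sum>i\<in>I. if i = j then c i else 0)"
    unfolding ginner_sum_left ginner_simps
    by (rule sum.cong) (use assms in \<open>auto simp: orthonormal_at_def\<close>)
  then show ?thesis using assms by simp
qed

lemma orthonormal_at_expand:
  assumes I: "finite I" "card I = CARD('m)" and f: "orthonormal_at y I f"
  shows "w = (\<Sum>i\<in>I. g y w (f i) *\<^sub>R f i)"
proof -
  have inj: "inj_on f I"
  proof (rule inj_onI)
    fix i j assume ij: "i \<in> I" "j \<in> I" "f i = f j"
    have "g y (f i) (f j) = g y (f i) (f i)" using ij(3) by simp
    then show "i = j" using f ij(1,2) by (auto simp: orthonormal_at_def split: if_splits)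
  qed
  have "independent (f ` I)"
    unfolding dependent_finite[OF finite_imageI[OF I(1)]]
  proof
    assume "\<exists>u. (\<exists>v\<in>f ` I. u v \<noteq> 0) \<and> (\<Sum>v\<in>f ` I. u v *\<^sub>R v) = 0"
    then obtain u j where j: "j \<in> I" "u (f j) \<noteq> 0" and s: "(\<Sum>i\<in>I. u (f i) *\<^sub>R f i) = 0"
      by (auto simp: sum.reindex[OF inj])
    show False
      using orthonormal_at_sum[OF I(1) f j(1), of "\<lambda>i. u (f i)"] j(2) unfolding s by (simp add: ginner_simps)
  qed
  then have "span (f ` I) = UNIV"
    using card_eq_dim[of "f ` I" UNIV] I by (auto simp: card_image[OF inj])
  then have "w \<in> span (f ` I)" by simp
  then obtain c where "w = (\<Sum>v\<in>f ` I. c v *\<^sub>R v)"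
    unfolding span_finite[OF finite_imageI[OF I(1)]] by blast
  then have c: "w = (\<Sum>i\<in>I. c (f i) *\<^sub>R f i)" by (simp add: sum.reindex[OF inj])
  have "g y w (f j) = c (f j)" if "j \<in> I" for j
    unfolding c by (rule orthonormal_at_sum[OF I(1) f that])
  then have "(\<Sum>i\<in>I. g y w (f i) *\<^sub>R f i) = (\<Sum>i\<in>I. c (f i) *\<^sub>R f i)" by simp
  then show ?thesis using c by simp
qed

text \<open>Gram-Schmidt. Starting from nothing it yields tangent frames; starting from the image of
  a tangent frame it yields normal frames.\<close>

lemma orthonormal_at_extend:
  assumes y: "y \<in> U" and f: "orthonormal_at y {1..j} f"
  shows "j + d \<le> CARD('m) \<Longrightarrow> \<exists>f'. orthonormal_at y {1..j + d} f' \<and> (\<forall>i\<in>{1..j}. f' i = f i)"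
proof (induction d)
  case 0
  then show ?case using f by auto
next
  case (Suc d)
  then obtain h where h: "orthonormal_at y {1..j + d} h" "\<forall>i\<in>{1..j}. h i = f i" by auto
  let ?I = "{1..j + d}"
  have "dim (h ` ?I) \<le> card ?I" using dim_le_card'[of "h ` ?I"] card_image_le[of ?I h] by simp
  then have "dim (h ` ?I) < CARD('m)" using Suc.prems by simp
  then have "dim (span (h ` ?I)) \<noteq> dim (UNIV :: (real^'m) set)" by simp
  then have "span (h ` ?I) \<noteq> UNIV" by (rule contrapos_nn) (simp only:)
  then obtain w where w: "w \<notin> span (h ` ?I)" by auto
  define w' where "w' = w - (\<Sum>i\<in>?I. g y w (h i) *\<^sub>R h i)"
  have "w' \<noteq> 0"
  proof
    assume "w' = 0"
    then have "w = (\<Sum>i\<in>?I. g y w (h i) *\<^sub>R h i)" by (simp add: w'_def)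
    also have "\<dots> \<in> span (h ` ?I)" by (intro span_sum span_scale span_base imageI)
    finally show False using w by simp
  qed
  then have pos: "g y w' w' > 0" by (rule pos_G[OF y])
  have w'h: "g y w' (h i) = 0" if "i \<in> ?I" for i
    unfolding w'_def ginner_simps orthonormal_at_sum[OF finite_atLeastAtMost h(1) that] by simp
  define z where "z = (1 / sqrt (g y w' w')) *\<^sub>R w'"
  have zz: "g y z z = 1" using pos by (simp add: z_def ginner_simps)
  have zh: "g y z (h i) = 0" "g y (h i) z = 0" if "i \<in> ?I" for i
    using w'h[OF that] g_commute[OF y, of "h i" w'] by (simp_all add: z_def ginner_simps)
  have "orthonormal_at y {1..j + Suc d} (h(Suc (j + d) := z))"
    using h(1) zz zh unfolding orthonormal_at_def by (auto simp: atLeastAtMostSuc_conv le_Suc_eq)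
  moreover have "\<forall>i\<in>{1..j}. (h(Suc (j + d) := z)) i = f i" using h(2) by auto
  ultimately show ?case by blast
qed

lemma linear_riem_left: "linear (\<lambda>u. riem G y u v w)" "linear (\<lambda>v. riem G y u v w)"
  by (rule linearI;
      simp add: vec_eq_iff riem_def algebra_simps sum.distrib sum_distrib_left)+

end

context submanifold_coords
begin

lemma tangent_frame_iff: "tangent_frame G F x e \<longleftrightarrow> I.orthonormal_at x {1..CARD('n)} e"
  by (simp add: tangent_frame_def I.orthonormal_at_def)

lemma card_le: "x \<in> S \<Longrightarrow> CARD('n) \<le> CARD('m)"
proof -
  assume x: "x \<in> S"
  have "dim (dF x ` UNIV) = dim (UNIV :: (real^'n) set)"
    by (rule dim_image_eq[OF linear_dF[OF x]]) (use inj_dF[OF x] in simp)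
  then show ?thesis using dim_subset_UNIV[of "dF x ` UNIV"] by simp
qed

lemma tangent_expand: "tangent_frame G F x e \<Longrightarrow> v = (\<Sum>i=1..CARD('n). I.g x v (e i) *\<^sub>R e i)"
  unfolding tangent_frame_iff by (rule I.orthonormal_at_expand) simp_all

lemma orthonormal_at_dF:
  "x \<in> S \<Longrightarrow> tangent_frame G F x e \<Longrightarrow> orthonormal_at (F x) {1..CARD('n)} (\<lambda>i. dF x (e i))"
  unfolding tangent_frame_iff orthonormal_at_def I.orthonormal_at_def by (simp add: induced_inner)

lemma tangent_frame_exists: "x \<in> S \<Longrightarrow> \<exists>e. tangent_frame G F x e"
  using I.orthonormal_at_extend[of x 0 undefined "CARD('n)"]
  by (auto simp: tangent_frame_iff I.orthonormal_at_def)

text \<open>The vectors that complete an orthonormal tangent frame to one of the ambient space. In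
  the nonexistence statement positivity is assumed for all frames, which says something only if
  frames exist.\<close>

lemma normal_frame_exists:
  assumes x: "x \<in> S"
  shows "\<exists>\<upsilon>. normal_frame G F x \<upsilon>"
proof -
  obtain e where e: "tangent_frame G F x e" using tangent_frame_exists[OF x] by blast
  let ?n = "CARD('n)"
  obtain f where f: "orthonormal_at (F x) {1..?n + (CARD('m) - ?n)} f" and fe: "\<forall>i\<in>{1..?n}. f i = dF x (e i)"
    using orthonormal_at_extend[OF F_in_U[OF x] orthonormal_at_dF[OF x e], of "CARD('m) - ?n"] card_le[OF x] by auto
  have "g (F x) (f (?n + r)) (dF x v) = 0" if r: "r \<in> {1..CARD('m) - ?n}" for r v
  proof -
    have "dF x v = (\<Sum>i=1..?n. I.g x v (e i) *\<^sub>R dF x (e i))"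
      by (subst tangent_expand[OF e, of v]) (simp only: linear_sum[OF linear_dF[OF x]] linear_cmul[OF linear_dF[OF x]] o_def)
    then have "g (F x) (f (?n + r)) (dF x v) = (\<Sum>i=1..?n. I.g x v (e i) * g (F x) (f (?n + r)) (dF x (e i)))"
      by (simp add: ginner_sum_right ginner_simps)
    also have "\<dots> = 0"
    proof (rule sum.neutral, rule ballI)
      fix i assume i: "i \<in> {1..?n}"
      have "g (F x) (f (?n + r)) (f i) = 0"
        using f r i unfolding orthonormal_at_def by auto
      then show "I.g x v (e i) * g (F x) (f (?n + r)) (dF x (e i)) = 0" using fe i by simp
    qed
    finally show ?thesis .
  qed
  moreover have "g (F x) (f (?n + r)) (f (?n + s)) = (if r = s then 1 else 0)"
    if "r \<in> {1..CARD('m) - ?n}" "s \<in> {1..CARD('m) - ?n}" for r s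
    using f that unfolding orthonormal_at_def by auto
  ultimately have "normal_frame G F x (\<lambda>r. f (?n + r))" unfolding normal_frame_def by simp
  then show ?thesis by blast
qed

lemma normal_frame_normal: "normal_frame G F x \<upsilon> \<Longrightarrow> r \<in> {1..CARD('m) - CARD('n)} \<Longrightarrow> normal x (\<upsilon> r)"
  by (simp add: normal_frame_def normal_def)

text \<open>Tangent and normal frame together form an orthonormal basis, indexed by a disjoint sum
  since both are numbered from 1. The tangential coefficients of \<zeta> vanish.\<close>

lemma normal_parseval:
  assumes x: "x \<in> S" and \<upsilon>: "normal_frame G F x \<upsilon>" and \<zeta>: "normal x \<zeta>"
  shows "g (F x) \<zeta> \<eta> = (\<Sum>r=1..CARD('m) - CARD('n). g (F x) \<zeta> (\<upsilon> r) * g (F x) (\<upsilon> r) \<eta>)"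
proof -
  obtain e where e: "tangent_frame G F x e" using tangent_frame_exists[OF x] by blast
  let ?I = "{1..CARD('n)} <+> {1..CARD('m) - CARD('n)}"
  let ?f = "case_sum (\<lambda>i. dF x (e i)) \<upsilon>"
  have f: "orthonormal_at (F x) ?I ?f"
  proof -
    have 1: "g (F x) (dF x (e i)) (dF x (e j)) = (if i = j then 1 else 0)"
      if "i \<in> {1..CARD('n)}" "j \<in> {1..CARD('n)}" for i j
      using orthonormal_at_dF[OF x e] that unfolding orthonormal_at_def by blast
    have 2: "g (F x) (\<upsilon> r) (\<upsilon> s) = (if r = s then 1 else 0)"
      if "r \<in> {1..CARD('m) - CARD('n)}" "s \<in> {1..CARD('m) - CARD('n)}" for r s
      using \<upsilon> that unfolding normal_frame_def by blast
    show ?thesis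
      unfolding orthonormal_at_def Plus_def ball_Un
      by (intro conjI ballI; elim imageE; simp only: sum.case sum.inject sum.distinct if_False 1 2
          normalD[OF x normal_frame_normal[OF \<upsilon>]])
  qed
  have "\<zeta> = (\<Sum>i\<in>?I. g (F x) \<zeta> (?f i) *\<^sub>R ?f i)"
    by (rule orthonormal_at_expand[OF _ _ f]) (use card_le[OF x] in \<open>simp_all add: card_Plus\<close>)
  also have "\<dots> = (\<Sum>r=1..CARD('m) - CARD('n). g (F x) \<zeta> (\<upsilon> r) *\<^sub>R \<upsilon> r)"
    by (simp add: sum.Plus normalD[OF x \<zeta>])
  finally have "g (F x) \<zeta> \<eta> = g (F x) (\<Sum>r=1..CARD('m) - CARD('n). g (F x) \<zeta> (\<upsilon> r) *\<^sub>R \<upsilon> r) \<eta>" by (rule arg_cong)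
  then show ?thesis by (simp add: ginner_sum_left ginner_simps)
qed

section \<open>The shape operator, the Ricci equation and the mean curvature\<close>

text \<open>The Weingarten formula, for the same extension of \<xi> by projected constant vectors as
  in \<open>normal_curvature\<close>.\<close>

definition shape :: "real^'n \<Rightarrow> real^'m \<Rightarrow> real^'n \<Rightarrow> real^'n" where
  "shape x \<xi> v = - tangential x (cov v (\<lambda>z. normal_part G F z \<xi>) x)"

lemma Ck_normal_extension: "Ck_on k S (\<lambda>z. normal_part G F z \<xi>)"
  by (rule Ck_normal_part[OF Ck_on_const[OF open_S]])

lemma g_sff_normal: "x \<in> S \<Longrightarrow> normal x \<eta> \<Longrightarrow> g (F x) (cov u (\<lambda>z. dF z v) x) \<eta> = g (F x) (sff x u v) \<eta>"
  by (simp add: sff_def ginner_simps normalD)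

text \<open>Differentiate g(N, dF c) = 0, where N is the normal extension of \<xi>.\<close>

lemma induced_inner_shape:
  assumes x: "x \<in> S" and \<xi>: "normal x \<xi>"
  shows "I.g x (shape x \<xi> v) c = g (F x) (sff x v c) \<xi>"
proof -
  let ?N = "\<lambda>z. normal_part G F z \<xi>"
  have "dd (\<lambda>z. g (F z) (?N z) (dF z c)) x v = g (F x) (cov v ?N x) (dF x c) + g (F x) (?N x) (cov v (\<lambda>z. dF z c) x)"
    by (rule g_along_derivative[OF x differentiable_if_Ck[OF Ck_normal_extension x] dF_differentiable[OF x]])
  moreover have "dd (\<lambda>z. g (F z) (?N z) (dF z c)) x v = dd (\<lambda>z. 0) x v"
    by (rule dd_cong[OF open_S x]) (simp add: normalD normal_part_normal)
  ultimately have "g (F x) (cov v ?N x) (dF x c) = - g (F x) \<xi> (cov v (\<lambda>z. dF z c) x)"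
    by (simp add: normal_part_of_normal[OF x \<xi>])
  then show ?thesis
    unfolding shape_def ginner_simps induced_inner_tangential[OF x] g_commute[OF F_in_U[OF x], of \<xi>] g_sff_normal[OF x \<xi>]
    by simp
qed

text \<open>The inner normal derivative is \<open>cov ?v N\<close> minus its tangential part
  \<open>dF z (?t z)\<close>. When the latter is differentiated and paired with the normal vector
  \<eta>, the derivative of \<open>?t\<close> drops out because it occurs inside
  \<open>dF x\<close>; with \<open>?t\<close> frozen at \<open>x\<close>, only the second
  fundamental form survives.\<close>

lemma g_normal_connection_twice:
  assumes x: "x \<in> S" and \<xi>: "normal x \<xi>" and \<eta>: "normal x \<eta>"
  defines "N \<equiv> \<lambda>z. normal_part G F z \<xi>"
  shows "g (F x) (normal_connection G F a (normal_connection G F b N) x) \<eta>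
    = g (F x) (cov (axis a 1) (cov (axis b 1) N) x) \<eta> + g (F x) (sff x (axis a 1) (shape x \<xi> (axis b 1))) \<eta>"
proof -
  let ?u = "axis a 1 :: real^'n" and ?v = "axis b 1 :: real^'n"
  let ?t = "\<lambda>z. tangential z (cov ?v N z)"
  have CkN: "Ck_on k S (cov ?v N)" for k unfolding N_def by (rule Ck_cov[OF Ck_normal_extension])
  have Ckt: "Ck_on k S ?t" for k
    unfolding tangential_def pd_F
    by (rule Ck_on_componentwise[OF open_S])
      (simp add: matrix_vector_mult_def Ck_on_sum Ck_on_bilinear[OF bounded_bilinear_mult] open_S
        Ck_on_component Ck_on_matrix_inv[OF open_S I.Ck_G I.det_G] Ck_g_along CkN Ck_dF)
  have dt: "(?t has_derivative dd ?t x) (at x)" by (rule Ck_on_has_derivative[OF Ckt x])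
  have dFt: "((\<lambda>z. dF z (?t z)) has_derivative (\<lambda>h. dd (\<lambda>z. dF z (?t x)) x h + dF x (dd ?t x h))) (at x)"
    by (rule linear_has_derivative_family[OF open_S x linear_dF dF_differentiable[OF x] dt])
  have e: "cov ?u (normal_connection G F b N) x = cov ?u (\<lambda>z. cov ?v N z - dF z (?t z)) x"
    unfolding cov_def[of ?u "normal_connection G F b N"] cov_def[of ?u "\<lambda>z. cov ?v N z - dF z (?t z)"]
    using dd_cong[OF open_S x, of "normal_connection G F b N" "\<lambda>z. cov ?v N z - dF z (?t z)" ?u]
    by (simp add: normal_connection_def cov_along_eq normal_part_eq x)
  also have "\<dots> = cov ?u (cov ?v N) x - cov ?u (\<lambda>z. dF z (?t z)) x"
    by (rule cov_diff[OF differentiable_if_Ck[OF CkN x]]) (use dFt in \<open>auto simp: differentiable_def\<close>)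
  also have "cov ?u (\<lambda>z. dF z (?t z)) x = cov ?u (\<lambda>z. dF z (?t x)) x + dF x (dd ?t x ?u)"
    unfolding cov_def[of ?u "\<lambda>z. dF z (?t z)"] cov_def[of ?u "\<lambda>z. dF z (?t x)"] dd_eq[OF dFt] by simp
  finally have "cov ?u (normal_connection G F b N) x
    = cov ?u (cov ?v N) x - (cov ?u (\<lambda>z. dF z (?t x)) x + dF x (dd ?t x ?u))" .
  then have "g (F x) (normal_connection G F a (normal_connection G F b N) x) \<eta>
    = g (F x) (cov ?u (cov ?v N) x) \<eta> - g (F x) (sff x ?u (?t x)) \<eta>"
    unfolding normal_connection_def[of G F a] cov_along_eq g_normal_part[OF x \<eta>]
    by (simp add: ginner_simps normalD(2)[OF x \<eta>] g_sff_normal[OF x \<eta>])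
  moreover have "sff x ?u (shape x \<xi> ?v) = - sff x ?u (?t x)"
    unfolding shape_def N_def by (rule linear_neg[OF linear_sff(2)[OF x]])
  ultimately show ?thesis by (simp add: ginner_simps)
qed

text \<open>On coordinate axes, antisymmetrising \<open>g_normal_connection_twice\<close> turns the
  second covariant derivatives into ambient curvature by \<open>cov_curvature\<close>. The right
  side is bilinear in \<open>u\<close> and \<open>v\<close>, which gives the general case.\<close>

theorem ricci_equation:
  assumes x: "x \<in> S" and \<xi>: "normal x \<xi>" and \<eta>: "normal x \<eta>"
  shows "normal_curvature G F x u v \<xi> \<eta> = g (F x) (riem G (F x) (dF x u) (dF x v) \<xi>) \<eta>
    + g (F x) (sff x u (shape x \<xi> v)) \<eta> - g (F x) (sff x v (shape x \<xi> u)) \<eta>"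
proof -
  define N where "N = (\<lambda>z. normal_part G F z \<xi>)"
  define R where "R u v = g (F x) (riem G (F x) (dF x u) (dF x v) \<xi>) \<eta>
    + g (F x) (sff x u (shape x \<xi> v)) \<eta> - g (F x) (sff x v (shape x \<xi> u)) \<eta>" for u v
  have shape_lin: "linear (shape x \<xi>)"
    by (rule linearI; rule I.g_nondegenerate[OF x])
      (simp_all add: induced_inner_shape[OF x \<xi>] ginner_simps linear_add[OF linear_sff(1)[OF x]] linear_cmul[OF linear_sff(1)[OF x]])
  have l: "linear (\<lambda>u. R u v)" "linear (R u)" for u v
    unfolding R_def
    by (rule linearI; simp add: ginner_simps linear_add[OF linear_riem_left(1)] linear_add[OF linear_riem_left(2)] linear_cmul[OF linear_riem_left(1)] linear_cmul[OF linear_riem_left(2)]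
          linear_add[OF linear_dF[OF x]] linear_cmul[OF linear_dF[OF x]] linear_add[OF shape_lin] linear_cmul[OF shape_lin]
          linear_add[OF linear_sff(1)[OF x]] linear_cmul[OF linear_sff(1)[OF x]]
          linear_add[OF linear_sff(2)[OF x]] linear_cmul[OF linear_sff(2)[OF x]] algebra_simps)+
  have "g (F x) (normal_connection G F a (normal_connection G F b N) x - normal_connection G F b (normal_connection G F a N) x) \<eta>
    = R (axis a 1) (axis b 1)" for a b
  proof -
    have "N x = \<xi>" by (simp add: N_def normal_part_of_normal[OF x \<xi>])
    then have "g (F x) (riem G (F x) (dF x (axis a 1)) (dF x (axis b 1)) \<xi>) \<eta>
       = g (F x) (cov (axis a 1) (cov (axis b 1) N) x) \<eta> - g (F x) (cov (axis b 1) (cov (axis a 1) N) x) \<eta>"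
      using cov_curvature[OF x, of N "axis a 1" "axis b 1"] Ck_normal_extension[of 2 \<xi>]
      by (simp add: N_def ginner_simps flip: ginner_simps(3))
    then show ?thesis
      unfolding ginner_simps g_normal_connection_twice[OF x \<xi> \<eta>, folded N_def] R_def by simp
  qed
  then have "normal_curvature G F x u v \<xi> \<eta> = (\<Sum>a\<in>UNIV. \<Sum>b\<in>UNIV. (u $ a * v $ b) *\<^sub>R R (axis a 1) (axis b 1))"
    by (simp add: normal_curvature_def Let_def flip: N_def)
  also have "\<dots> = R u v" by (rule bilinear_axis_expand[OF l, symmetric])
  finally show ?thesis by (simp add: R_def)
qed

text \<open>The matrix \<open>M\<close>, the sum of the products of each e_i with its transpose,
  inverts the induced metric: M gam v = v is the expansion of \<open>v\<close> in the frame.\<close>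

lemma mean_curvature_eq:
  assumes x: "x \<in> S" and e: "tangent_frame G F x e"
  shows "mean_curvature G F x = (1 / real CARD('n)) *\<^sub>R (\<Sum>i=1..CARD('n). sff x (e i) (e i))"
proof -
  let ?n = "CARD('n)"
  define M :: "real^'n^'n" where "M = (\<chi> a b. \<Sum>i=1..?n. e i $ a * e i $ b)"
  have Mw: "M *v w = (\<Sum>i=1..?n. (e i \<bullet> w) *\<^sub>R e i)" for w
    unfolding vec_eq_iff
  proof
    fix a
    have "(M *v w) $ a = (\<Sum>b\<in>UNIV. \<Sum>i=1..?n. e i $ a * e i $ b * w $ b)"
      by (simp add: M_def matrix_vector_mult_def sum_distrib_right)
    also have "\<dots> = (\<Sum>i=1..?n. \<Sum>b\<in>UNIV. e i $ a * e i $ b * w $ b)" by (rule sum.swap)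
    finally show "(M *v w) $ a = (\<Sum>i=1..?n. (e i \<bullet> w) *\<^sub>R e i) $ a"
      by (simp add: inner_vec_def sum_distrib_left mult_ac)
  qed
  have "(M ** gam x) *v v = v" for v
  proof -
    have "(M ** gam x) *v v = (\<Sum>i=1..?n. I.g x (e i) v *\<^sub>R e i)"
      unfolding matrix_vector_mul_assoc[symmetric] ginner_def Mw ..
    then show ?thesis using tangent_expand[OF e, of v] I.g_commute[OF x] by simp
  qed
  then have "M ** gam x = mat 1" by (simp add: matrix_eq)
  then have "M ** (gam x ** matrix_inv (gam x)) = matrix_inv (gam x)"
    by (simp add: matrix_mul_assoc)
  then have "M = matrix_inv (gam x)"
    by (simp add: matrix_inv_mult_right[OF I.invertible_G[OF x]])
  then have inv: "matrix_inv (gam x) $ a $ b = (\<Sum>i=1..?n. e i $ a * e i $ b)" for a b by (simp add: M_def flip: \<open>M = matrix_inv (gam x)\<close>)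
  have "(\<Sum>i=1..?n. sff x (e i) (e i)) = (\<Sum>i=1..?n. \<Sum>a\<in>UNIV. \<Sum>b\<in>UNIV. (e i $ a * e i $ b) *\<^sub>R sff x (axis a 1) (axis b 1))"
    by (rule sum.cong[OF refl], rule bilinear_axis_expand[OF linear_sff[OF x]])
  also have "\<dots> = (\<Sum>a\<in>UNIV. \<Sum>i=1..?n. \<Sum>b\<in>UNIV. (e i $ a * e i $ b) *\<^sub>R sff x (axis a 1) (axis b 1))"
    by (rule sum.swap)
  also have "\<dots> = (\<Sum>a\<in>UNIV. \<Sum>b\<in>UNIV. \<Sum>i=1..?n. (e i $ a * e i $ b) *\<^sub>R sff x (axis a 1) (axis b 1))"
    by (rule sum.cong[OF refl], rule sum.swap)
  also have "\<dots> = (\<Sum>a\<in>UNIV. \<Sum>b\<in>UNIV. matrix_inv (gam x) $ a $ b *\<^sub>R second_ff G F a b x)"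
    by (simp add: inv second_ff_eq[OF x] scaleR_sum_left)
  finally show ?thesis by (simp add: mean_curvature_def)
qed

end

section \<open>The generalized Wintgen inequality at a minimal point\<close>

text \<open>Moves the inequality from finite index types to ranges of natural numbers. The
  codimension is not the cardinality of a type at hand and may be zero, so the family is padded by
  zero matrices (\<open>b\<close>) up to the size of a type that is large enough.\<close>

lemma ddvv_families:
  fixes a :: "nat \<Rightarrow> nat \<Rightarrow> nat \<Rightarrow> real"
  assumes sym: "\<And>r i j. a r i j = a r j i" and N: "N = CARD('n::finite)" and K: "K \<le> CARD('k::finite)"
  shows "(\<Sum>r=1..K. \<Sum>s=1..K. \<Sum>i=1..N. \<Sum>j=1..N. (\<Sum>l=1..N. a r i l * a s l j - a s i l * a r l j)\<^sup>2)
    \<le> (\<Sum>r=1..K. \<Sum>i=1..N. \<Sum>j=1..N. (a r i j)\<^sup>2)\<^sup>2"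
proof -
  have "\<exists>h. bij_betw h (UNIV :: 'n set) {1..N}"
    by (rule finite_same_card_bij) (simp_all add: N)
  then obtain \<alpha> where \<alpha>: "bij_betw \<alpha> (UNIV :: 'n set) {1..N}" ..
  have "\<exists>h. bij_betw h (UNIV :: 'k set) {1..CARD('k)}"
    by (rule finite_same_card_bij) simp_all
  then obtain \<kappa> where \<kappa>: "bij_betw \<kappa> (UNIV :: 'k set) {1..CARD('k)}" ..
  have sa: "(\<Sum>i\<in>UNIV. h (\<alpha> i)) = (\<Sum>i=1..N. h i)" for h :: "nat \<Rightarrow> real"
    by (rule sum.reindex_bij_betw[OF \<alpha>])
  have sk: "(\<Sum>r\<in>UNIV. h (\<kappa> r)) = (\<Sum>r=1..K. h r)" if "\<And>r. r > K \<Longrightarrow> h r = 0" for h :: "nat \<Rightarrow> real"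
  proof -
    have "(\<Sum>r\<in>UNIV. h (\<kappa> r)) = (\<Sum>r=1..CARD('k). h r)" by (rule sum.reindex_bij_betw[OF \<kappa>])
    also have "\<dots> = (\<Sum>r=1..K. h r)" by (rule sum.mono_neutral_right) (use K that in auto)
    finally show ?thesis .
  qed
  define b where "b r i j = (if r \<le> K then a r i j else 0)" for r i j
  define A :: "'k \<Rightarrow> real^'n^'n" where "A r = (\<chi> i j. b (\<kappa> r) (\<alpha> i) (\<alpha> j))" for r
  define C where "C r s i j = (\<Sum>l=1..N. b r i l * b s l j - b s i l * b r l j)" for r s i j
  have comm: "commutator (A r) (A s) $ i $ j = C (\<kappa> r) (\<kappa> s) (\<alpha> i) (\<alpha> j)" for r s i j
    unfolding C_def sa[symmetric] by (simp add: commutator_def matrix_matrix_mult_def A_def sum_subtractf)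
  have ip: "M \<bullet> M = (\<Sum>i\<in>UNIV. \<Sum>j\<in>UNIV. (M $ i $ j)\<^sup>2)" for M :: "real^'n^'n"
    by (simp add: inner_vec_def power2_eq_square)
  have C0: "C r s i j = 0" if "r > K \<or> s > K" for r s i j using that by (auto simp: C_def b_def)
  have "transpose (A r) = A r" for r
    by (simp add: A_def b_def transpose_def vec_eq_iff sym[of _ "\<alpha> _" "\<alpha> _"])
  note ddvv = ddvv_inequality[of A, OF this]
  have e1: "(\<Sum>i\<in>UNIV. \<Sum>j\<in>UNIV. H (\<alpha> i) (\<alpha> j)) = (\<Sum>i=1..N. \<Sum>j=1..N. H i j)" for H :: "nat \<Rightarrow> nat \<Rightarrow> real"
    using sa[of "\<lambda>i. \<Sum>j=1..N. H i j"] by (simp only: sa[of "H _"])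
  have e2: "(\<Sum>r\<in>UNIV. \<Sum>s\<in>UNIV. H (\<kappa> r) (\<kappa> s)) = (\<Sum>r=1..K. \<Sum>s=1..K. H r s)"
    if "\<And>r s. r > K \<or> s > K \<Longrightarrow> H r s = 0" for H :: "nat \<Rightarrow> nat \<Rightarrow> real"
  proof -
    have "(\<Sum>s\<in>UNIV. H r (\<kappa> s)) = (\<Sum>s=1..K. H r s)" for r
      by (rule sk[of "H r"]) (simp add: that)
    moreover have "(\<Sum>r\<in>UNIV. \<Sum>s=1..K. H (\<kappa> r) s) = (\<Sum>r=1..K. \<Sum>s=1..K. H r s)"
      by (rule sk[of "\<lambda>r. \<Sum>s=1..K. H r s"]) (simp add: that)
    ultimately show ?thesis by (simp only:)
  qed
  have cc: "commutator (A r) (A s) \<bullet> commutator (A r) (A s) = (\<Sum>i=1..N. \<Sum>j=1..N. (C (\<kappa> r) (\<kappa> s) i j)\<^sup>2)" for r s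
    unfolding ip comm by (rule e1[of "\<lambda>i j. (C (\<kappa> r) (\<kappa> s) i j)\<^sup>2"])
  have aa: "A r \<bullet> A r = (\<Sum>i=1..N. \<Sum>j=1..N. (b (\<kappa> r) i j)\<^sup>2)" for r
    unfolding ip e1[of "\<lambda>i j. (b (\<kappa> r) i j)\<^sup>2", symmetric] by (simp add: A_def)
  have "(\<Sum>r\<in>UNIV. \<Sum>s\<in>UNIV. commutator (A r) (A s) \<bullet> commutator (A r) (A s))
      = (\<Sum>r=1..K. \<Sum>s=1..K. \<Sum>i=1..N. \<Sum>j=1..N. (C r s i j)\<^sup>2)"
    unfolding cc by (rule e2[of "\<lambda>r s. \<Sum>i=1..N. \<Sum>j=1..N. (C r s i j)\<^sup>2"]) (simp add: C0)
  moreover have "(\<Sum>r\<in>UNIV. A r \<bullet> A r) = (\<Sum>r=1..K. \<Sum>i=1..N. \<Sum>j=1..N. (b r i j)\<^sup>2)"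
    unfolding aa by (rule sk[of "\<lambda>r. \<Sum>i=1..N. \<Sum>j=1..N. (b r i j)\<^sup>2"]) (simp add: b_def)
  ultimately have "(\<Sum>r=1..K. \<Sum>s=1..K. \<Sum>i=1..N. \<Sum>j=1..N. (C r s i j)\<^sup>2) \<le> (\<Sum>r=1..K. \<Sum>i=1..N. \<Sum>j=1..N. (b r i j)\<^sup>2)\<^sup>2"
    using ddvv by (simp only:)
  moreover have "(\<Sum>r=1..K. \<Sum>s=1..K. \<Sum>i=1..N. \<Sum>j=1..N. (C r s i j)\<^sup>2) =
    (\<Sum>r=1..K. \<Sum>s=1..K. \<Sum>i=1..N. \<Sum>j=1..N. (\<Sum>l=1..N. a r i l * a s l j - a s i l * a r l j)\<^sup>2)"
    by (intro sum.cong refl arg_cong[of _ _ "\<lambda>x. x\<^sup>2"]) (simp add: C_def b_def)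
  moreover have "(\<Sum>r=1..K. \<Sum>i=1..N. \<Sum>j=1..N. (b r i j)\<^sup>2) = (\<Sum>r=1..K. \<Sum>i=1..N. \<Sum>j=1..N. (a r i j)\<^sup>2)"
    by (intro sum.cong refl) (simp add: b_def)
  ultimately show ?thesis by simp
qed

lemma sum_ordered_pairs:
  fixes f :: "nat \<Rightarrow> nat \<Rightarrow> real"
  assumes sym: "\<And>i j. f i j = f j i"
  shows "2 * (\<Sum>(i,j) | 1 \<le> i \<and> i < j \<and> j \<le> n. f i j) = (\<Sum>i=1..n. \<Sum>j=1..n. f i j) - (\<Sum>i=1..n. f i i)"
proof (induction n)
  case 0
  have "{(i,j). 1 \<le> i \<and> i < j \<and> j \<le> (0::nat)} = {}" by auto
  then show ?case by (simp only:) simp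
next
  case (Suc n)
  let ?P = "\<lambda>n. {(i,j). 1 \<le> i \<and> i < j \<and> j \<le> (n::nat)}"
  have P: "?P (Suc n) = ?P n \<union> (\<lambda>i. (i, Suc n)) ` {1..n}" by (auto simp: le_Suc_eq)
  have fin: "finite (?P n)" by (rule finite_subset[of _ "{1..n} \<times> {1..n}"]) auto
  have "(\<Sum>(i,j)\<in>?P (Suc n). f i j) = (\<Sum>(i,j)\<in>?P n. f i j) + (\<Sum>(i,j)\<in>(\<lambda>i. (i, Suc n)) ` {1..n}. f i j)"
    unfolding P by (rule sum.union_disjoint[OF fin]) auto
  also have "(\<Sum>(i,j)\<in>(\<lambda>i. (i, Suc n)) ` {1..n}. f i j) = (\<Sum>i=1..n. f i (Suc n))"
    by (subst sum.reindex) (simp_all add: inj_on_def)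
  finally have e: "(\<Sum>(i,j)\<in>?P (Suc n). f i j) = (\<Sum>(i,j)\<in>?P n. f i j) + (\<Sum>i=1..n. f i (Suc n))" .
  have "(\<Sum>j=1..n. f (Suc n) j) = (\<Sum>j=1..n. f j (Suc n))"
    by (rule sum.cong[OF refl], rule sym)
  then show ?case
    unfolding e distrib_left Suc.IH by (simp add: sum.distrib)
qed

context submanifold_coords
begin

text \<open>For orthonormal vectors the denominator is 1 and the ambient curvature reduces to the
  two values of \<open>P\<close>; the products of second fundamental forms are expanded in the
  normal frame.\<close>

lemma sectional_curvature_gauss:
  assumes x: "x \<in> S" and e: "tangent_frame G F x e" and \<upsilon>: "normal_frame G F x \<upsilon>"
    and R: "\<And>a b c d. g (F x) (riem G (F x) a b c) d =
      - (g (F x) a d * P b c - g (F x) b d * P a c + g (F x) b c * P a d - g (F x) a c * P b d)"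
    and i: "i \<in> {1..CARD('n)}" and j: "j \<in> {1..CARD('n)}" and ij: "i \<noteq> j"
  defines "a \<equiv> \<lambda>r i j. g (F x) (sff x (e i) (e j)) (\<upsilon> r)"
  shows "sectional_curvature gam x (e i) (e j) =
    - (P (dF x (e i)) (dF x (e i)) + P (dF x (e j)) (dF x (e j)))
    + (\<Sum>r=1..CARD('m) - CARD('n). a r i i * a r j j - (a r i j)\<^sup>2)"
proof -
  have I: "I.g x (e p) (e q) = (if p = q then 1 else 0)" if "p \<in> {1..CARD('n)}" "q \<in> {1..CARD('n)}" for p q
    using e that unfolding tangent_frame_def by blast
  have hh: "g (F x) (sff x u v) (sff x u' v') = (\<Sum>r=1..CARD('m) - CARD('n). g (F x) (sff x u v) (\<upsilon> r) * g (F x) (sff x u' v') (\<upsilon> r))" for u v u' v'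
    using normal_parseval[OF x \<upsilon> normal_sff[OF x], of u v "sff x u' v'"]
    unfolding g_commute[OF F_in_U[OF x], of "\<upsilon> _"] .
  have "sectional_curvature gam x (e i) (e j) = I.g x (riem gam x (e i) (e j) (e j)) (e i)"
    unfolding sectional_curvature_def using I[OF i i] I[OF j j] I[OF i j] ij by simp
  also have "\<dots> = - (P (dF x (e i)) (dF x (e i)) + P (dF x (e j)) (dF x (e j)))
      + (\<Sum>r=1..CARD('m) - CARD('n). a r j j * a r i i) - (\<Sum>r=1..CARD('m) - CARD('n). a r i j * a r i j)"
    unfolding gauss_equation[OF x] R hh induced_inner[OF x, symmetric] sff_commute[OF x, of "e j" "e i"]
    using I[OF i i] I[OF j j] I[OF i j] I[OF j i] ij by (simp add: a_def)
  finally show ?thesis by (simp add: sum_subtractf power2_eq_square mult.commute)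
qed

text \<open>Every term of the ambient curvature contains a product of a tangent with a normal
  vector, so it vanishes. What remains of the Ricci equation is an entry of minus the commutator of
  the shape matrices.\<close>

lemma normal_curvature_ricci:
  assumes x: "x \<in> S" and e: "tangent_frame G F x e" and \<upsilon>: "normal_frame G F x \<upsilon>"
    and R: "\<And>a b c d. g (F x) (riem G (F x) a b c) d =
      - (g (F x) a d * P b c - g (F x) b d * P a c + g (F x) b c * P a d - g (F x) a c * P b d)"
    and r: "r \<in> {1..CARD('m) - CARD('n)}" and s: "s \<in> {1..CARD('m) - CARD('n)}"
  defines "a \<equiv> \<lambda>r i j. g (F x) (sff x (e i) (e j)) (\<upsilon> r)"
  shows "normal_curvature G F x (e i) (e j) (\<upsilon> r) (\<upsilon> s) = - (\<Sum>l=1..CARD('n). a r i l * a s l j - a s i l * a r l j)"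
proof -
  note nr = normal_frame_normal[OF \<upsilon> r] and ns = normal_frame_normal[OF \<upsilon> s]
  have sh: "g (F x) (sff x u (shape x (\<upsilon> r) v)) \<eta> = (\<Sum>l=1..CARD('n). g (F x) (sff x v (e l)) (\<upsilon> r) * g (F x) (sff x u (e l)) \<eta>)" for u v \<eta>
  proof -
    have "shape x (\<upsilon> r) v = (\<Sum>l=1..CARD('n). g (F x) (sff x v (e l)) (\<upsilon> r) *\<^sub>R e l)"
      using tangent_expand[OF e, of "shape x (\<upsilon> r) v"] unfolding induced_inner_shape[OF x nr] .
    then have "sff x u (shape x (\<upsilon> r) v) = (\<Sum>l=1..CARD('n). g (F x) (sff x v (e l)) (\<upsilon> r) *\<^sub>R sff x u (e l))"
      by (simp only: linear_sum[OF linear_sff(2)[OF x]] linear_cmul[OF linear_sff(2)[OF x]] o_def)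
    then show ?thesis by (simp add: ginner_sum_left ginner_simps)
  qed
  show ?thesis
    unfolding ricci_equation[OF x nr ns] R normalD(2)[OF x nr] normalD(2)[OF x ns] sh a_def
      sff_commute[OF x, of "e _" "e j"]
    by (simp add: sum_subtractf mult.commute)
qed

theorem wintgen_inequality_minimal:
  assumes x: "x \<in> S" and n: "CARD('n) \<ge> 2" and m: "CARD('m) \<ge> 3"
    and P: "\<And>u v. P u v = P v u" "\<And>u. linear (P u)"
    and R: "\<And>a b c d. g (F x) (riem G (F x) a b c) d =
      - (g (F x) a d * P b c - g (F x) b d * P a c + g (F x) b c * P a d - g (F x) a c * P b d)"
    and min: "minimal_at G F x" and e: "tangent_frame G F x e" and \<upsilon>: "normal_frame G F x \<upsilon>"
  shows "rho G F x e + rho_perp G F x e \<upsilon> \<le> ambient_term G F x e"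
proof -
  let ?n = "CARD('n)" and ?k = "CARD('m) - CARD('n)"
  define a where "a r i j = g (F x) (sff x (e i) (e j)) (\<upsilon> r)" for r i j
  define p where "p i = P (dF x (e i)) (dF x (e i))" for i
  define N where "N = (\<Sum>r=1..?k. \<Sum>i=1..?n. \<Sum>j=1..?n. (a r i j)\<^sup>2)"
  define c where "c r s i j = (\<Sum>l=1..?n. a r i l * a s l j - a s i l * a r l j)" for r s i j
  define s where "s = (\<Sum>i=1..?n. p i)"
  have N0: "N \<ge> 0" by (simp add: N_def sum_nonneg)
  have asym: "a r i j = a r j i" for r i j by (simp add: a_def sff_commute[OF x, of "e i" "e j"])
  have tr: "(\<Sum>i=1..?n. a r i i) = 0" for r
  proof -
    have "(\<Sum>i=1..?n. sff x (e i) (e i)) = 0"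
      using min unfolding minimal_at_def mean_curvature_eq[OF x e] by simp
    then show ?thesis unfolding a_def ginner_sum_left[symmetric] by (simp add: ginner_simps)
  qed
  define q where "q i j = - (p i + p j) + (\<Sum>r=1..?k. a r i i * a r j j - (a r i j)\<^sup>2)" for i j
  \<comment> \<open>By \<open>tr\<close> the products a_ii a_jj cancel in the full double sum, which
    becomes -2 n s - N; removing the diagonal adds 2 s.\<close>
  have q: "2 * (\<Sum>(i,j) | 1 \<le> i \<and> i < j \<and> j \<le> ?n. q i j) = - 2 * (real ?n - 1) * s - N"
  proof -
    have d: "q i i = - 2 * p i" for i by (simp add: q_def power2_eq_square)
    have "(\<Sum>i=1..?n. \<Sum>j=1..?n. \<Sum>r=1..?k. a r i i * a r j j) = (\<Sum>i=1..?n. \<Sum>r=1..?k. a r i i * (\<Sum>j=1..?n. a r j j))"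
      unfolding sum_distrib_left by (rule sum.cong[OF refl], rule sum.swap)
    then have 1: "(\<Sum>i=1..?n. \<Sum>j=1..?n. \<Sum>r=1..?k. a r i i * a r j j) = 0" by (simp only: tr mult_zero_right sum.neutral_const)
    have "(\<Sum>i=1..?n. \<Sum>j=1..?n. \<Sum>r=1..?k. (a r i j)\<^sup>2) = (\<Sum>i=1..?n. \<Sum>r=1..?k. \<Sum>j=1..?n. (a r i j)\<^sup>2)"
      by (rule sum.cong[OF refl], rule sum.swap)
    also have "\<dots> = N" unfolding N_def by (rule sum.swap)
    finally have 2: "(\<Sum>i=1..?n. \<Sum>j=1..?n. \<Sum>r=1..?k. (a r i j)\<^sup>2) = N" .
    have 3: "(\<Sum>i=1..?n. \<Sum>j=1..?n. p i + p j) = 2 * real ?n * s"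
      by (simp add: sum.distrib s_def flip: sum_distrib_left)
    have "(\<Sum>i=1..?n. \<Sum>j=1..?n. q i j) = - (2 * real ?n * s) - N"
      unfolding q_def sum.distrib[of "\<lambda>j. - (p _ + p j)"] sum_subtractf sum_negf
      unfolding sum.distrib[of "\<lambda>i. - (\<Sum>j=1..?n. p i + p j)"] sum_subtractf sum_negf 1 2 3 by simp
    moreover have "(\<Sum>i=1..?n. q i i) = - 2 * s" by (simp add: d s_def sum_distrib_left sum_negf)
    moreover have "q i j = q j i" for i j by (simp add: q_def asym[of _ i j] mult.commute add.commute)
    ultimately show ?thesis by (subst sum_ordered_pairs) (simp_all add: algebra_simps)
  qed
  have rho: "rho G F x e = 2 / (real ?n * (real ?n - 1)) * (\<Sum>(i,j) | 1 \<le> i \<and> i < j \<and> j \<le> ?n. q i j)"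
    unfolding rho_def
    by (rule arg_cong, rule sum.cong[OF refl])
      (auto simp: q_def p_def a_def sectional_curvature_gauss[OF x e \<upsilon> R])
  have cs: "(c r s i j)\<^sup>2 = (c s r i j)\<^sup>2" for r s i j
  proof -
    have "c r s i j = - c s r i j" by (simp add: c_def flip: sum_negf)
    then show ?thesis by simp
  qed
  have cneg: "c r s i j = - c r s j i" for r s i j
  proof -
    have "a r i l * a s l j - a s i l * a r l j = - (a r j l * a s l i - a s j l * a r l i)" for l
      unfolding asym[of r i l] asym[of s l j] asym[of s i l] asym[of r l j] by (simp add: mult.commute)
    then show ?thesis unfolding c_def sum_negf[symmetric] by (rule sum.cong[OF refl])
  qed
  then have ci: "(c r s i j)\<^sup>2 = (c r s j i)\<^sup>2" for r s i j by (metis power2_minus)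
  have c0: "c r r i j = 0" "c r s i i = 0" for r s i j
    using cneg[of r s i i] by (simp_all add: c_def)
  define Q where "Q = (\<Sum>(i,j) | 1 \<le> i \<and> i < j \<and> j \<le> ?n. \<Sum>(r,s) | 1 \<le> r \<and> r < s \<and> s \<le> ?k. (c r s i j)\<^sup>2)"
  \<comment> \<open>One factor 2 for each of the pairs i < j and r < s: the squares are symmetric in
    both pairs and vanish on the diagonals. This is why \<open>Q\<close> is bounded by
    (N/2)^2.\<close>
  have "2 * (2 * Q) = 2 * (\<Sum>(i,j) | 1 \<le> i \<and> i < j \<and> j \<le> ?n. \<Sum>r=1..?k. \<Sum>s=1..?k. (c r s i j)\<^sup>2)"
  proof -
    have "2 * Q = (\<Sum>(i,j) | 1 \<le> i \<and> i < j \<and> j \<le> ?n. 2 * (\<Sum>(r,s) | 1 \<le> r \<and> r < s \<and> s \<le> ?k. (c r s i j)\<^sup>2))"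
      by (simp add: Q_def sum_distrib_left split_beta)
    also have "\<dots> = (\<Sum>(i,j) | 1 \<le> i \<and> i < j \<and> j \<le> ?n. \<Sum>r=1..?k. \<Sum>s=1..?k. (c r s i j)\<^sup>2)"
      by (subst sum_ordered_pairs) (simp_all add: cs c0)
    finally show ?thesis by simp
  qed
  also have "\<dots> = (\<Sum>i=1..?n. \<Sum>j=1..?n. \<Sum>r=1..?k. \<Sum>s=1..?k. (c r s i j)\<^sup>2)"
    by (subst sum_ordered_pairs) (auto simp: c0 intro!: sum.cong ci)
  also have "\<dots> = (\<Sum>r=1..?k. \<Sum>s=1..?k. \<Sum>i=1..?n. \<Sum>j=1..?n. (c r s i j)\<^sup>2)"
    by (simp only: sum.swap[of _ "{1..?k}" "{1..?n}"])
  also have "\<dots> \<le> N\<^sup>2"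
    unfolding c_def N_def by (rule ddvv_families[where 'n = 'n and 'k = 'm]) (simp_all add: asym)
  finally have Q: "Q \<le> (N / 2)\<^sup>2" by (simp add: power_divide)
  have nc: "(normal_curvature G F x (e i) (e j) (\<upsilon> r) (\<upsilon> s))\<^sup>2 = (c r s i j)\<^sup>2"
    if "r \<in> {1..?k}" "s \<in> {1..?k}" for r s i j
    unfolding normal_curvature_ricci[OF x e \<upsilon> R that] c_def a_def power2_minus ..
  have "(\<Sum>(r,s) | 1 \<le> r \<and> r < s \<and> s \<le> ?k. (normal_curvature G F x (e i) (e j) (\<upsilon> r) (\<upsilon> s))\<^sup>2)
      = (\<Sum>(r,s) | 1 \<le> r \<and> r < s \<and> s \<le> ?k. (c r s i j)\<^sup>2)" for i j
    by (rule sum.cong[OF refl]) (auto simp: nc)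
  then have rp: "rho_perp G F x e \<upsilon> = 2 / (real ?n * (real ?n - 1)) * sqrt Q"
    unfolding rho_perp_def Q_def by (simp only:)
  \<comment> \<open>This N/2 cancels exactly the contribution of the second fundamental form to
    \<open>rho\<close>, leaving only the ambient part.\<close>
  have "sqrt Q \<le> N / 2" using Q N0 by (intro real_le_lsqrt) auto
  moreover have "(\<Sum>(i,j) | 1 \<le> i \<and> i < j \<and> j \<le> ?n. q i j) = (- 2 * (real ?n - 1) * s - N) / 2"
    unfolding q[symmetric] by (rule nonzero_mult_div_cancel_left[symmetric]) (rule zero_neq_numeral[symmetric])
  ultimately have "(\<Sum>(i,j) | 1 \<le> i \<and> i < j \<and> j \<le> ?n. q i j) + sqrt Q \<le> (- 2 * (real ?n - 1) * s - N) / 2 + N / 2"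
    by (intro add_mono) (simp_all only: order_refl)
  moreover have "2 / (real ?n * (real ?n - 1)) \<ge> 0" using n by simp
  ultimately have "rho G F x e + rho_perp G F x e \<upsilon>
      \<le> 2 / (real ?n * (real ?n - 1)) * ((- 2 * (real ?n - 1) * s - N) / 2 + N / 2)"
    unfolding rho rp distrib_left[symmetric] by (rule mult_left_mono)
  also have "\<dots> = - 2 / real ?n * s" using n by (simp add: field_simps)
  also have "\<dots> = ambient_term G F x e"
  proof -
    note rt = ricci_tau_of_conformally_flat_metric[OF F_in_U[OF x] P R]
    define t where "t = (\<Sum>i\<in>UNIV. \<Sum>j\<in>UNIV. matrix_inv (G (F x)) $ i $ j * P (axis i 1) (axis j 1))"
    have one: "g (F x) (dF x (e j)) (dF x (e j)) = 1" if "j \<in> {1..?n}" for j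
      using e that unfolding tangent_frame_def induced_inner[OF x] by auto
    have "(\<Sum>j=1..?n. ricci G (F x) (dF x (e j)) (dF x (e j))) = (\<Sum>j=1..?n. - ((real CARD('m) - 2) * p j + t))"
      by (rule sum.cong[OF refl]) (simp add: rt(1) one p_def t_def)
    also have "\<dots> = - ((real CARD('m) - 2) * s + real ?n * t)"
      by (simp only: sum_negf sum.distrib sum_distrib_left[symmetric] s_def) simp
    finally have r: "(\<Sum>j=1..?n. ricci G (F x) (dF x (e j)) (dF x (e j))) = - ((real CARD('m) - 2) * s + real ?n * t)" .
    \<comment> \<open>Applied with k = n, b = m - 2, c = m - 1. The coefficients of the ambient
      condition are such that the trace \<open>t\<close> from the Ricci terms cancels the one from
      the scalar curvature.\<close>
    have gen: "- 2 / k * s = 2 / (k * b) * - (b * s + k * t) - 2 * (- c * t) / (c * b)"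
      if "k \<noteq> 0" "b \<noteq> 0" "c \<noteq> 0" for k b c :: real
      using that by (simp add: field_simps)
    show ?thesis
      unfolding ambient_term_def r rt(2) t_def[symmetric]
    proof (rule gen)
      show "real ?n \<noteq> 0" "real CARD('m) - 2 \<noteq> 0" "real CARD('m) - 1 \<noteq> 0" using m by auto
    qed
  qed
  finally show ?thesis .
qed

end

section \<open>Passage to charts\<close>

lemma smooth_manifold_chart:
  assumes X: "smooth_manifold X A" and c: "c \<in> A"
  shows "openin X (fst c)" and "\<And>q. q \<in> fst c \<Longrightarrow> chart_inv c (snd c q) = q"
    and "\<And>T. openin X T \<Longrightarrow> open (snd c ` (fst c \<inter> T))"
proof -
  have *: "openin X (fst c)" "open (snd c ` fst c)"
    "homeomorphic_map (subtopology X (fst c)) (top_of_set (snd c ` fst c)) (snd c)"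
    using X c unfolding smooth_manifold_def by (auto simp: case_prod_beta)
  show "openin X (fst c)" by (rule *)
  have sub: "fst c \<subseteq> topspace X" using *(1) openin_subset by blast
  have "inj_on (snd c) (fst c)"
    using homeomorphic_imp_injective_map[OF *(3)] sub by (simp add: Int_absorb1)
  then show "chart_inv c (snd c q) = q" if "q \<in> fst c" for q
    unfolding chart_inv_def using that by (rule inv_into_f_f)
  show "open (snd c ` (fst c \<inter> T))" if T: "openin X T" for T
  proof -
    have "openin (subtopology X (fst c)) (fst c \<inter> T)"
      using T by (auto simp: openin_subtopology)
    then have "openin (top_of_set (snd c ` fst c)) (snd c ` (fst c \<inter> T))"
      using homeomorphic_imp_open_map[OF *(3)] by (simp add: open_map_def)
    then show ?thesis using *(2) openin_open_trans by blast
  qed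
qed

text \<open>The conformal factor exists only on a neighbourhood \<open>W\<close> of
  \<open>f p\<close>, so the chart around \<open>f p\<close> is cut down to \<open>W\<close>, and
  the chart around \<open>p\<close> to the points that \<open>f\<close> sends into it.\<close>

lemma immersion_local_form:
  fixes X :: "'a topology" and A :: "('a, 'n::finite) chart set"
    and Y :: "'b topology" and B :: "('b, 'm::finite) chart set"
    and g :: "('b, 'm) metric_components"
  assumes X: "smooth_manifold X A" and Y: "smooth_manifold Y B"
    and g: "riemannian_metric B g" and flat: "conformally_flat Y B g"
    and f: "immersion X A Y B f" and p: "p \<in> topspace X" and co: "coordinates_at A B g f p G F x"
  shows "\<exists>U S. submanifold_coords U G S F \<and> x \<in> S \<and>
    (\<exists>P. (\<forall>u v. P u v = P v u) \<and> (\<forall>u. linear (P u)) \<and>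
      (\<forall>a b c d. ginner G (F x) (riem G (F x) a b c) d =
        - (ginner G (F x) a d * P b c - ginner G (F x) b d * P a c
          + ginner G (F x) b c * P a d - ginner G (F x) a c * P b d)))"
proof -
  obtain c d where c: "c \<in> A" "p \<in> fst c" and d: "d \<in> B" "f p \<in> fst d"
    and x: "x = snd c p" and F: "F = snd d \<circ> f \<circ> chart_inv c" and G: "G = g d"
    using co unfolding coordinates_at_def by blast
  note cX = smooth_manifold_chart[OF X c(1)] and dY = smooth_manifold_chart[OF Y d(1)]
  have cf: "continuous_map X Y f" using f by (simp add: immersion_def)
  have "f p \<in> topspace Y" using dY(1) d(2) openin_subset by blast
  from bspec[OF flat[unfolded conformally_flat_def] this] obtain W and u :: "'b \<Rightarrow> real"
    where Wu: "openin Y W \<and> f p \<in> W \<and> (\<forall>d\<in>B. smooth_on (snd d ` (fst d \<inter> W)) (u \<circ> chart_inv d)) \<and>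
      (\<forall>d\<in>B. \<forall>y\<in>snd d ` (fst d \<inter> W). \<forall>v1 v2 v3. riem (\<lambda>z. exp (2 * u (chart_inv d z)) *\<^sub>R g d z) y v1 v2 v3 = 0)"
    by (elim exE) (rule that)
  have W: "openin Y W" "f p \<in> W" using Wu by (simp_all only:)
  have u: "smooth_on (snd d ` (fst d \<inter> W)) (u \<circ> chart_inv d)"
    by (rule bspec[OF conjunct1[OF conjunct2[OF conjunct2[OF Wu]]] d(1)])
  have R0: "\<forall>y\<in>snd d ` (fst d \<inter> W). \<forall>v1 v2 v3. riem (\<lambda>z. exp (2 * u (chart_inv d z)) *\<^sub>R g d z) y v1 v2 v3 = 0"
    by (rule bspec[OF conjunct2[OF conjunct2[OF conjunct2[OF Wu]]] d(1)])
  define U where "U = snd d ` (fst d \<inter> W)"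
  define S where "S = snd c ` (fst c \<inter> {q \<in> topspace X. f q \<in> fst d \<inter> W})"
  have metric: "smooth_on (snd d ` fst d) (g d)"
    "\<And>y. y \<in> snd d ` fst d \<Longrightarrow> transpose (g d y) = g d y"
    "\<And>y v. y \<in> snd d ` fst d \<Longrightarrow> v \<noteq> 0 \<Longrightarrow> ginner (g d) y v v > 0"
    using bspec[OF conjunct1[OF g[unfolded riemannian_metric_def]] d(1)] by blast+
  have US: "U \<subseteq> snd d ` fst d" by (auto simp: U_def)
  have SS: "S \<subseteq> snd c ` (fst c \<inter> f -` fst d)" by (auto simp: S_def)
  have imm: "smooth_on (snd c ` (fst c \<inter> f -` fst d)) F"
    "\<And>z. z \<in> snd c ` (fst c \<inter> f -` fst d) \<Longrightarrow> inj (differential F z)"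
    using f c(1) d(1) unfolding immersion_def F by (auto simp: Let_def)
  interpret submanifold_coords U G S F
  proof
    show "open U" unfolding U_def by (rule dY(3)[OF W(1)])
    show "Ck_on k U G" for k
      unfolding G by (rule Ck_on_subset[OF metric(1)[unfolded smooth_on_def, rule_format] US])
    show "transpose (G y) = G y" if "y \<in> U" for y
      unfolding G using metric(2) US that by blast
    show "ginner G y v v > 0" if "y \<in> U" "v \<noteq> 0" for y v
      unfolding G using metric(3) US that by blast
    have "openin X {q \<in> topspace X. f q \<in> fst d \<inter> W}"
      by (rule openin_continuous_map_preimage[OF cf]) (intro openin_Int dY(1) W(1))
    then show "open S" unfolding S_def by (rule cX(3))
    show "Ck_on k S F" for k
      by (rule Ck_on_subset[OF imm(1)[unfolded smooth_on_def, rule_format] SS])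
    show "F z \<in> U" if "z \<in> S" for z
      using that cX(2) by (auto simp: S_def U_def F)
    show "inj (differential F z)" if "z \<in> S" for z
      using imm(2) SS that by blast
  qed
  have xS: "x \<in> S" using c d W p by (auto simp: S_def x)
  define \<phi> where "\<phi> z = u (chart_inv d z)" for z
  have "Ck_on k U \<phi>" for k
    using u by (simp add: smooth_on_def o_def U_def \<phi>_def[abs_def])
  moreover have "riem (\<lambda>z. exp (2 * \<phi> z) *\<^sub>R G z) (F x) a b c = 0" for a b c
    unfolding \<phi>_def G using R0 F_in_U[OF xS, unfolded U_def] by blast
  ultimately show ?thesis
    by (intro exI[of _ U] exI[of _ S] conjI submanifold_coords_axioms xS
        curvature_of_conformally_flat_metric[OF _ F_in_U[OF xS], of \<phi>])
qed

theorem corollary3p6: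
  fixes X :: "'a topology" and A :: "('a, 'n::finite) chart set"
    and Y :: "'b topology" and B :: "('b, 'm::finite) chart set"
    and g :: "('b, 'm) metric_components"
  assumes "smooth_manifold X A" and "CARD('n) \<ge> 3"
    and "smooth_manifold Y B" and "CARD('m) \<ge> 4"
    and "riemannian_metric B g" and "conformally_flat Y B g"
  shows
    "(\<forall>f. immersion X A Y B f \<longrightarrow> ambient_condition X A B g f \<longrightarrow>
        (\<forall>p\<in>topspace X. \<forall>G F x e \<upsilon>.
           coordinates_at A B g f p G F x \<longrightarrow> tangent_frame G F x e \<longrightarrow> normal_frame G F x \<upsilon> \<longrightarrow>
           rho G F x e + rho_perp G F x e \<upsilon> > 0 \<longrightarrow> \<not> minimal_at G F x)) \<and>
     \<not> (\<exists>f. minimal_immersion X A Y B g f \<and> ambient_condition X A B g f \<and>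
          (\<forall>p\<in>topspace X. \<forall>G F x e \<upsilon>.
             coordinates_at A B g f p G F x \<longrightarrow> tangent_frame G F x e \<longrightarrow> normal_frame G F x \<upsilon> \<longrightarrow>
             rho G F x e + rho_perp G F x e \<upsilon> > 0))"
proof -
  note local_form = immersion_local_form[OF assms(1,3,5,6)]
  have not_minimal: "\<not> minimal_at G F x"
    if f: "immersion X A Y B f" and amb: "ambient_condition X A B g f" and p: "p \<in> topspace X"
      and co: "coordinates_at A B g f p G F x" and e: "tangent_frame G F x e" and \<upsilon>: "normal_frame G F x \<upsilon>"
      and pos: "rho G F x e + rho_perp G F x e \<upsilon> > 0" for f p G F x e \<upsilon>
  proof
    assume min: "minimal_at G F x"
    obtain U S P where sub: "submanifold_coords U G S F" and x: "x \<in> S"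
      and P: "\<forall>u v. P u v = P v u" "\<forall>u. linear (P u)" and R:
      "\<forall>a b c d. ginner G (F x) (riem G (F x) a b c) d =
        - (ginner G (F x) a d * P b c - ginner G (F x) b d * P a c
          + ginner G (F x) b c * P a d - ginner G (F x) a c * P b d)"
      using local_form[OF f p co] by blast
    have "rho G F x e + rho_perp G F x e \<upsilon> \<le> ambient_term G F x e"
      by (rule submanifold_coords.wintgen_inequality_minimal[OF sub x _ _ P[rule_format] R[rule_format] min e \<upsilon>])
        (use assms(2,4) in simp_all)
    moreover have "ambient_term G F x e \<le> 0"
      using amb p co e unfolding ambient_condition_def by blast
    ultimately show False using pos by simp
  qed
  moreover have False
    if f: "minimal_immersion X A Y B g f" and amb: "ambient_condition X A B g f"
      and pos: "\<forall>p\<in>topspace X. \<forall>G F x e \<upsilon>.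
             coordinates_at A B g f p G F x \<longrightarrow> tangent_frame G F x e \<longrightarrow> normal_frame G F x \<upsilon> \<longrightarrow>
             rho G F x e + rho_perp G F x e \<upsilon> > 0" for f
  proof -
    have imm: "immersion X A Y B f" using f by (simp add: minimal_immersion_def)
    \<comment> \<open>Minimality and positivity are assumed for all points, charts and frames; a
      manifold is nonempty by definition, so one choice of these can be made to set them against
      each other.\<close>
    obtain p where p: "p \<in> topspace X" using assms(1) unfolding smooth_manifold_def by blast
    have "f p \<in> topspace Y"
      using imm p by (auto simp: immersion_def continuous_map_def)
    then obtain c d where "c \<in> A" "p \<in> fst c" "d \<in> B" "f p \<in> fst d"
      using assms(1,3) p unfolding smooth_manifold_def by blast
    then have co: "coordinates_at A B g f p (g d) (snd d \<circ> f \<circ> chart_inv c) (snd c p)"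
      unfolding coordinates_at_def by blast
    obtain U S where sub: "submanifold_coords U (g d) S (snd d \<circ> f \<circ> chart_inv c)" and x: "snd c p \<in> S"
      using local_form[OF imm p co] by blast
    obtain e where e: "tangent_frame (g d) (snd d \<circ> f \<circ> chart_inv c) (snd c p) e"
      using submanifold_coords.tangent_frame_exists[OF sub x] ..
    obtain \<upsilon> where \<upsilon>: "normal_frame (g d) (snd d \<circ> f \<circ> chart_inv c) (snd c p) \<upsilon>"
      using submanifold_coords.normal_frame_exists[OF sub x] ..
    have "\<not> minimal_at (g d) (snd d \<circ> f \<circ> chart_inv c) (snd c p)"
      using not_minimal[OF imm amb p co e \<upsilon>] pos p co e \<upsilon> by blast
    then show False using f p co unfolding minimal_immersion_def by blast
  qed
  ultimately show ?thesis by blast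
qed

end
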